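(* Let $f_1,f_2:\mathbb R^+\to\mathbb R^+$ be continuous and strictly increasing with $f_i(x)>0$ for $x>0$, $i=1,2$, and let $K>0$. Let $h_i:\mathbb R^+\to\mathbb R$ ($i=1,2$) be Lebesgue measurable with $h_i(t)\le t$ and $\lim_{t\to\infty}h_i(t)=\infty$. For $i=1,2$ let $R_i(t,\cdot)$ be left continuous and non-decreasing for any $t$, let $R_i(\cdot,s)$ be locally integrable for any $s$, let $R_i(t,s)=0$ for $s\le h_i(t)$ and $R_i(t,t^+)=1$, and let $r_i$ be a Lebesgue measurable essentially bounded function on $\mathbb R^+$ with $r_i(t)\ge 0$ and $\int_0^\infty r_i(s)\,ds=\infty$. Let $\varphi,\psi:(-\infty,0]\to\mathbb R$ be continuous bounded functions with $\varphi(t)\ge 0$, $\psi(t)\ge 0$ for $t<0$ and $\varphi(0)>0$, $\psi(0)>0$. Consider the initial value problem (P) described in the context. 1) If $f_2(x)<f_1^{-1}(x)$ for any $x>0$, $x\ne K$, and $f_2(K)=f_1^{-1}(K)$, then any solution of (P) with initial functions satisfying $\varphi(t)\ge K$, $\psi(t)\ge f_2(K)$ for all $t\le0$ tends to $(K,f_2(K))$ as $t\to\infty$, while any solution of (P) with initial functions satisfying $\varphi(t)<K$, $\psi(t)<f_2(K)$ for all $t\le 0$ converges to zero (both components) as $t\to\infty$. 2) If $f_2(x)>f_1^{-1}(x)$ for any $x>0$, $x\ne K$, and $f_2(K)=f_1^{-1}(K)$, then any solution of (P) with initial functions satisfying $\varphi(t)\ge K$, $\psi(t)\ge f_2(K)$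 for all $t\le0$ tends to $+\infty$ (both components) as $t\to\infty$ (or as $t\to c^-$, where $c$ is a finite right end of the maximal interval of existence of the solution), while any solution of (P) with initial functions satisfying $\varphi(t)<K$, $\psi(t)<f_2(K)$ for all $t\le 0$ converges to $(K,f_2(K))$ as $t\to\infty$.
   Context: $\mathbb R^+=[0,\infty)$; $u(t^+)$ is the right-side limit of $u$ at $t$. Problem (P) is the system $$x'(t)=r_1(t)\left[\int_{h_1(t)}^t f_1(y(s))\,d_sR_1(t,s)-x(t)\right],\quad y'(t)=r_2(t)\left[\int_{h_2(t)}^t f_2(x(s))\,d_sR_2(t,s)-y(t)\right]$$ with the initial conditions $x(t)=\varphi(t)$, $y(t)=\psi(t)$ for $t\le 0$. The integrals are Stieltjes integrals in $s$ over $[h_i(t),t]$ including the endpoint atoms, i.e. with respect to the probability measure on $[h_i(t),t]$ with (left continuous) distribution function $R_i(t,\cdot)$. A solution is a pair $(x,y)$, locally absolutely continuous on its maximal interval of existence $[0,c)$, $0<c\le\infty$, which satisfies the system for almost all $t\in[0,c)$ and the initial conditions for $t\le0$. Convention: $f_1^{-1}$ is the inverse of $f_1$ on its range, $f_1^{-1}(x)=0$ for $0\le x<f_1(0)$, and $f_1^{-1}(x)=+\infty$ for $x$ above the range of $f_1$.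
   Formalization: In both claims with φ(t) ≥ K, ψ(t) ≥ f₂(K), it is additionally assumed that (φ(0),ψ(0)) ≠ (K,f₂(K)); otherwise the constant solution refutes the claim in 2), and non-unique solutions leaving the equilibrium refute it in 1). *)

theory Defs
  imports "HOL-Analysis.Analysis"
begin

text \<open>
  The half-line \<open>[0,\<infinity>)\<close> is \<open>{0..}\<close>. Functions with a smaller domain are total here; their values
  outside the domain are unconstrained.
\<close>

definition production_function :: "(real \<Rightarrow> real) \<Rightarrow> bool" where
  "production_function f \<longleftrightarrow>
     (\<forall>u\<ge>0. f u \<ge> 0) \<and> continuous_on {0..} f \<and> strict_mono_on {0..} f \<and> (\<forall>u>0. f u > 0)"

text \<open>
  The inverse on the range, continued by \<open>0\<close> below the range and by \<open>\<infinity>\<close> above it. For a continuous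
  increasing \<open>f\<close> the range is an interval with least element \<open>f 0\<close>, so the last case is exactly
  the case of arguments above the range.
\<close>
definition extended_inverse :: "(real \<Rightarrow> real) \<Rightarrow> real \<Rightarrow> ereal" where
  "extended_inverse f u =
     (if u < f 0 then 0
      else if u \<in> f ` {0..} then ereal (the_inv_into {0..} f u)
      else \<infinity>)"

definition delay :: "(real \<Rightarrow> real) \<Rightarrow> bool" where
  "delay h \<longleftrightarrow>
     h \<in> borel_measurable (lebesgue_on {0..}) \<and> (\<forall>t\<ge>0. h t \<le> t) \<and> filterlim h at_top at_top"

definition delay_distribution :: "(real \<Rightarrow> real) \<Rightarrow> (real \<Rightarrow> real \<Rightarrow> real) \<Rightarrow> bool" where
  "delay_distribution h R \<longleftrightarrow>
     (\<forall>t\<ge>0. (\<forall>s. continuous (at_left s) (R t)) \<and> mono (R t) \<and>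
             (\<forall>s\<le>h t. R t s = 0) \<and> (R t \<longlongrightarrow> 1) (at_right t)) \<and>
     (\<forall>s. \<forall>T\<ge>0. set_integrable lebesgue {0..T} (\<lambda>t. R t s))"

definition rate_function :: "(real \<Rightarrow> real) \<Rightarrow> bool" where
  "rate_function r \<longleftrightarrow>
     r \<in> borel_measurable (lebesgue_on {0..}) \<and>
     (\<exists>B. AE t in lebesgue_on {0..}. \<bar>r t\<bar> \<le> B) \<and>
     (\<forall>t\<ge>0. r t \<ge> 0) \<and>
     (\<integral>\<^sup>+ t. ennreal (r t) \<partial>lebesgue_on {0..}) = \<infinity>"

definition initial_function :: "(real \<Rightarrow> real) \<Rightarrow> bool" where
  "initial_function \<phi> \<longleftrightarrow>
     continuous_on {..0} \<phi> \<and> bounded (\<phi> ` {..0}) \<and> (\<forall>t<0. \<phi> t \<ge> 0) \<and> \<phi> 0 > 0"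

text \<open>
  \<open>interval_measure\<close> expects a right-continuous distribution function, so the left-continuous
  \<open>R t\<close> is replaced by its right-continuous version \<open>s \<mapsto> R t (s\<^sup>+)\<close>, which generates the same
  measure. Integrating over the closed interval includes the atoms at \<open>h t\<close> and at \<open>t\<close>; the
  total mass there is \<open>R t (t\<^sup>+) - R t (h t) = 1\<close>.
\<close>
definition delay_integral ::
  "(real \<Rightarrow> real) \<Rightarrow> (real \<Rightarrow> real \<Rightarrow> real) \<Rightarrow> (real \<Rightarrow> real) \<Rightarrow> real \<Rightarrow> real" where
  "delay_integral h R g t =
     (LINT s:{h t..t}|interval_measure (\<lambda>s. Lim (at_right s) (R t)). g s)"

definition absolutely_continuous_fun_on :: "real \<Rightarrow> real \<Rightarrow> (real \<Rightarrow> real) \<Rightarrow> bool" where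
  "absolutely_continuous_fun_on a b f \<longleftrightarrow>
     (\<forall>\<epsilon>>0. \<exists>\<delta>>0. \<forall>P.
        finite P \<and> (\<forall>(u, v)\<in>P. a \<le> u \<and> u \<le> v \<and> v \<le> b) \<and>
        disjoint_family_on (\<lambda>(u, v). {u<..<v}) P \<and> (\<Sum>(u, v)\<in>P. v - u) < \<delta> \<longrightarrow>
        (\<Sum>(u, v)\<in>P. \<bar>f v - f u\<bar>) < \<epsilon>)"

text \<open>
  Solutions on \<open>[0,c)\<close>. The functions \<open>x\<close>, \<open>y\<close> are not required to be nonnegative; since the
  initial values are positive and \<open>x' \<ge> - r x\<close> as long as \<open>y \<ge> 0\<close> (and vice versa), solutions stay
  positive, so the values of \<open>f1\<close>, \<open>f2\<close> at negative arguments play no role.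
\<close>
definition solution_on ::
  "(real \<Rightarrow> real) \<Rightarrow> (real \<Rightarrow> real) \<Rightarrow> (real \<Rightarrow> real) \<Rightarrow> (real \<Rightarrow> real) \<Rightarrow>
   (real \<Rightarrow> real \<Rightarrow> real) \<Rightarrow> (real \<Rightarrow> real \<Rightarrow> real) \<Rightarrow> (real \<Rightarrow> real) \<Rightarrow> (real \<Rightarrow> real) \<Rightarrow>
   (real \<Rightarrow> real) \<Rightarrow> (real \<Rightarrow> real) \<Rightarrow> ereal \<Rightarrow> (real \<Rightarrow> real) \<Rightarrow> (real \<Rightarrow> real) \<Rightarrow> bool" where
  "solution_on f1 f2 h1 h2 R1 R2 r1 r2 \<phi> \<psi> c x y \<longleftrightarrow>
     0 < c \<and>
     (\<forall>t\<le>0. x t = \<phi> t \<and> y t = \<psi> t) \<and>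
     (\<forall>b\<ge>0. ereal b < c \<longrightarrow>
        absolutely_continuous_fun_on 0 b x \<and> absolutely_continuous_fun_on 0 b y) \<and>
     (AE t in lebesgue. 0 \<le> t \<and> ereal t < c \<longrightarrow>
        (x has_real_derivative r1 t * (delay_integral h1 R1 (\<lambda>s. f1 (y s)) t - x t)) (at t) \<and>
        (y has_real_derivative r2 t * (delay_integral h2 R2 (\<lambda>s. f2 (x s)) t - y t)) (at t))"

definition maximal_solution ::
  "(real \<Rightarrow> real) \<Rightarrow> (real \<Rightarrow> real) \<Rightarrow> (real \<Rightarrow> real) \<Rightarrow> (real \<Rightarrow> real) \<Rightarrow>
   (real \<Rightarrow> real \<Rightarrow> real) \<Rightarrow> (real \<Rightarrow> real \<Rightarrow> real) \<Rightarrow> (real \<Rightarrow> real) \<Rightarrow> (real \<Rightarrow> real) \<Rightarrow>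
   (real \<Rightarrow> real) \<Rightarrow> (real \<Rightarrow> real) \<Rightarrow> ereal \<Rightarrow> (real \<Rightarrow> real) \<Rightarrow> (real \<Rightarrow> real) \<Rightarrow> bool" where
  "maximal_solution f1 f2 h1 h2 R1 R2 r1 r2 \<phi> \<psi> c x y \<longleftrightarrow>
     solution_on f1 f2 h1 h2 R1 R2 r1 r2 \<phi> \<psi> c x y \<and>
     \<not> (\<exists>c' x' y'. c < c' \<and> solution_on f1 f2 h1 h2 R1 R2 r1 r2 \<phi> \<psi> c' x' y' \<and>
          (\<forall>t. ereal t < c \<longrightarrow> x' t = x t \<and> y' t = y t))"

text \<open>
  Initial data whose value at time \<open>0\<close> is exactly the equilibrium \<open>(K, f2 K)\<close> have to be excluded
  when initial functions above the equilibrium are considered with the weak inequality. With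
  \<open>\<phi> = K\<close> and \<open>\<psi> = f2 K\<close> the constant pair is always a solution, so such solutions need not tend
  to infinity when \<open>f2\<close> lies above the inverse of \<open>f1\<close>. When \<open>f2\<close> lies below the inverse they
  need not converge to the equilibrium, because solutions are not unique: for \<open>h t = t\<close>,
  \<open>r = 1\<close>, \<open>K = 1\<close> and \<open>f1 u = f2 u = 1 - sqrt (1 - u)\<close> on \<open>[0,1]\<close>, \<open>f1 u = f2 u = (u + 1) / 2\<close>
  for \<open>u > 1\<close>, the functions \<open>x t = y t = 1 - (1 - exp (- t / 2))\<^sup>2\<close> for \<open>t \<ge> 0\<close>
  solve the problem with \<open>\<phi> = \<psi> = 1\<close> and tend to \<open>0\<close>.
\<close>

end

theory Submission
  imports Defs "HOL-Probability.Giry_Monad"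
begin

text \<open>
  Along a solution \<open>x' = r (D - x)\<close> holds almost everywhere, where \<open>D\<close> is a weighted mean of past
  values of \<open>f1 \<circ> y\<close>. Hence \<open>(x - L) exp (\<integral> r)\<close> is monotone as long as \<open>D\<close> stays on one side of \<open>L\<close>,
  and a first exit argument makes every box \<open>[0, p] \<times> [0, q]\<close> or \<open>[p, \<infinity>) \<times> [q, \<infinity>)\<close> invariant
  for which \<open>f1 q\<close> and \<open>f2 p\<close> lie on the correct side of \<open>p\<close> and \<open>q\<close>. As \<open>\<integral> r = \<infinity>\<close> and \<open>h t \<rightarrow> \<infinity>\<close>,
  an eventual bound \<open>p\<close> for \<open>x\<close> improves to every bound weaker than \<open>f1 (f2 p)\<close>, and iterating this
  drives \<open>x\<close> to a fixed point of \<open>f1 \<circ> f2\<close>. To prevent the iteration from stalling at \<open>K\<close> on the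
  wrong side, one finds a box strictly beyond \<open>K\<close> once all delayed arguments lie in a compact
  interval on which both components are strictly beyond the equilibrium.

  Solutions are global as soon as they are bounded: they are Lipschitz up to the end point, and from
  there a monotone iteration of the integral equation produces a continuation.
\<close>

section \<open>Absolutely continuous functions\<close>

text \<open>Derivatives are known only almost everywhere, so every estimate rests on one principle:
  an absolutely continuous function whose derivative is nonnegative almost everywhere is
  nondecreasing. Since \<open>f1\<close> and \<open>f2\<close> need not be Lipschitz continuous,
  solutions need not be unique; a solution is therefore compared with constants only, never with
  another solution. The iteration can stall because each improvement \<open>f1 (f2 p)\<close> is
  reached only up to an arbitrarily small loss: from the bound \<open>K\<close>, a fixed point of
  \<open>f1 \<circ> f2\<close>, it yields only bounds short of \<open>K\<close>. Initial data that
  touch the equilibrium are a further obstacle: the rates may vanish for a while, and delayed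
  arguments may still see values equal to the equilibrium. A component strictly beyond its
  equilibrium value at time 0 remains so, and it pulls the other one along once the delays have left
  the initial interval and the rate has acted. The system is symmetric under exchange of the
  components together with their data, so most estimates are proved for one component. At a finite
  end point both components are unbounded, because a bound on one bounds the target of the
  other.\<close>

lemma AE_has_real_derivative_integral:
  fixes g :: "real \<Rightarrow> real"
  assumes g: "\<And>a b. g integrable_on {a..b}"
  shows "AE t in lebesgue. a < t \<longrightarrow> ((\<lambda>u. integral {a..u} g) has_real_derivative g t) (at t)"
proof -
  obtain N where N: "negligible N" "\<And>t e. \<lbrakk>t \<notin> N; 0 < e\<rbrakk> \<Longrightarrow>
      \<exists>d>0. \<forall>h. 0 < h \<and> h < d \<longrightarrow> \<bar>integral {t..t + h} g / h - g t\<bar> < e"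
    using integrable_ccontinuous_explicit[where f=g] g by (auto simp: divide_inverse mult.commute)
  \<comment> \<open>The set \<open>N\<close> controls forward difference quotients only. Backward
    quotients of \<open>g\<close> are forward quotients of its reflection, so a point outside
    \<open>N\<close> and outside the mirror image of \<open>N'\<close> has a two-sided
    derivative.\<close>
  have "(\<lambda>t. g (- t)) integrable_on {a..b}" for a b
    using g[of "-b" "-a"] Henstock_Kurzweil_Integration.integrable_reflect_real[where f=g and a="-b" and b="-a"] by simp
  then obtain N' where N': "negligible N'" "\<And>t e. \<lbrakk>t \<notin> N'; 0 < e\<rbrakk> \<Longrightarrow>
      \<exists>d>0. \<forall>h. 0 < h \<and> h < d \<longrightarrow> \<bar>integral {t..t + h} (\<lambda>t. g (- t)) / h - g (- t)\<bar> < e"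
    using integrable_ccontinuous_explicit[where f="\<lambda>t. g (- t)"]
    by (auto simp: divide_inverse mult.commute)
  have "negligible (uminus ` N')"
    using N'(1) by (intro negligible_differentiable_image_negligible) (auto simp: differentiable_on_def)
  then have null: "negligible (N \<union> uminus ` N')"
    using N(1) by (rule negligible_Un[rotated])
  have deriv: "((\<lambda>u. integral {a..u} g) has_real_derivative g t) (at t)"
    if t: "t \<notin> N" "t \<notin> uminus ` N'" "a < t" for t
    unfolding has_field_derivative_iff
  proof (rule LIM_I)
    fix e :: real assume "0 < e"
    obtain d where d: "d > 0" "\<And>h. \<lbrakk>0 < h; h < d\<rbrakk> \<Longrightarrow> \<bar>integral {t..t + h} g / h - g t\<bar> < e"
      using N(2)[OF t(1) \<open>0 < e\<close>] by blast
    have "- t \<notin> N'"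
      using t(2) imageI[of "- t" N' uminus] by auto
    then obtain d' where d': "d' > 0"
      "\<And>h. \<lbrakk>0 < h; h < d'\<rbrakk> \<Longrightarrow> \<bar>integral {- t..- t + h} (\<lambda>t. g (- t)) / h - g t\<bar> < e"
      using N'(2)[OF \<open>- t \<notin> N'\<close> \<open>0 < e\<close>] unfolding minus_minus by blast
    show "\<exists>s>0. \<forall>u. u \<noteq> t \<and> norm (u - t) < s \<longrightarrow>
        norm ((integral {a..u} g - integral {a..t} g) / (u - t) - g t) < e"
    proof (intro exI[of _ "min (min d d') (t - a)"] conjI allI impI)
      fix u assume u: "u \<noteq> t \<and> norm (u - t) < min (min d d') (t - a)"
      show "norm ((integral {a..u} g - integral {a..t} g) / (u - t) - g t) < e"
      proof (cases "t < u")
        case True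
        have "integral {a..u} g - integral {a..t} g = integral {t..u} g"
          using Henstock_Kurzweil_Integration.integral_combine[where f=g and a=a and c=t and b=u] g True t(3) by simp
        then show ?thesis
          using d(2)[of "u - t"] u True by simp
      next
        case False
        then have "a \<le> u" "u < t"
          using u by auto
        then have "integral {a..u} g - integral {a..t} g = - integral {u..t} g"
          using Henstock_Kurzweil_Integration.integral_combine[where f=g and a=a and c=u and b=t] g by simp
        moreover have "integral {- t..- u} (\<lambda>t. g (- t)) = integral {u..t} g"
          using Henstock_Kurzweil_Integration.integral_reflect_real[where f=g and a=u and b=t] by simp
        ultimately show ?thesis
          using d'(2)[of "t - u"] u \<open>u < t\<close>
          by (simp add: minus_divide_divide[of "integral {u..t} g" "t - u", symmetric] del: minus_divide_divide)
      qed
    qed (use d d' t in auto)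
  qed
  have "N \<union> uminus ` N' \<in> null_sets lebesgue"
    using null by (simp add: negligible_iff_null_sets)
  then show ?thesis
    by (rule AE_I') (use deriv in blast)
qed

text \<open>A gauge argument avoids recovering \<open>f\<close> from its derivative. In a fine
  tagged division, an interval tagged at a point with nonnegative derivative loses at most
  \<open>\<epsilon>\<close> times its length, and the intervals with exceptional tags have total
  length below the \<open>\<delta>\<close> of absolute continuity.\<close>

lemma absolutely_continuous_imp_mono:
  assumes ac: "absolutely_continuous_fun_on a b f" and "a \<le> b"
    and deriv: "AE t in lebesgue. a < t \<and> t < b \<longrightarrow> (\<exists>d\<ge>0. (f has_real_derivative d) (at t))"
  shows "f a \<le> f b"
proof (rule field_le_epsilon)
  fix e :: real assume "0 < e"
  \<comment> \<open>Good intervals cost at most \<open>\<epsilon> * (b - a)\<close> and exceptional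
    ones at most \<open>\<epsilon>\<close>, together \<open>e\<close>.\<close>
  define \<epsilon> where "\<epsilon> = e / (b - a + 1)"
  have \<epsilon>: "0 < \<epsilon>" "\<epsilon> * (b - a + 1) = e"
    using \<open>0 < e\<close> \<open>a \<le> b\<close> by (auto simp: \<epsilon>_def)
  obtain \<delta> where \<delta>: "0 < \<delta>" "\<forall>P. finite P \<and> (\<forall>(u, v)\<in>P. a \<le> u \<and> u \<le> v \<and> v \<le> b) \<and>
      disjoint_family_on (\<lambda>(u, v). {u<..<v}) P \<and> (\<Sum>(u, v)\<in>P. v - u) < \<delta> \<longrightarrow>
      (\<Sum>(u, v)\<in>P. \<bar>f v - f u\<bar>) < \<epsilon>"
    using ac \<epsilon>(1) unfolding absolutely_continuous_fun_on_def by blast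
  define good where "good t \<longleftrightarrow> a < t \<and> t < b \<and> (\<exists>d\<ge>0. (f has_real_derivative d) (at t))" for t
  define N where "N = {t \<in> {a..b}. \<not> good t}"
  have "AE t in lebesgue. t \<notin> N"
  proof -
    have "AE t in lebesgue. t \<noteq> a" "AE t in lebesgue. t \<noteq> b"
      using AE_completion[OF AE_lborel_singleton] by auto
    with deriv show ?thesis
      by eventually_elim (auto simp: N_def good_def)
  qed
  then obtain Z where "Z \<in> null_sets lebesgue" "N \<subseteq> Z"
    unfolding eventually_ae_filter by auto
  then have N: "N \<in> null_sets lebesgue"
    using null_sets_completion_subset by blast
  then obtain G where G: "open G" "N \<subseteq> G" "emeasure lebesgue (G - N) < ennreal \<delta>"
    using sets_lebesgue_outer_open[OF null_setsD2[OF N] \<delta>(1)] by metis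
  moreover have "emeasure lebesgue G = emeasure lebesgue (G - N)"
    using N G(1) emeasure_Diff_null_set[of N lebesgue G] by simp
  ultimately have less: "emeasure lebesgue G < ennreal \<delta>"
    by simp
  then have "G \<in> lmeasurable"
    using G(1) by (intro fmeasurableI) (auto simp: less_top[symmetric])
  with less have Gm: "G \<in> lmeasurable" "measure lebesgue G < \<delta>"
    by (auto simp: emeasure_eq_measure2 ennreal_less_iff)
  have "\<exists>d>0. \<forall>u v. t - d < u \<and> u \<le> t \<and> t \<le> v \<and> v < t + d \<longrightarrow> f v - f u \<ge> - \<epsilon> * (v - u)" if t: "good t" for t
  proof -
    obtain D where D: "0 \<le> D" "(f has_derivative (*) D) (at t)"
      using t by (auto simp: good_def has_field_derivative_def)
    obtain d where d: "d > 0" "\<And>y. \<bar>y - t\<bar> < d \<Longrightarrow> \<bar>f y - f t - D * (y - t)\<bar> \<le> \<epsilon> * \<bar>y - t\<bar>"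
      using D(2) \<epsilon>(1) unfolding has_derivative_at_alt by auto
    have "f v - f u \<ge> - \<epsilon> * (v - u)" if "t - d < u" "u \<le> t" "t \<le> v" "v < t + d" for u v
    proof -
      have "f v - f t \<ge> D * (v - t) - \<epsilon> * (v - t)"
        using d(2)[of v] that by auto
      moreover have "f t - f u \<ge> D * (t - u) - \<epsilon> * (t - u)"
        using d(2)[of u] that by (auto simp: algebra_simps)
      moreover have "D * (v - t) + D * (t - u) \<ge> 0"
        using D(1) that by simp
      ultimately show ?thesis
        by (simp add: algebra_simps)
    qed
    with d(1) show ?thesis by blast
  qed
  then obtain d where d: "\<And>t. good t \<Longrightarrow> d t > 0"
    "\<And>t u v. \<lbrakk>good t; t - d t < u; u \<le> t; t \<le> v; v < t + d t\<rbrakk> \<Longrightarrow> f v - f u \<ge> - \<epsilon> * (v - u)"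
    by metis
  \<comment> \<open>Near a good point the derivative controls increments; the exceptional points are covered by an
    open set so small that absolute continuity controls the increments there.\<close>
  define \<gamma> where "\<gamma> t = (if good t then ball t (d t) else if t \<in> N then G else UNIV)" for t
  have "gauge \<gamma>"
    using d(1) G by (auto simp: gauge_def \<gamma>_def)
  then obtain p where p: "p tagged_division_of cbox a b" "\<gamma> fine p"
    using fine_division_exists by blast
  have fin: "finite p"
    using p(1) by (rule tagged_division_of_finite)
  define q where "q = {(t, k) \<in> p. \<not> good t}"
  have qp: "q \<subseteq> p"
    by (auto simp: q_def)
  have q: "q tagged_partial_division_of cbox a b"
    using p(1) qp by (meson tagged_division_of_def tagged_partial_division_subset)
  have K: "\<exists>u v. k = {u..v} \<and> a \<le> u \<and> u \<le> t \<and> t \<le> v \<and> v \<le> b" if "(t, k) \<in> p" for t k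
    using p(1) that by (fastforce simp: tagged_division_of)
  have "(\<Sum>(t, k)\<in>p. f (Sup k) - f (Inf k)) = f b - f a"
    using additive_tagged_division_1[OF \<open>a \<le> b\<close>, of p f] p(1) by simp
  moreover have "(\<Sum>(t, k)\<in>p. f (Sup k) - f (Inf k)) =
      (\<Sum>(t, k)\<in>p - q. f (Sup k) - f (Inf k)) + (\<Sum>(t, k)\<in>q. f (Sup k) - f (Inf k))"
    using sum.subset_diff[OF qp fin] by blast
  moreover have "(\<Sum>(t, k)\<in>p - q. f (Sup k) - f (Inf k)) \<ge> - \<epsilon> * (b - a)"
  proof -
    have "- \<epsilon> * measure lborel k \<le> f (Sup k) - f (Inf k)" if tk: "(t, k) \<in> p - q" for t k
    proof -
      obtain u v where uv: "k = {u..v}" "u \<le> t" "t \<le> v"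
        using K tk by blast
      moreover have "good t"
        using tk by (auto simp: q_def)
      moreover have "k \<subseteq> ball t (d t)"
        using fineD[OF p(2), of t k] tk \<open>good t\<close> by (simp add: \<gamma>_def)
      ultimately show ?thesis
        using d(2)[of t u v] by (fastforce simp: dist_real_def subset_eq)
    qed
    then have "(\<Sum>(t, k)\<in>p - q. - \<epsilon> * measure lborel k) \<le> (\<Sum>(t, k)\<in>p - q. f (Sup k) - f (Inf k))"
      by (intro sum_mono) auto
    moreover have "(\<Sum>(t, k)\<in>p - q. measure lborel k) \<le> (\<Sum>(t, k)\<in>p. measure lborel k)"
      using fin by (intro sum_mono2) auto
    then have "\<epsilon> * (\<Sum>(t, k)\<in>p - q. measure lborel k) \<le> \<epsilon> * (b - a)"
      using additive_content_tagged_division[OF p(1)] \<open>a \<le> b\<close> \<epsilon>(1) by (intro mult_left_mono) auto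
    moreover have "(\<Sum>(t, k)\<in>p - q. - \<epsilon> * measure lborel k) =
        - \<epsilon> * (\<Sum>(t, k)\<in>p - q. measure lborel k)"
      by (simp add: sum_distrib_left case_prod_beta)
    ultimately show ?thesis
      by linarith
  qed
  moreover have "(\<Sum>(t, k)\<in>q. \<bar>f (Sup k) - f (Inf k)\<bar>) < \<epsilon>"
  proof -
    define D where "D = snd ` q"
    define P where "P = (\<lambda>k. (Inf k, Sup k)) ` D"
    have DK: "\<exists>u v. k = {u..v} \<and> a \<le> u \<and> u \<le> v \<and> v \<le> b" if "k \<in> D" for k
      using that K qp unfolding D_def by force
    have div: "D division_of \<Union>D"
      unfolding D_def using partial_division_of_tagged_division[OF q] .
    have inj: "inj_on (\<lambda>k. (Inf k, Sup k)) D"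
    proof (rule inj_onI)
      fix k l assume "k \<in> D" "l \<in> D" "(Inf k, Sup k) = (Inf l, Sup l)"
      then show "k = l"
        using DK[of k] DK[of l] by auto
    qed
    have "(\<Sum>(u, v)\<in>P. v - u) = sum (measure lebesgue) D"
      unfolding P_def by (subst sum.reindex[OF inj]) (auto intro!: sum.cong dest!: DK)
    also have "\<dots> = measure lebesgue (\<Union>D)"
      using content_division[OF div] by simp
    also have "\<dots> \<le> measure lebesgue G"
    proof (rule measure_mono_fmeasurable)
      show "\<Union>D \<subseteq> G"
      proof
        fix s assume "s \<in> \<Union>D"
        then obtain t k where tk: "(t, k) \<in> q" "s \<in> k"
          by (auto simp: D_def)
        then have "t \<in> N" "\<not> good t"
          using K[of t k] by (auto simp: q_def N_def)
        then show "s \<in> G"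
          using fineD[OF p(2), of t k] tk qp by (auto simp: \<gamma>_def)
      qed
      show "\<Union>D \<in> sets lebesgue"
        using lmeasurable_division[OF div] by auto
    qed (rule Gm(1))
    finally have small: "(\<Sum>(u, v)\<in>P. v - u) < \<delta>"
      using Gm by simp
    have "disjoint_family_on (\<lambda>(u, v). {u<..<v}) P"
      unfolding disjoint_family_on_def
    proof (intro ballI impI)
      fix m n assume "m \<in> P" "n \<in> P" "m \<noteq> n"
      then obtain k l where kl: "k \<in> D" "l \<in> D" "k \<noteq> l" "m = (Inf k, Sup k)" "n = (Inf l, Sup l)"
        unfolding P_def by blast
      then have "interior k \<inter> interior l = {}"
        by (intro division_ofD(5)[OF div]) auto
      then show "(case m of (u, v) \<Rightarrow> {u<..<v}) \<inter> (case n of (u, v) \<Rightarrow> {u<..<v}) = {}"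
        using DK[OF kl(1)] DK[OF kl(2)] kl(4,5) by auto
    qed
    moreover have "finite P"
      using fin qp by (auto simp: P_def D_def intro: finite_subset)
    moreover have "\<forall>(u, v)\<in>P. a \<le> u \<and> u \<le> v \<and> v \<le> b"
      using DK by (force simp: P_def)
    ultimately have "(\<Sum>(u, v)\<in>P. \<bar>f v - f u\<bar>) < \<epsilon>"
      using \<delta>(2) small by blast
    also have "(\<Sum>(u, v)\<in>P. \<bar>f v - f u\<bar>) = (\<Sum>k\<in>D. \<bar>f (Sup k) - f (Inf k)\<bar>)"
      unfolding P_def by (subst sum.reindex[OF inj]) simp
    \<comment> \<open>Passing from intervals to tagged intervals requires a summand that vanishes on
      every degenerate box. As \<open>Inf {}\<close> and \<open>Sup {}\<close> are unspecified, the
      empty box is sent to 0 explicitly.\<close>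
    also have "\<dots> = (\<Sum>k\<in>D. if k = {} then 0 else \<bar>f (Sup k) - f (Inf k)\<bar>)"
      using DK[of "{}"] by (intro sum.cong) auto
    also have "\<dots> = (\<Sum>(t, k)\<in>q. if k = {} then 0 else \<bar>f (Sup k) - f (Inf k)\<bar>)"
      unfolding D_def
      by (rule sum.over_tagged_division_lemma[OF tagged_partial_division_of_Union_self[OF q], symmetric])
        (auto simp: not_less less_le_not_le)
    also have "\<dots> = (\<Sum>(t, k)\<in>q. \<bar>f (Sup k) - f (Inf k)\<bar>)"
    proof (intro sum.cong refl)
      fix z assume "z \<in> q"
      then obtain t k where "z = (t, k)" "(t, k) \<in> p"
        using qp by (cases z) auto
      then show "(case z of (t, k) \<Rightarrow> if k = {} then 0 else \<bar>f (Sup k) - f (Inf k)\<bar>) =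
          (case z of (t, k) \<Rightarrow> \<bar>f (Sup k) - f (Inf k)\<bar>)"
        using K[of t k] by auto
    qed
    finally show ?thesis .
  qed
  moreover have "\<bar>\<Sum>(t, k)\<in>q. f (Sup k) - f (Inf k)\<bar> \<le> (\<Sum>(t, k)\<in>q. \<bar>f (Sup k) - f (Inf k)\<bar>)"
    using sum_abs[of "\<lambda>(t, k). f (Sup k) - f (Inf k)" q] by (simp add: case_prod_beta)
  ultimately show "f a \<le> f b + e"
    using \<epsilon>(2) by (simp add: algebra_simps)
qed

section \<open>Closure properties of absolute continuity\<close>

definition fine_family :: "real \<Rightarrow> real \<Rightarrow> real \<Rightarrow> (real \<times> real) set \<Rightarrow> bool" where
  "fine_family a b \<delta> P \<longleftrightarrow> finite P \<and> (\<forall>(u, v)\<in>P. a \<le> u \<and> u \<le> v \<and> v \<le> b) \<and>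
     disjoint_family_on (\<lambda>(u, v). {u<..<v}) P \<and> (\<Sum>(u, v)\<in>P. v - u) < \<delta>"

lemma absolutely_continuous_fun_on_iff:
  "absolutely_continuous_fun_on a b f \<longleftrightarrow>
     (\<forall>\<epsilon>>0. \<exists>\<delta>>0. \<forall>P. fine_family a b \<delta> P \<longrightarrow> (\<Sum>(u, v)\<in>P. \<bar>f v - f u\<bar>) < \<epsilon>)"
  unfolding absolutely_continuous_fun_on_def fine_family_def ..

lemma fine_familyD: "fine_family a b \<delta> P \<Longrightarrow> (u, v) \<in> P \<Longrightarrow> a \<le> u \<and> u \<le> v \<and> v \<le> b"
  unfolding fine_family_def by blast

lemma fine_family_mono:
  assumes "fine_family a' b' \<delta>' P" "a \<le> a'" "b' \<le> b" "\<delta>' \<le> \<delta>"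
  shows "fine_family a b \<delta> P"
proof -
  have "\<forall>(u, v)\<in>P. a \<le> u \<and> u \<le> v \<and> v \<le> b"
    using fine_familyD[OF assms(1)] assms(2,3) by (auto intro: order_trans)
  moreover have "(\<Sum>(u, v)\<in>P. v - u) < \<delta>"
    using assms(1,4) unfolding fine_family_def by (elim conjE) (rule less_le_trans)
  ultimately show ?thesis
    using assms(1) unfolding fine_family_def by blast
qed

lemma absolutely_continuous_fun_on_subset:
  assumes "absolutely_continuous_fun_on a b f" "a \<le> a'" "b' \<le> b"
  shows "absolutely_continuous_fun_on a' b' f"
  unfolding absolutely_continuous_fun_on_iff
proof (intro allI impI)
  fix \<epsilon> :: real assume "0 < \<epsilon>"
  then obtain \<delta> where \<delta>: "0 < \<delta>" "\<forall>P. fine_family a b \<delta> P \<longrightarrow>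
      (\<Sum>(u, v)\<in>P. \<bar>f v - f u\<bar>) < \<epsilon>"
    using assms(1) unfolding absolutely_continuous_fun_on_iff by blast
  with \<delta> show "\<exists>\<delta>>0. \<forall>P. fine_family a' b' \<delta> P \<longrightarrow>
      (\<Sum>(u, v)\<in>P. \<bar>f v - f u\<bar>) < \<epsilon>"
    using fine_family_mono[OF _ assms(2,3) order_refl] by blast
qed

lemma absolutely_continuous_fun_on_ident: "absolutely_continuous_fun_on a b (\<lambda>t. t)"
  unfolding absolutely_continuous_fun_on_iff
proof (intro allI impI)
  fix \<epsilon> :: real assume "0 < \<epsilon>"
  have "(\<Sum>(u, v)\<in>P. \<bar>v - u\<bar>) = (\<Sum>(u, v)\<in>P. v - u)"
    if "fine_family a b \<epsilon> P" for P
    using fine_familyD[OF that] by (intro sum.cong) auto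
  with \<open>0 < \<epsilon>\<close> show "\<exists>\<delta>>0. \<forall>P. fine_family a b \<delta> P \<longrightarrow>
      (\<Sum>(u, v)\<in>P. \<bar>v - u\<bar>) < \<epsilon>"
    by (intro exI[of _ \<epsilon>]) (simp add: fine_family_def)
qed

text \<open>Linear combinations, products, reciprocals and Lipschitz functions all have increments
  controlled in this way. \<open>A\<close> and \<open>B\<close> may have any sign, hence their
  absolute values; the extra 1 in \<open>C\<close> keeps the divisor positive and makes the last
  estimate strict.\<close>

lemma absolutely_continuous_fun_on_dominated:
  assumes f: "absolutely_continuous_fun_on a b f" and g: "absolutely_continuous_fun_on a b g"
    and w: "\<And>u v. \<lbrakk>a \<le> u; u \<le> v; v \<le> b\<rbrakk> \<Longrightarrow> \<bar>w v - w u\<bar> \<le> A * \<bar>f v - f u\<bar> + B * \<bar>g v - g u\<bar>"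
  shows "absolutely_continuous_fun_on a b w"
  unfolding absolutely_continuous_fun_on_iff
proof (intro allI impI)
  fix \<epsilon> :: real assume "0 < \<epsilon>"
  define C where "C = \<bar>A\<bar> + \<bar>B\<bar> + 1"
  define \<eta> where "\<eta> = \<epsilon> / C"
  have C: "C > 0" "\<bar>A\<bar> \<le> C" "\<bar>B\<bar> \<le> C"
    by (auto simp: C_def)
  have "\<eta> > 0" "(\<bar>A\<bar> + \<bar>B\<bar>) * \<eta> < \<epsilon>"
    using \<open>0 < \<epsilon>\<close> C by (auto simp: \<eta>_def C_def field_simps)
  obtain \<delta> where \<delta>: "0 < \<delta>" "\<forall>P. fine_family a b \<delta> P \<longrightarrow>
      (\<Sum>(u, v)\<in>P. \<bar>f v - f u\<bar>) < \<eta>"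
    using f \<open>\<eta> > 0\<close> unfolding absolutely_continuous_fun_on_iff by blast
  obtain \<delta>' where \<delta>': "0 < \<delta>'" "\<forall>P. fine_family a b \<delta>' P \<longrightarrow>
      (\<Sum>(u, v)\<in>P. \<bar>g v - g u\<bar>) < \<eta>"
    using g \<open>\<eta> > 0\<close> unfolding absolutely_continuous_fun_on_iff by blast
  show "\<exists>\<delta>>0. \<forall>P. fine_family a b \<delta> P \<longrightarrow>
      (\<Sum>(u, v)\<in>P. \<bar>w v - w u\<bar>) < \<epsilon>"
  proof (intro exI[of _ "min \<delta> \<delta>'"] conjI allI impI)
    fix P assume P: "fine_family a b (min \<delta> \<delta>') P"
    have f_less: "(\<Sum>(u, v)\<in>P. \<bar>f v - f u\<bar>) < \<eta>"
      using \<delta>(2) fine_family_mono[OF P order_refl order_refl] by simp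
    have g_less: "(\<Sum>(u, v)\<in>P. \<bar>g v - g u\<bar>) < \<eta>"
      using \<delta>'(2) fine_family_mono[OF P order_refl order_refl] by simp
    have le: "\<bar>w v - w u\<bar> \<le> \<bar>A\<bar> * \<bar>f v - f u\<bar> + \<bar>B\<bar> * \<bar>g v - g u\<bar>" if "(u, v) \<in> P" for u v
    proof -
      have "A * \<bar>f v - f u\<bar> \<le> \<bar>A\<bar> * \<bar>f v - f u\<bar>" "B * \<bar>g v - g u\<bar> \<le> \<bar>B\<bar> * \<bar>g v - g u\<bar>"
        by (intro mult_right_mono; simp)+
      moreover have "\<bar>w v - w u\<bar> \<le> A * \<bar>f v - f u\<bar> + B * \<bar>g v - g u\<bar>"
        using fine_familyD[OF P that] by (intro w) auto
      ultimately show ?thesis by linarith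
    qed
    have "(\<Sum>(u, v)\<in>P. \<bar>w v - w u\<bar>) \<le> (\<Sum>(u, v)\<in>P. \<bar>A\<bar> * \<bar>f v - f u\<bar> + \<bar>B\<bar> * \<bar>g v - g u\<bar>)"
      using le by (intro sum_mono) auto
    also have "\<dots> = \<bar>A\<bar> * (\<Sum>(u, v)\<in>P. \<bar>f v - f u\<bar>) + \<bar>B\<bar> * (\<Sum>(u, v)\<in>P. \<bar>g v - g u\<bar>)"
      by (simp add: case_prod_beta sum.distrib sum_distrib_left)
    also have "\<dots> \<le> \<bar>A\<bar> * \<eta> + \<bar>B\<bar> * \<eta>"
      using f_less g_less by (intro add_mono mult_left_mono) auto
    also have "\<dots> < \<epsilon>"
      using \<open>(\<bar>A\<bar> + \<bar>B\<bar>) * \<eta> < \<epsilon>\<close> by (simp add: algebra_simps)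
    finally show "(\<Sum>(u, v)\<in>P. \<bar>w v - w u\<bar>) < \<epsilon>" .
  qed (use \<delta> \<delta>' in auto)
qed

lemma lipschitz_imp_absolutely_continuous:
  assumes "\<And>u v. \<lbrakk>a \<le> u; u \<le> v; v \<le> b\<rbrakk> \<Longrightarrow> \<bar>w v - w u\<bar> \<le> B * (v - u)"
  shows "absolutely_continuous_fun_on a b w"
  by (rule absolutely_continuous_fun_on_dominated[where A=B and B=0,
      OF absolutely_continuous_fun_on_ident absolutely_continuous_fun_on_ident])
    (use assms in auto)

lemma absolutely_continuous_imp_continuous:
  assumes "absolutely_continuous_fun_on a b f"
  shows "continuous_on {a..b} f"
  unfolding continuous_on_iff
proof (intro ballI allI impI)
  fix s \<epsilon> :: real assume s: "s \<in> {a..b}" and "0 < \<epsilon>"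
  then obtain \<delta> where \<delta>: "0 < \<delta>" "\<forall>P. fine_family a b \<delta> P \<longrightarrow>
      (\<Sum>(u, v)\<in>P. \<bar>f v - f u\<bar>) < \<epsilon>"
    using assms unfolding absolutely_continuous_fun_on_iff by blast
  have close: "\<bar>f v - f u\<bar> < \<epsilon>" if "a \<le> u" "u \<le> v" "v \<le> b" "v - u < \<delta>" for u v
    using \<delta>(2)[rule_format, of "{(u, v)}"] that by (simp add: fine_family_def disjoint_family_on_def)
  have "dist (f t) (f s) < \<epsilon>" if "t \<in> {a..b}" "dist t s < \<delta>" for t
    using that s close[of s t] close[of t s] by (cases "s \<le> t") (auto simp: dist_real_def)
  with \<delta>(1) show "\<exists>d>0. \<forall>t\<in>{a..b}. dist t s < d \<longrightarrow> dist (f t) (f s) < \<epsilon>"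
    by blast
qed

lemma absolutely_continuous_fun_on_mult:
  assumes f: "absolutely_continuous_fun_on a b f" and g: "absolutely_continuous_fun_on a b g"
  shows "absolutely_continuous_fun_on a b (\<lambda>t. f t * g t)"
proof -
  have "\<exists>A. \<forall>t\<in>{a..b}. \<bar>h t\<bar> \<le> A" if "absolutely_continuous_fun_on a b h" for h
    using compact_imp_bounded[OF compact_continuous_image[OF absolutely_continuous_imp_continuous[OF that]]]
    by (auto simp: bounded_iff)
  then obtain A B where A: "\<And>t. t \<in> {a..b} \<Longrightarrow> \<bar>f t\<bar> \<le> A" and B: "\<And>t. t \<in> {a..b} \<Longrightarrow> \<bar>g t\<bar> \<le> B"
    using f g by metis
  show ?thesis
  proof (rule absolutely_continuous_fun_on_dominated[OF f g])
    fix u v assume uv: "a \<le> u" "u \<le> v" "v \<le> b"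
    have "f v * g v - f u * g u = (f v - f u) * g v + f u * (g v - g u)"
      by (simp add: algebra_simps)
    also have "\<bar>\<dots>\<bar> \<le> \<bar>f v - f u\<bar> * \<bar>g v\<bar> + \<bar>f u\<bar> * \<bar>g v - g u\<bar>"
      by (metis abs_mult abs_triangle_ineq)
    also have "\<dots> \<le> \<bar>f v - f u\<bar> * B + A * \<bar>g v - g u\<bar>"
      using A[of u] B[of v] uv by (intro add_mono mult_left_mono mult_right_mono) auto
    finally show "\<bar>f v * g v - f u * g u\<bar> \<le> B * \<bar>f v - f u\<bar> + A * \<bar>g v - g u\<bar>"
      by (simp add: mult.commute)
  qed
qed

section \<open>Relaxation towards a moving target\<close>

text \<open>Stands for the integral of \<open>r\<close> from 0 to \<open>t\<close>, up to an
  additive constant. The increments are nonnegative because \<open>r\<close> is, Lipschitz because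
  \<open>r\<close> is essentially bounded, and the divergence expresses that \<open>r\<close> has
  infinite integral.\<close>

definition rate_primitive :: "(real \<Rightarrow> real) \<Rightarrow> (real \<Rightarrow> real) \<Rightarrow> bool" where
  "rate_primitive r \<rho> \<longleftrightarrow>
     (\<exists>B. \<forall>u v. 0 \<le> u \<longrightarrow> u \<le> v \<longrightarrow> 0 \<le> \<rho> v - \<rho> u \<and> \<rho> v - \<rho> u \<le> B * (v - u)) \<and>
     filterlim \<rho> at_top at_top \<and> (AE t in lebesgue. 0 < t \<longrightarrow> (\<rho> has_real_derivative r t) (at t))"

lemma rate_primitive_mono: "rate_primitive r \<rho> \<Longrightarrow> 0 \<le> u \<Longrightarrow> u \<le> v \<Longrightarrow> \<rho> u \<le> \<rho> v"
  unfolding rate_primitive_def by force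

lemma absolutely_continuous_exp_primitive:
  assumes \<rho>: "rate_primitive r \<rho>" and "0 \<le> a"
  shows "absolutely_continuous_fun_on a b (\<lambda>t. exp (\<rho> t))"
proof -
  obtain B where B: "\<And>u v. \<lbrakk>0 \<le> u; u \<le> v\<rbrakk> \<Longrightarrow> 0 \<le> \<rho> v - \<rho> u \<and> \<rho> v - \<rho> u \<le> B * (v - u)"
    using \<rho> unfolding rate_primitive_def by blast
  show ?thesis
  proof (rule lipschitz_imp_absolutely_continuous)
    fix u v assume uv: "a \<le> u" "u \<le> v" "v \<le> b"
    have *: "1 - exp (\<rho> u - \<rho> v) \<le> \<rho> v - \<rho> u"
      using exp_ge_add_one_self[of "\<rho> u - \<rho> v"] by linarith
    have "exp (\<rho> v) - exp (\<rho> u) = exp (\<rho> v) * (1 - exp (\<rho> u - \<rho> v))"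
      by (simp add: exp_diff algebra_simps)
    also have "\<dots> \<le> exp (\<rho> v) * (\<rho> v - \<rho> u)"
      using * by (intro mult_left_mono) auto
    also have "\<dots> \<le> exp (\<rho> b) * (B * (v - u))"
      using B[of u v] B[of v b] uv \<open>0 \<le> a\<close> by (intro mult_mono) auto
    finally show "\<bar>exp (\<rho> v) - exp (\<rho> u)\<bar> \<le> exp (\<rho> b) * B * (v - u)"
      using B[of u v] uv \<open>0 \<le> a\<close> by (simp add: mult.assoc)
  qed
qed

text \<open>Here and below, a sign \<open>\<sigma> = \<plusminus>1\<close> treats lower and upper bounds simultaneously.\<close>

lemma relaxation_comparison:
  assumes \<rho>: "rate_primitive r \<rho>" and r: "\<And>t. 0 \<le> t \<Longrightarrow> 0 \<le> r t" and ab: "0 \<le> a" "a \<le> b"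
    and x: "absolutely_continuous_fun_on a b x"
    and deriv: "AE t in lebesgue. a < t \<and> t < b \<longrightarrow>
      (x has_real_derivative r t * (D t - x t)) (at t) \<and> 0 \<le> \<sigma> * (D t - L)"
  shows "\<sigma> * (x a - L) * exp (\<rho> a) \<le> \<sigma> * (x b - L) * exp (\<rho> b)"
proof -
  define w where "w t = \<sigma> * (x t - L) * exp (\<rho> t)" for t
  have "absolutely_continuous_fun_on a b (\<lambda>t. \<sigma> * (x t - L))"
    by (rule absolutely_continuous_fun_on_dominated[OF x x, where A="\<bar>\<sigma>\<bar>" and B=0])
      (simp add: abs_mult flip: right_diff_distrib)
  then have w: "absolutely_continuous_fun_on a b w"
    unfolding w_def using absolutely_continuous_exp_primitive[OF \<rho> ab(1)]
    by (rule absolutely_continuous_fun_on_mult)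
  have "AE t in lebesgue. 0 < t \<longrightarrow> (\<rho> has_real_derivative r t) (at t)"
    using \<rho> unfolding rate_primitive_def by blast
  with deriv have "AE t in lebesgue. a < t \<and> t < b \<longrightarrow> (\<exists>d\<ge>0. (w has_real_derivative d) (at t))"
  proof eventually_elim
    case (elim t)
    show ?case
    proof
      assume t: "a < t \<and> t < b"
      then have 1: "(x has_real_derivative r t * (D t - x t)) (at t)" and 2: "0 \<le> \<sigma> * (D t - L)"
        and 3: "(\<rho> has_real_derivative r t) (at t)"
        using elim ab by auto
      \<comment> \<open>With \<open>exp (\<rho> t)\<close> as integrating factor the terms in
        \<open>x t\<close> cancel, so the sign of the derivative depends on \<open>D t - L\<close>
        only.\<close>
      have "(w has_real_derivative \<sigma> * (r t * (D t - x t)) * exp (\<rho> t) + \<sigma> * (x t - L) * (exp (\<rho> t) * r t)) (at t)"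
        unfolding w_def by (auto intro!: derivative_eq_intros 1 3)
      also have "\<sigma> * (r t * (D t - x t)) * exp (\<rho> t) + \<sigma> * (x t - L) * (exp (\<rho> t) * r t) =
          r t * exp (\<rho> t) * (\<sigma> * (D t - L))"
        by (simp add: algebra_simps)
      finally show "\<exists>d\<ge>0. (w has_real_derivative d) (at t)"
        using 2 r[of t] t ab by (intro exI[of _ "r t * exp (\<rho> t) * (\<sigma> * (D t - L))"]) auto
    qed
  qed
  from absolutely_continuous_imp_mono[OF w ab(2) this] show ?thesis
    by (simp add: w_def)
qed

section \<open>Primitives of bounded measurable functions\<close>

lemma bounded_measurable_integrable_on:
  fixes g :: "real \<Rightarrow> real"
  assumes "g \<in> borel_measurable lebesgue" "\<And>t. \<bar>g t\<bar> \<le> B"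
  shows "g integrable_on {a..b}"
proof (rule measurable_bounded_by_integrable_imp_integrable)
  show "g \<in> borel_measurable (lebesgue_on {a..b})"
    using assms(1) by (rule measurable_restrict_space1)
  show "(\<lambda>_. B) integrable_on {a..b}"
    by (rule integrable_const_ivl)
qed (use assms(2) in auto)

lemma integral_lipschitz:
  fixes g :: "real \<Rightarrow> real"
  assumes g: "g \<in> borel_measurable lebesgue" "\<And>t. \<bar>g t\<bar> \<le> B" and uv: "a \<le> u" "u \<le> v"
  shows "\<bar>integral {a..v} g - integral {a..u} g\<bar> \<le> B * (v - u)"
proof -
  have "integral {a..v} g - integral {a..u} g = integral {u..v} g"
    using Henstock_Kurzweil_Integration.integral_combine[where f=g and a=a and c=u and b=v]
      bounded_measurable_integrable_on[OF g] uv by simp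
  moreover have "norm (integral {u..v} g) \<le> integral {u..v} (\<lambda>_. B)"
    using g(2) by (intro integral_norm_bound_integral bounded_measurable_integrable_on[OF g]) auto
  ultimately show ?thesis
    using uv by (simp add: mult.commute)
qed

lemma rate_function_bounded_version:
  assumes "rate_function r"
  obtains r' B where "r' \<in> borel_measurable lebesgue" "\<And>t. 0 \<le> r' t" "\<And>t. r' t \<le> B"
    "AE t in lebesgue. 0 \<le> t \<longrightarrow> r' t = r t"
proof -
  obtain B where B: "AE t in lebesgue_on {0..}. \<bar>r t\<bar> \<le> B"
    using assms unfolding rate_function_def by blast
  \<comment> \<open>Capping changes \<open>r\<close> on a null set only and makes both bounds valid
    at every point; \<open>\<bar>B\<bar>\<close> keeps the minimum nonnegative without a discussion
    of the sign of \<open>B\<close>.\<close>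
  define r' where "r' t = min (if t \<in> {0..} then r t else 0) \<bar>B\<bar>" for t
  have "(\<lambda>t. if t \<in> {0..} then r t else 0) \<in> borel_measurable lebesgue"
    using assms by (subst borel_measurable_if) (auto simp: rate_function_def)
  then have "r' \<in> borel_measurable lebesgue"
    unfolding r'_def by measurable
  moreover have "AE t in lebesgue. 0 \<le> t \<longrightarrow> r' t = r t"
    using B by (subst (asm) AE_restrict_space_iff) (auto simp: r'_def elim!: eventually_mono)
  moreover have "0 \<le> r' t" "r' t \<le> \<bar>B\<bar>" for t
    using assms by (auto simp: r'_def rate_function_def)
  ultimately show ?thesis
    using that by blast
qed

text \<open>The primitive of the bounded version \<open>r'\<close> serves. Its divergence follows by
  monotone convergence over the intervals \<open>{0..real n}\<close>: the values at integers have
  supremum infinity, and monotonicity extends this to all large times.\<close>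

lemma rate_primitive_exists:
  assumes "rate_function r"
  obtains \<rho> where "rate_primitive r \<rho>"
proof -
  obtain r' B where r': "r' \<in> borel_measurable lebesgue" "\<And>t. 0 \<le> r' t" "\<And>t. r' t \<le> B"
    "AE t in lebesgue. 0 \<le> t \<longrightarrow> r' t = r t"
    using rate_function_bounded_version[OF assms] by blast
  have abs: "\<bar>r' t\<bar> \<le> B" for t
    using r'(2,3) by simp
  note int = bounded_measurable_integrable_on[OF r'(1) abs]
  define \<rho> where "\<rho> t = integral {0..t} r'" for t
  have diff: "\<rho> v - \<rho> u = integral {u..v} r'" if "0 \<le> u" "u \<le> v" for u v
    using Henstock_Kurzweil_Integration.integral_combine[where f=r' and a=0 and c=u and b=v] int that
    by (simp add: \<rho>_def)
  have incr: "0 \<le> \<rho> v - \<rho> u" if "0 \<le> u" "u \<le> v" for u v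
    using diff[OF that] integral_nonneg[OF int] r'(2) by simp
  have "\<rho> v - \<rho> u \<le> B * (v - u)" if "0 \<le> u" "u \<le> v" for u v
    using integral_lipschitz[OF r'(1) abs that] by (simp add: \<rho>_def)
  moreover have "filterlim \<rho> at_top at_top"
  proof -
    have nn: "(\<integral>\<^sup>+ t. ennreal (indicator {0..real n} t * r' t) \<partial>lebesgue) = ennreal (\<rho> (real n))" for n
    proof -
      have "((\<lambda>t. indicator {0..real n} t * r' t) has_integral \<rho> (real n)) UNIV"
        using integrable_integral[OF int[of 0 "real n"]] has_integral_restrict_UNIV[of "{0..real n}" r']
        by (simp add: \<rho>_def indicator_def of_bool_def if_distrib[of "\<lambda>c. c * _"] cong: if_cong)
      then show ?thesis
        by (subst (asm) has_integral_iff_nn_integral_lebesgue) (auto simp: r'(2))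
    qed
    have "\<infinity> = (\<integral>\<^sup>+ t. ennreal (r t) * indicator {0..} t \<partial>lebesgue)"
      using assms by (simp add: rate_function_def nn_integral_restrict_space)
    also have "\<dots> = (\<integral>\<^sup>+ t. (SUP n. ennreal (indicator {0..real n} t * r' t)) \<partial>lebesgue)"
    proof (rule nn_integral_cong_AE)
      show "AE t in lebesgue. ennreal (r t) * indicator {0..} t = (SUP n. ennreal (indicator {0..real n} t * r' t))"
        using r'(4)
      proof eventually_elim
        case (elim t)
        show ?case
        proof (cases "0 \<le> t")
          case True
          obtain m where "t \<le> real m"
            using real_arch_simple by blast
          have "(SUP n. ennreal (indicator {0..real n} t * r' t)) = ennreal (r' t)"
          proof (rule antisym)
            show "(SUP n. ennreal (indicator {0..real n} t * r' t)) \<le> ennreal (r' t)"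
              using r'(2)[of t] by (intro SUP_least) (auto simp: indicator_def)
            show "ennreal (r' t) \<le> (SUP n. ennreal (indicator {0..real n} t * r' t))"
              using \<open>t \<le> real m\<close> True by (intro SUP_upper2[of m]) auto
          qed
          with True elim show ?thesis by simp
        qed simp
      qed
    qed
    also have "\<dots> = (SUP n. \<integral>\<^sup>+ t. ennreal (indicator {0..real n} t * r' t) \<partial>lebesgue)"
    proof (rule nn_integral_monotone_convergence_SUP)
      show "incseq (\<lambda>n t. ennreal (indicator {0..real n} t * r' t))"
        using r'(2) by (auto simp: incseq_def le_fun_def indicator_def intro!: ennreal_leI)
      show "(\<lambda>t. ennreal (indicator {0..real n} t * r' t)) \<in> borel_measurable lebesgue" for n
        by (intro measurable_compose[OF _ measurable_ennreal] borel_measurable_times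
            borel_measurable_indicator r'(1)) simp
    qed
    finally have sup: "(SUP n. ennreal (\<rho> (real n))) = \<infinity>"
      by (simp add: nn)
    show ?thesis
      unfolding filterlim_at_top
    proof
      fix Z :: real
      have "\<exists>n. Z \<le> \<rho> (real n)"
      proof (rule ccontr)
        assume "\<nexists>n. Z \<le> \<rho> (real n)"
        then have "(SUP n. ennreal (\<rho> (real n))) \<le> ennreal Z"
          by (intro SUP_least ennreal_leI) (auto simp: not_le less_imp_le)
        then show False
          unfolding sup by (simp add: top_unique)
      qed
      then obtain n where "Z \<le> \<rho> (real n)" ..
      then show "eventually (\<lambda>t. Z \<le> \<rho> t) at_top"
        using incr[of "real n"] by (intro eventually_at_top_linorderI[of "real n"]) fastforce
    qed
  qed
  moreover have "AE t in lebesgue. 0 < t \<longrightarrow> (\<rho> has_real_derivative r t) (at t)"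
    using AE_has_real_derivative_integral[OF int, of 0] r'(4)
    by eventually_elim (auto simp: \<rho>_def[abs_def])
  ultimately have "rate_primitive r \<rho>"
    using incr unfolding rate_primitive_def by blast
  then show ?thesis by (rule that)
qed

section \<open>The delay kernel\<close>

lemma mono_tendsto_Lim_at_right:
  fixes f :: "real \<Rightarrow> real"
  assumes "mono f"
  shows "(f \<longlongrightarrow> Lim (at_right s) f) (at_right s)"
proof -
  have "(f \<longlongrightarrow> Inf (f ` ({s<..} \<inter> UNIV))) (at s within ({s<..} \<inter> UNIV))"
    by (rule Lim_right_bound[where K="f s"]) (use assms in \<open>auto simp: mono_def\<close>)
  then show ?thesis
    using tendsto_Lim[of "at_right s" f] by simp
qed

lemma mono_le_Lim_at_right:
  fixes f :: "real \<Rightarrow> real"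
  assumes "mono f"
  shows "f s \<le> Lim (at_right s) f"
  by (rule tendsto_lowerbound[OF mono_tendsto_Lim_at_right[OF assms]])
    (use assms in \<open>auto simp: eventually_at_filter mono_def\<close>)

lemma mono_Lim_at_right_le:
  fixes f :: "real \<Rightarrow> real"
  assumes "mono f" "s < u"
  shows "Lim (at_right s) f \<le> f u"
proof (rule tendsto_upperbound[OF mono_tendsto_Lim_at_right[OF assms(1)]])
  show "eventually (\<lambda>v. f v \<le> f u) (at_right s)"
    using eventually_at_right_less[of s] eventually_at_right[OF assms(2)] assms
    by (auto simp: mono_def intro!: exI[of _ u])
qed simp

lemma mono_Lim_at_right:
  fixes f :: "real \<Rightarrow> real"
  assumes "mono f" "s \<le> u"
  shows "Lim (at_right s) f \<le> Lim (at_right u) f"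
  using mono_Lim_at_right_le[OF assms(1), of s u] mono_le_Lim_at_right[OF assms(1), of u] assms(2)
  by (cases "s = u") auto

text \<open>Right continuity is what \<open>interval_measure\<close> demands of a distribution
  function. For the upper estimate, the right limit at \<open>u\<close> is bounded by the value of
  \<open>f\<close> at a point between \<open>u\<close> and \<open>b\<close>.\<close>

lemma continuous_Lim_at_right:
  fixes f :: "real \<Rightarrow> real"
  assumes "mono f"
  shows "continuous (at_right s) (\<lambda>s. Lim (at_right s) f)"
  unfolding continuous_within
proof (rule order_tendstoI)
  fix a assume "a < Lim (at_right s) f"
  then have "a < Lim (at_right u) f" if "s < u" for u
    using mono_Lim_at_right[OF assms, of s u] that by simp
  then show "eventually (\<lambda>u. a < Lim (at_right u) f) (at_right s)"
    by (auto simp: eventually_at_filter)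
next
  fix a assume "Lim (at_right s) f < a"
  then have "eventually (\<lambda>u. f u < a) (at_right s)"
    using order_tendstoD(2)[OF mono_tendsto_Lim_at_right[OF assms]] by blast
  then obtain b where b: "s < b" "\<And>u. s < u \<Longrightarrow> u < b \<Longrightarrow> f u < a"
    unfolding eventually_at_right_field by blast
  have "Lim (at_right u) f < a" if "s < u" "u < b" for u
    using mono_Lim_at_right_le[OF assms, of u "(u + b) / 2"] b(2)[of "(u + b) / 2"] that by simp
  with b(1) show "eventually (\<lambda>u. Lim (at_right u) f < a) (at_right s)"
    unfolding eventually_at_right_field by blast
qed

text \<open>Cutting off by a density instead of restricting the space leaves the same space and the
  same Borel sets for every \<open>t\<close>, so that \<open>t\<close> can be varied as the
  parameter of a probability kernel.\<close>

definition delay_measure :: "(real \<Rightarrow> real) \<Rightarrow> (real \<Rightarrow> real \<Rightarrow> real) \<Rightarrow> real \<Rightarrow> real measure" where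
  "delay_measure h R t =
     density (interval_measure (\<lambda>s. Lim (at_right s) (R t))) (\<lambda>s. ennreal (indicator {h t..t} s))"

lemma sets_delay_measure [simp, measurable_cong]: "sets (delay_measure h R t) = sets borel"
  by (simp add: delay_measure_def)

lemma space_delay_measure [simp]: "space (delay_measure h R t) = UNIV"
  by (simp add: delay_measure_def)

lemma delay_distributionD:
  assumes "delay_distribution h R" "0 \<le> t"
  shows "mono (R t)" "\<And>s. s \<le> h t \<Longrightarrow> R t s = 0" "Lim (at_right t) (R t) = 1"
  using assms tendsto_Lim[of "at_right t" "R t" 1] by (auto simp: delay_distribution_def)

text \<open>The measure is given on half-open intervals, which miss the atom at the left end.
  Approaching \<open>h t\<close> strictly from the left recovers it, because the distribution
  function vanishes there. The minimum with \<open>t\<close> reflects the cut-off at the right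
  end.\<close>

lemma emeasure_delay_measure_atMost:
  assumes R: "delay_distribution h R" and t: "0 \<le> t" "h t \<le> t"
  shows "emeasure (delay_measure h R t) {..b} = ennreal (Lim (at_right (min b t)) (R t))"
proof -
  define F where "F s = Lim (at_right s) (R t)" for s
  note R' = delay_distributionD[OF R t(1)]
  have F_mono: "s \<le> u \<Longrightarrow> F s \<le> F u" for s u
    unfolding F_def using mono_Lim_at_right[OF R'(1)] .
  \<comment> \<open>The inequality is strict: with an atom at \<open>h t\<close>, the value
    \<open>F (h t)\<close> is positive although \<open>R t (h t)\<close> is 0.\<close>
  have F_0: "F s = 0" if "s < h t" for s
    unfolding F_def using mono_Lim_at_right_le[OF R'(1) that] mono_le_Lim_at_right[OF R'(1), of s]
      R'(2)[of s] R'(2)[of "h t"] that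
    by linarith
  have Ioc: "emeasure (interval_measure F) {a<..b} = F b - F a" if "a \<le> b" for a b
    using that F_mono continuous_Lim_at_right[OF R'(1)] unfolding F_def[abs_def]
    by (intro emeasure_interval_measure_Ioc) auto
  have *: "emeasure (interval_measure F) {h t..b} = ennreal (F b)" if "h t \<le> b" for b
  proof (rule LIMSEQ_unique)
    have eq: "{h t..b} = (\<Inter>n. {h t - 1 / real (Suc n)<..b})"
    proof (intro set_eqI iffI)
      fix s assume s: "s \<in> (\<Inter>n. {h t - 1 / real (Suc n)<..b})"
      have "h t \<le> s"
      proof (rule ccontr)
        assume "\<not> h t \<le> s"
        then obtain n where "1 / real (Suc n) < h t - s"
          using nat_approx_posE[of "h t - s"] by auto
        moreover have "h t - 1 / real (Suc n) < s"
          using s by auto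
        ultimately show False by simp
      qed
      with s show "s \<in> {h t..b}" by auto
    qed (auto intro: less_le_trans[of _ "h t"])
    show "(\<lambda>n. emeasure (interval_measure F) {h t - 1 / real (Suc n)<..b}) \<longlonglongrightarrow> emeasure (interval_measure F) {h t..b}"
      unfolding eq
    proof (rule Lim_emeasure_decseq)
      show "decseq (\<lambda>n. {h t - 1 / real (Suc n)<..b})"
        unfolding decseq_def by (force simp: frac_le intro: le_less_trans[rotated])
      show "emeasure (interval_measure F) {h t - 1 / real (Suc n)<..b} \<noteq> \<infinity>" for n
      proof -
        have "h t - 1 / real (Suc n) \<le> b"
          using that by (smt (verit) of_nat_0_less_iff zero_less_Suc divide_pos_pos)
        then show ?thesis by (simp add: Ioc)
      qed
    qed auto
    have "emeasure (interval_measure F) {h t - 1 / real (Suc n)<..b} = ennreal (F b)" for n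
    proof -
      have "h t - 1 / real (Suc n) < h t"
        by simp
      moreover from this that have "h t - 1 / real (Suc n) \<le> b"
        by linarith
      ultimately show ?thesis
        using Ioc F_0 by simp
    qed
    then show "(\<lambda>n. emeasure (interval_measure F) {h t - 1 / real (Suc n)<..b}) \<longlonglongrightarrow> ennreal (F b)"
      by simp
  qed
  have "emeasure (delay_measure h R t) {..b} = emeasure (interval_measure F) ({..b} \<inter> {h t..t})"
    unfolding delay_measure_def F_def[symmetric]
    by (simp add: ennreal_indicator emeasure_restricted Int_commute)
  also have "{..b} \<inter> {h t..t} = {h t..min b t}"
    by auto
  also have "emeasure (interval_measure F) \<dots> = ennreal (F (min b t))"
    using *[of "min b t"] F_0[of "min b t"] t by (cases "h t \<le> min b t") auto
  finally show ?thesis by (simp add: F_def)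
qed

lemma prob_space_delay_measure:
  assumes R: "delay_distribution h R" and t: "0 \<le> t" "h t \<le> t"
  shows "prob_space (delay_measure h R t)"
proof
  note R' = delay_distributionD[OF R t(1)]
  have "emeasure (delay_measure h R t) UNIV = emeasure (delay_measure h R t) {..t}"
  proof (rule emeasure_eq_AE)
    show "AE s in delay_measure h R t. s \<in> UNIV \<longleftrightarrow> s \<in> {..t}"
      unfolding delay_measure_def by (subst AE_density) (auto split: split_indicator)
  qed auto
  then show "emeasure (delay_measure h R t) (space (delay_measure h R t)) = 1"
    using emeasure_delay_measure_atMost[OF assms, of t] R'(3) by simp
qed

text \<open>The integrand coming from a solution is controlled only on the delay interval. Any Borel
  function that agrees with it there may replace it, which turns the delay integral into an
  expectation on the whole line.\<close>

lemma delay_integral_eq: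
  assumes "g' \<in> borel_measurable borel" "\<And>s. s \<in> {h t..t} \<Longrightarrow> g' s = g s"
  shows "delay_integral h R g t = (\<integral>s. g' s \<partial>delay_measure h R t)"
proof -
  have "delay_integral h R g t =
      (\<integral>s. indicator {h t..t} s *\<^sub>R g' s \<partial>interval_measure (\<lambda>s. Lim (at_right s) (R t)))"
    unfolding delay_integral_def set_lebesgue_integral_def
    using assms(2) by (intro Bochner_Integration.integral_cong) (auto split: split_indicator)
  also have "\<dots> = (\<integral>s. g' s \<partial>delay_measure h R t)"
    unfolding delay_measure_def using assms(1) by (subst integral_density) auto
  finally show ?thesis .
qed

lemma delay_integral_sign:
  assumes R: "delay_distribution h R" and t: "0 \<le> t" "h t \<le> t"
    and g: "continuous_on {h t..t} g" and sign: "\<And>s. s \<in> {h t..t} \<Longrightarrow> 0 \<le> \<sigma> * (g s - L)"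
  shows "0 \<le> \<sigma> * (delay_integral h R g t - L)"
proof -
  interpret prob_space "delay_measure h R t"
    using R t by (rule prob_space_delay_measure)
  \<comment> \<open>Clamping the argument yields a bounded continuous function on the whole line
    without changing \<open>g\<close> on the delay interval; its mean lies on the same side of
    \<open>L\<close> as its values.\<close>
  define g' where "g' s = g (max (h t) (min s t))" for s
  have "continuous_on UNIV g'"
    unfolding g'_def by (rule continuous_on_compose2[OF g]) (use t in \<open>auto intro!: continuous_intros\<close>)
  then have meas: "g' \<in> borel_measurable borel"
    by (rule borel_measurable_continuous_onI)
  have "bounded (g ` {h t..t})"
    using compact_continuous_image[OF g] by (simp add: compact_imp_bounded)
  then obtain B where B: "\<forall>s\<in>{h t..t}. \<bar>g s\<bar> \<le> B"
    unfolding bounded_iff by auto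
  have int: "integrable (delay_measure h R t) g'"
    by (rule integrable_const_bound[where B=B])
      (use meas B t in \<open>auto simp: g'_def measurable_cong_sets[OF sets_delay_measure refl]\<close>)
  have "0 \<le> (\<integral>s. \<sigma> * (g' s - L) \<partial>delay_measure h R t)"
    using t by (intro Bochner_Integration.integral_nonneg) (auto simp: g'_def intro!: sign)
  also have "\<dots> = \<sigma> * ((\<integral>s. g' s \<partial>delay_measure h R t) - L)"
    using int prob_space by (simp add: Bochner_Integration.integral_diff)
  also have "(\<integral>s. g' s \<partial>delay_measure h R t) = delay_integral h R g t"
    using meas by (rule delay_integral_eq[symmetric]) (auto simp: g'_def)
  finally show ?thesis .
qed

lemma delay_distribution_measurable:
  assumes R: "delay_distribution h R"
  shows "(\<lambda>t. R t s) \<in> borel_measurable (lebesgue_on {0..})"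
proof -
  have "(\<lambda>t. indicator {0..} t *\<^sub>R R t s) \<in> borel_measurable lebesgue"
  proof (rule borel_measurable_LIMSEQ_real)
    show "(\<lambda>t. indicator {0..real n} t *\<^sub>R R t s) \<in> borel_measurable lebesgue" for n
      using R by (auto simp: delay_distribution_def set_integrable_def intro: borel_measurable_integrable)
    show "(\<lambda>n. indicator {0..real n} t *\<^sub>R R t s) \<longlonglongrightarrow> indicator {0..} t *\<^sub>R R t s" for t
    proof (rule tendsto_eventually)
      obtain m where "t \<le> real m"
        using real_arch_simple by blast
      then show "eventually (\<lambda>n. indicator {0..real n} t *\<^sub>R R t s = indicator {0..} t *\<^sub>R R t s) sequentially"
        by (auto simp: eventually_sequentially indicator_def intro!: exI[of _ m])
    qed
  qed
  then show ?thesis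
    by (subst borel_measurable_restrict_space_iff) auto
qed

text \<open>It suffices to test the half-lines \<open>{..b}\<close>, which are stable under
  intersection and generate the Borel sets. The mass of \<open>{..b}\<close> is 1 if
  \<open>t \<le> b\<close>, and otherwise the right limit of \<open>R t\<close> at \<open>b\<close>,
  a limit along \<open>b + 1 / real (Suc n)\<close> of functions measurable in
  \<open>t\<close>.\<close>

lemma measurable_delay_measure:
  assumes R: "delay_distribution h R" and h: "delay h"
  shows "delay_measure h R \<in> measurable (lebesgue_on {0..}) (prob_algebra borel)"
proof (rule measurable_prob_algebra_generated[where \<Omega>=UNIV and G="range (\<lambda>b::real. {..b})"])
  show "sets borel = sigma_sets UNIV (range (\<lambda>b::real. {..b}))"
    by (simp add: borel_eq_atMost)
  show "Int_stable (range (\<lambda>b::real. {..b}))"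
    by (auto simp: Int_stable_def)
  show "prob_space (delay_measure h R t)" if "t \<in> space (lebesgue_on {0..})" for t
    using that h by (intro prob_space_delay_measure[OF R]) (auto simp: delay_def)
  fix A :: "real set" assume "A \<in> range (\<lambda>b. {..b})"
  then obtain b where A: "A = {..b}" by blast
  have meas: "(\<lambda>t. if t \<le> b then 1 else Lim (at_right b) (R t)) \<in> borel_measurable (lebesgue_on {0..})"
  proof (rule borel_measurable_LIMSEQ_real)
    have "{t. t \<le> b} \<inter> space (lebesgue_on {0..}) \<in> sets (lebesgue_on {0..})"
      by (auto simp: sets_restrict_space space_restrict_space intro!: image_eqI[of _ _ "{..b}"])
    then show "(\<lambda>t. if t \<le> b then 1 else R t (b + 1 / real (Suc n))) \<in> borel_measurable (lebesgue_on {0..})" for n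
      using delay_distribution_measurable[OF R] by (intro measurable_If) (auto simp: Int_def conj_commute)
    show "(\<lambda>n. if t \<le> b then 1 else R t (b + 1 / real (Suc n))) \<longlonglongrightarrow> (if t \<le> b then 1 else Lim (at_right b) (R t))"
      if "t \<in> space (lebesgue_on {0..})" for t
    proof -
      have "filterlim (\<lambda>n. b + 1 / real (Suc n)) (at_right b) sequentially"
        unfolding filterlim_at using tendsto_add[OF tendsto_const LIMSEQ_Suc[OF lim_inverse_n'], of b]
        by auto
      then show ?thesis
        using filterlim_compose[OF mono_tendsto_Lim_at_right[OF delay_distributionD(1)[OF R]]] that
        by auto
    qed
  qed
  have "emeasure (delay_measure h R t) A = ennreal (if t \<le> b then 1 else Lim (at_right b) (R t))"
    if "t \<in> space (lebesgue_on {0..})" for t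
    using that h emeasure_delay_measure_atMost[OF R, of t b] delay_distributionD(3)[OF R, of t]
    by (auto simp: A delay_def min_def)
  then show "(\<lambda>t. emeasure (delay_measure h R t) A) \<in> borel_measurable (lebesgue_on {0..})"
    by (subst measurable_cong, assumption) (intro measurable_compose[OF meas] measurable_ennreal)
qed auto

lemma measurable_integral_delay_measure:
  fixes g :: "real \<Rightarrow> real"
  assumes "delay_distribution h R" "delay h" and g: "g \<in> borel_measurable borel"
  shows "(\<lambda>t. \<integral>s. g s \<partial>delay_measure h R t) \<in> borel_measurable (lebesgue_on {0..})"
  using measurable_delay_measure[OF assms(1,2)]
  by (rule measurable_compose[OF measurable_prob_algebraD integral_measurable_subprob_algebra[OF g]])

section \<open>Continuation of bounded solutions\<close>

text \<open>Both \<open>C * t + f t\<close> and \<open>C * t - f t\<close> have a nonnegative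
  derivative almost everywhere and hence are nondecreasing.\<close>

lemma absolutely_continuous_bounded_derivative:
  assumes f: "absolutely_continuous_fun_on a b f" and ab: "a \<le> b"
    and deriv: "AE t in lebesgue. a < t \<and> t < b \<longrightarrow> (\<exists>d. (f has_real_derivative d) (at t) \<and> \<bar>d\<bar> \<le> C)"
  shows "\<bar>f b - f a\<bar> \<le> C * (b - a)"
proof -
  have mono: "C * a + s * f a \<le> C * b + s * f b" if s: "\<bar>s\<bar> = 1" for s :: real
  proof (rule absolutely_continuous_imp_mono[OF _ ab])
    show "absolutely_continuous_fun_on a b (\<lambda>t. C * t + s * f t)"
    proof (rule absolutely_continuous_fun_on_dominated[OF absolutely_continuous_fun_on_ident f])
      fix u v
      have "C * v + s * f v - (C * u + s * f u) = C * (v - u) + s * (f v - f u)"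
        by (simp add: algebra_simps)
      also have "\<bar>\<dots>\<bar> \<le> \<bar>C\<bar> * \<bar>v - u\<bar> + 1 * \<bar>f v - f u\<bar>"
        using abs_triangle_ineq[of "C * (v - u)" "s * (f v - f u)"] s by (simp add: abs_mult)
      finally show "\<bar>C * v + s * f v - (C * u + s * f u)\<bar> \<le> \<bar>C\<bar> * \<bar>v - u\<bar> + 1 * \<bar>f v - f u\<bar>" .
    qed
    show "AE t in lebesgue. a < t \<and> t < b \<longrightarrow> (\<exists>d\<ge>0. ((\<lambda>t. C * t + s * f t) has_real_derivative d) (at t))"
      using deriv
    proof eventually_elim
      case (elim t)
      show ?case
      proof
        assume "a < t \<and> t < b"
        then obtain d where d: "(f has_real_derivative d) (at t)" "\<bar>d\<bar> \<le> C"
          using elim by blast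
        have "((\<lambda>t. C * t + s * f t) has_real_derivative C + s * d) (at t)"
          by (auto intro!: derivative_eq_intros d(1))
        moreover have "\<bar>s * d\<bar> \<le> C"
          using s d(2) by (simp add: abs_mult)
        ultimately show "\<exists>d\<ge>0. ((\<lambda>t. C * t + s * f t) has_real_derivative d) (at t)"
          by (intro exI[of _ "C + s * d"]) auto
      qed
    qed
  qed
  show ?thesis
    using mono[of 1] mono[of "-1"] by (simp add: algebra_simps abs_le_iff)
qed

text \<open>Adding \<open>C * u\<close> makes \<open>x\<close> nondecreasing and bounded above on
  the half-open interval. Its supremum there, corrected by \<open>C * b\<close>, is the limit at
  \<open>b\<close>, with the Lipschitz estimate included.\<close>

lemma lipschitz_left_limit:
  fixes x :: "real \<Rightarrow> real"
  assumes lip: "\<And>u v. \<lbrakk>a \<le> u; u \<le> v; v < b\<rbrakk> \<Longrightarrow> \<bar>x v - x u\<bar> \<le> C * (v - u)" and "a < b" "0 \<le> C"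
  obtains l where "\<And>u. \<lbrakk>a \<le> u; u < b\<rbrakk> \<Longrightarrow> \<bar>l - x u\<bar> \<le> C * (b - u)"
proof -
  define W where "W = (\<lambda>u. x u + C * u) ` {a..<b}"
  have bound: "x v + C * v \<le> x u + 2 * C * b - C * u" if "a \<le> u" "u < b" "a \<le> v" "v < b" for u v
  proof (cases "u \<le> v")
    case True
    have "C * v \<le> C * b"
      using that \<open>0 \<le> C\<close> by (intro mult_left_mono) auto
    then show ?thesis
      using lip[of u v] True that by (simp add: algebra_simps abs_le_iff)
  next
    case False
    have "C * u \<le> C * b"
      using that \<open>0 \<le> C\<close> by (intro mult_left_mono) auto
    then show ?thesis
      using lip[of v u] False that by (simp add: algebra_simps abs_le_iff)
  qed
  have "bdd_above W"
    using bound[of a] \<open>a < b\<close> unfolding W_def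
    by (intro bdd_aboveI[of _ "x a + 2 * C * b - C * a"]) auto
  show thesis
  proof (rule that[of "Sup W - C * b"])
    fix u assume u: "a \<le> u" "u < b"
    have "x u + C * u \<le> Sup W"
      using u \<open>bdd_above W\<close> unfolding W_def by (intro cSup_upper) auto
    moreover have "Sup W \<le> x u + 2 * C * b - C * u"
      using bound[of u] u unfolding W_def by (intro cSup_least) auto
    ultimately show "\<bar>Sup W - C * b - x u\<bar> \<le> C * (b - u)"
      by (simp add: abs_le_iff algebra_simps)
  qed
qed

section \<open>The linear equation for one component on a short interval beyond the end
  point\<close>

locale relaxation =
  fixes r \<rho> r' :: "real \<Rightarrow> real" and B T e :: real
  assumes primitive: "rate_primitive r \<rho>"
    and r'_meas: "r' \<in> borel_measurable lebesgue" and r'_nonneg: "\<And>t. 0 \<le> r' t" and r'_le: "\<And>t. r' t \<le> B"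
    and r'_eq: "AE t in lebesgue. 0 \<le> t \<longrightarrow> r' t = r t"
    and T: "0 \<le> T" "T < e"
begin

text \<open>The integrating factor is frozen outside \<open>[T, e]\<close> to keep integrands globally bounded.\<close>

definition E where "E s = exp (\<rho> (max T (min s e)))"

text \<open>The variation of constants formula: the solution of \<open>x' = r (D - x)\<close> with
  value \<open>a\<close> at \<open>T\<close>, where \<open>E\<close> is the integrating
  factor.\<close>

definition relax where
  "relax a D t = (a * E T + integral {T..t} (\<lambda>s. E s * r' s * D s)) / E t"

lemma E_pos: "0 < E s"
  by (simp add: E_def)

lemma E_mono: "s \<le> u \<Longrightarrow> E s \<le> E u"
  unfolding E_def using rate_primitive_mono[OF primitive] T by (simp add: max.coboundedI2 min.coboundedI1)

lemma E_eq: "T \<le> s \<Longrightarrow> s \<le> e \<Longrightarrow> E s = exp (\<rho> s)"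
  by (simp add: E_def)

lemma B_nonneg: "0 \<le> B"
  using r'_nonneg[of 0] r'_le[of 0] by simp

lemma absolutely_continuous_E: "absolutely_continuous_fun_on T e E"
  by (rule absolutely_continuous_fun_on_dominated[where A=1 and B=0,
      OF absolutely_continuous_exp_primitive[OF primitive T(1)] absolutely_continuous_exp_primitive[OF primitive T(1)]])
    (simp add: E_eq)

lemma continuous_E: "continuous_on UNIV E"
proof -
  have "continuous_on UNIV (\<lambda>s. E (max T (min s e)))"
    by (rule continuous_on_compose2[OF absolutely_continuous_imp_continuous[OF absolutely_continuous_E]])
      (use T in \<open>auto intro!: continuous_intros\<close>)
  moreover have "E (max T (min s e)) = E s" for s
    using T by (simp add: E_def)
  ultimately show ?thesis by simp
qed

context
  fixes D :: "real \<Rightarrow> real" and N :: real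
  assumes D_meas: "D \<in> borel_measurable lebesgue" and D_nonneg: "\<And>t. 0 \<le> D t" and D_le: "\<And>t. D t \<le> N"
begin

lemma integrand_meas: "(\<lambda>s. E s * r' s * D s) \<in> borel_measurable lebesgue"
proof -
  have "E \<in> borel_measurable lebesgue"
    using borel_measurable_continuous_onI[OF continuous_E] by (simp add: measurable_completion)
  then show ?thesis
    using r'_meas D_meas by (intro borel_measurable_times)
qed

lemma integrand_nonneg: "0 \<le> E s * r' s * D s"
  using E_pos[of s] r'_nonneg[of s] D_nonneg[of s] by simp

lemma integrand_le: "s \<le> t \<Longrightarrow> E s * r' s * D s \<le> E t * B * N"
  using E_mono[of s t] E_pos[of s] E_pos[of t] r'_nonneg[of s] r'_le[of s] D_nonneg[of s] D_le[of s] B_nonneg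
  by (intro mult_mono) auto

lemma integrand_bounded: "\<bar>E s * r' s * D s\<bar> \<le> E e * B * N"
proof -
  have "E s \<le> E e"
    using E_mono[of s e] T by (cases "s \<le> e") (auto simp: E_def)
  then show ?thesis
    using integrand_nonneg E_pos[of s] E_pos[of e] r'_nonneg[of s] r'_le[of s] D_nonneg[of s] D_le[of s] B_nonneg
    by (simp, intro mult_mono) auto
qed

lemmas integrand_integrable = bounded_measurable_integrable_on[OF integrand_meas integrand_bounded]

lemma relax_start: "relax a D T = a"
  using E_pos[of T] by (simp add: relax_def)

lemma relax_nonneg: "0 \<le> a \<Longrightarrow> 0 \<le> relax a D t"
  unfolding relax_def using E_pos[of T] E_pos[of t] integrand_nonneg
  by (intro divide_nonneg_pos add_nonneg_nonneg integral_nonneg integrand_integrable) auto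

text \<open>The quotient \<open>E s / E t\<close> is at most 1 for \<open>s \<le> t\<close>, so the
  weights drop out. The linear growth bound later fixes how short the interval of continuation has
  to be.\<close>

lemma relax_le:
  assumes "0 \<le> a" "T \<le> t"
  shows "relax a D t \<le> a + B * N * (t - T)"
proof -
  have "integral {T..t} (\<lambda>s. E s * r' s * D s) \<le> integral {T..t} (\<lambda>_. E t * B * N)"
    using integrand_le by (intro integral_le integrand_integrable) auto
  also have "\<dots> = E t * (B * N * (t - T))"
    using assms by simp
  finally have "a * E T + integral {T..t} (\<lambda>s. E s * r' s * D s) \<le> a * E t + E t * (B * N * (t - T))"
    using mult_left_mono[OF E_mono[OF assms(2)] assms(1)] by simp
  also have "a * E t + E t * (B * N * (t - T)) = (a + B * N * (t - T)) * E t"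
    by (simp add: algebra_simps)
  finally show ?thesis
    unfolding relax_def by (simp only: pos_divide_le_eq[OF E_pos])
qed

lemma absolutely_continuous_relax: "absolutely_continuous_fun_on T e (relax a D)"
proof -
  have 1: "absolutely_continuous_fun_on T e (\<lambda>t. a * E T + integral {T..t} (\<lambda>s. E s * r' s * D s))"
    using integral_lipschitz[OF integrand_meas integrand_bounded]
    by (intro lipschitz_imp_absolutely_continuous[where B="E e * B * N"]) auto
  have 2: "absolutely_continuous_fun_on T e (\<lambda>t. inverse (E t))"
  proof (rule absolutely_continuous_fun_on_dominated[OF absolutely_continuous_E absolutely_continuous_E])
    fix u v assume uv: "T \<le> u" "u \<le> v" "v \<le> e"
    have "inverse (E v) - inverse (E u) = - (inverse (E v) * (E v - E u) * inverse (E u))"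
      using E_pos[of u] E_pos[of v] by (simp add: field_simps)
    also have "\<bar>\<dots>\<bar> = inverse (E v) * inverse (E u) * \<bar>E v - E u\<bar>"
      using E_pos[of u] E_pos[of v] by (simp add: abs_mult)
    also have "\<dots> \<le> inverse (E T) * inverse (E T) * \<bar>E v - E u\<bar>"
      using E_pos[of T] E_pos[of u] E_mono[of T u] E_mono[of T v] uv
      by (intro mult_right_mono mult_mono le_imp_inverse_le) auto
    finally show "\<bar>inverse (E v) - inverse (E u)\<bar> \<le> inverse (E T) * inverse (E T) * \<bar>E v - E u\<bar> + 0 * \<bar>E v - E u\<bar>"
      by simp
  qed
  show ?thesis
    using absolutely_continuous_fun_on_mult[OF 1 2] by (simp add: relax_def[abs_def] divide_inverse)
qed

lemma AE_relax_derivative: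
  "AE t in lebesgue. T < t \<and> t < e \<longrightarrow> (relax a D has_real_derivative r t * (D t - relax a D t)) (at t)"
proof -
  have "AE t in lebesgue. 0 < t \<longrightarrow> (\<rho> has_real_derivative r t) (at t)"
    using primitive unfolding rate_primitive_def by blast
  then show ?thesis
    using AE_has_real_derivative_integral[OF integrand_integrable, of T] r'_eq
  proof eventually_elim
    case (elim t)
    show ?case
    proof
      assume t: "T < t \<and> t < e"
      have \<rho>: "(\<rho> has_real_derivative r t) (at t)"
        using elim t T by auto
      have "((\<lambda>s. exp (\<rho> s)) has_real_derivative exp (\<rho> t) * r t) (at t)"
        by (auto intro!: derivative_eq_intros \<rho>)
      then have E: "(E has_real_derivative E t * r t) (at t)"
      proof (rule has_field_derivative_transform_within_open[where S="{T<..<e}", THEN DERIV_cong])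
        show "exp (\<rho> t) * r t = E t * r t"
          using t by (simp add: E_eq)
      qed (use t in \<open>auto simp: E_eq\<close>)
      have "r' t = r t"
        using elim t T by auto
      then have I: "((\<lambda>u. integral {T..u} (\<lambda>s. E s * r' s * D s)) has_real_derivative E t * r t * D t) (at t)"
        using elim t by auto
      show "(relax a D has_real_derivative r t * (D t - relax a D t)) (at t)"
        unfolding relax_def[abs_def]
        by (rule derivative_eq_intros E I refl)+
          (use E_pos[of t] in \<open>auto simp: field_simps power2_eq_square\<close>)
    qed
  qed
qed

end

lemma relax_mono:
  assumes "D \<in> borel_measurable lebesgue" "\<And>t. 0 \<le> D t" "\<And>t. D t \<le> N"
    and "D' \<in> borel_measurable lebesgue" "\<And>t. 0 \<le> D' t" "\<And>t. D' t \<le> N" and le: "\<And>t. D t \<le> D' t"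
  shows "relax a D t \<le> relax a D' t"
proof -
  have "E s * r' s * D s \<le> E s * r' s * D' s" for s
    using E_pos[of s] r'_nonneg[of s] le[of s] by (intro mult_left_mono) auto
  then have "integral {T..t} (\<lambda>s. E s * r' s * D s) \<le> integral {T..t} (\<lambda>s. E s * r' s * D' s)"
    by (intro integral_le integrand_integrable[where N=N] assms) auto
  then show ?thesis
    unfolding relax_def using E_pos[of t] by (intro divide_right_mono add_left_mono) auto
qed

lemma relax_tendsto:
  assumes D: "\<And>n. D n \<in> borel_measurable lebesgue" "\<And>n t. 0 \<le> D n t" "\<And>n t. D n t \<le> N"
    and lim: "\<And>t. (\<lambda>n. D n t) \<longlonglongrightarrow> D' t"
  shows "(\<lambda>n. relax a (D n) t) \<longlonglongrightarrow> relax a D' t"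
proof -
  have "(\<lambda>n. integral {T..t} (\<lambda>s. E s * r' s * D n s)) \<longlonglongrightarrow> integral {T..t} (\<lambda>s. E s * r' s * D' s)"
  proof (rule dominated_convergence(2))
    show "(\<lambda>s. E s * r' s * D n s) integrable_on {T..t}" for n
      by (rule integrand_integrable[OF D])
    show "(\<lambda>_. E e * B * N) integrable_on {T..t}"
      by (rule integrable_const_ivl)
    show "norm (E s * r' s * D n s) \<le> E e * B * N" for n s
      using integrand_bounded[OF D] by simp
    show "(\<lambda>n. E s * r' s * D n s) \<longlonglongrightarrow> E s * r' s * D' s" for s
      by (intro tendsto_intros lim)
  qed
  then show ?thesis
    unfolding relax_def using E_pos[of t] by (intro tendsto_intros) auto
qed

end

section \<open>Averages of bounded profiles and the fixed point iteration\<close>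

lemma delay_integral_cong:
  "(\<And>s. s \<in> {h t..t} \<Longrightarrow> g s = g' s) \<Longrightarrow> delay_integral h R g t = delay_integral h R g' t"
  unfolding delay_integral_def set_lebesgue_integral_def
  by (intro Bochner_Integration.integral_cong) (auto split: split_indicator)

text \<open>Truncation at \<open>0\<close> is needed because \<open>f\<close> is unconstrained at negative arguments.\<close>

definition delay_average ::
  "(real \<Rightarrow> real) \<Rightarrow> (real \<Rightarrow> real \<Rightarrow> real) \<Rightarrow> (real \<Rightarrow> real) \<Rightarrow> real \<Rightarrow> (real \<Rightarrow> real) \<Rightarrow> real \<Rightarrow> real" where
  "delay_average h R f e v t =
     (if t \<in> {0..e} then \<integral>s. f (max 0 (v s)) \<partial>delay_measure h R t else 0)"

lemma production_functionD:
  assumes "production_function f"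
  shows "0 \<le> u \<Longrightarrow> 0 \<le> f u" "continuous_on {0..} f" "0 \<le> u \<Longrightarrow> u < v \<Longrightarrow> f u < f v"
    "0 \<le> u \<Longrightarrow> u \<le> v \<Longrightarrow> f u \<le> f v" "0 < u \<Longrightarrow> 0 < f u"
proof -
  show less: "f u < f v" if "0 \<le> u" "u < v" for u v
    using assms that strict_mono_onD[of "{0..}" f u v] by (auto simp: production_function_def)
  show "f u \<le> f v" if "0 \<le> u" "u \<le> v"
    using less[of u v] that by (cases "u = v") auto
qed (use assms in \<open>auto simp: production_function_def\<close>)

lemma continuous_production_max:
  assumes "production_function f"
  shows "continuous_on UNIV (\<lambda>u. f (max 0 u))"
  by (rule continuous_on_compose2[OF production_functionD(2)[OF assms]]) (auto intro!: continuous_intros)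

context
  fixes h f :: "real \<Rightarrow> real" and R :: "real \<Rightarrow> real \<Rightarrow> real" and e :: real
  assumes R: "delay_distribution h R" and h: "delay h" and f: "production_function f"
begin

context
  fixes v :: "real \<Rightarrow> real" and M :: real
  assumes v: "v \<in> borel_measurable borel" and v_le: "\<And>s. v s \<le> M" and M: "0 \<le> M"
begin

lemma production_measurable: "(\<lambda>s. f (max 0 (v s))) \<in> borel_measurable borel"
  using measurable_compose[OF v borel_measurable_continuous_onI[OF continuous_production_max[OF f]]] .

lemma production_bounds: "0 \<le> f (max 0 (v s))" "f (max 0 (v s)) \<le> f M"
  using production_functionD(1)[OF f] production_functionD(4)[OF f, of "max 0 (v s)" M] v_le[of s] M by auto

lemma integrable_production:
  assumes "0 \<le> t"
  shows "integrable (delay_measure h R t) (\<lambda>s. f (max 0 (v s)))"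
proof -
  interpret prob_space "delay_measure h R t"
    using h assms by (intro prob_space_delay_measure R) (auto simp: delay_def)
  show ?thesis
    by (rule integrable_const_bound[where B="f M"])
      (use production_measurable production_bounds in \<open>auto simp: measurable_cong_sets[OF sets_delay_measure refl]\<close>)
qed

lemma delay_average_nonneg: "0 \<le> delay_average h R f e v t"
  unfolding delay_average_def using production_bounds
  by (auto intro!: Bochner_Integration.integral_nonneg)

lemma delay_average_le: "delay_average h R f e v t \<le> f M"
proof (cases "t \<in> {0..e}")
  case True
  interpret prob_space "delay_measure h R t"
    using h True by (intro prob_space_delay_measure R) (auto simp: delay_def)
  have "(\<integral>s. f (max 0 (v s)) \<partial>delay_measure h R t) \<le> (\<integral>s. f M \<partial>delay_measure h R t)"
    using True production_bounds by (intro integral_mono integrable_production) auto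
  with True show ?thesis
    using prob_space by (simp add: delay_average_def)
qed (use production_functionD(1)[OF f M] in \<open>auto simp: delay_average_def\<close>)

lemma delay_average_measurable: "delay_average h R f e v \<in> borel_measurable lebesgue"
proof -
  have *: "(\<lambda>t. \<integral>s. f (max 0 (v s)) \<partial>delay_measure h R t) \<in> borel_measurable (lebesgue_on {0..})"
    by (rule measurable_integral_delay_measure[OF R h production_measurable])
  have "(\<lambda>t. if t \<in> {0..} then \<integral>s. f (max 0 (v s)) \<partial>delay_measure h R t else 0) \<in> borel_measurable lebesgue"
    using * by (subst borel_measurable_if) auto
  then have "(\<lambda>t. indicator {..e} t * (if t \<in> {0..} then \<integral>s. f (max 0 (v s)) \<partial>delay_measure h R t else 0)) \<in> borel_measurable lebesgue"
    by (intro borel_measurable_times borel_measurable_indicator) auto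
  also have "(\<lambda>t. indicator {..e} t * (if t \<in> {0..} then \<integral>s. f (max 0 (v s)) \<partial>delay_measure h R t else 0)) =
      delay_average h R f e v"
    by (auto simp: delay_average_def fun_eq_iff split: split_indicator)
  finally show ?thesis .
qed

lemma delay_average_eq:
  assumes "\<And>s. s \<le> t \<Longrightarrow> 0 \<le> v s" "t \<in> {0..e}"
  shows "delay_average h R f e v t = delay_integral h R (\<lambda>s. f (v s)) t"
  using assms delay_integral_eq[OF production_measurable, of h t "\<lambda>s. f (v s)" R]
  by (simp add: delay_average_def max_def)

end

lemma delay_average_mono:
  assumes "v \<in> borel_measurable borel" "\<And>s. v s \<le> M" "w \<in> borel_measurable borel" "\<And>s. w s \<le> M"
    and "0 \<le> M" and le: "\<And>s. v s \<le> w s"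
  shows "delay_average h R f e v t \<le> delay_average h R f e w t"
proof -
  have "f (max 0 (v s)) \<le> f (max 0 (w s))" for s
    using le[of s] by (intro production_functionD(4)[OF f]) auto
  then show ?thesis
    unfolding delay_average_def using assms
    by (auto intro!: integral_mono integrable_production[where M=M])
qed

lemma delay_average_tendsto:
  assumes v: "\<And>n. v n \<in> borel_measurable borel" "\<And>n s. v n s \<le> M" "0 \<le> M"
    and lim: "\<And>s. (\<lambda>n. v n s) \<longlonglongrightarrow> w s"
  shows "(\<lambda>n. delay_average h R f e (v n) t) \<longlonglongrightarrow> delay_average h R f e w t"
proof (cases "t \<in> {0..e}")
  case True
  interpret prob_space "delay_measure h R t"
    using h True by (intro prob_space_delay_measure R) (auto simp: delay_def)
  have w: "w \<in> borel_measurable borel"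
    using borel_measurable_LIMSEQ_real[OF lim v(1)] .
  have w_le: "w s \<le> M" for s
    using LIMSEQ_le_const2[OF lim] v(2) by blast
  have "(\<lambda>n. \<integral>s. f (max 0 (v n s)) \<partial>delay_measure h R t) \<longlonglongrightarrow> (\<integral>s. f (max 0 (w s)) \<partial>delay_measure h R t)"
  proof (rule integral_dominated_convergence[where w="\<lambda>_. f M"])
    show "AE s in delay_measure h R t. (\<lambda>n. f (max 0 (v n s))) \<longlonglongrightarrow> f (max 0 (w s))"
      using continuous_on_tendsto_compose[OF continuous_production_max[OF f] lim] by simp
    show "AE s in delay_measure h R t. norm (f (max 0 (v n s))) \<le> f M" for n
      using production_bounds[OF v(1,2,3)] by simp
  qed (use production_measurable[OF v] production_measurable[OF w w_le v(3)] in
      \<open>auto simp: measurable_cong_sets[OF sets_delay_measure refl]\<close>)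
  with True show ?thesis
    by (simp add: delay_average_def)
next
  case False
  then have "delay_average h R f e w' t = 0" for w'
    unfolding delay_average_def by (rule if_not_P)
  then show ?thesis by simp
qed

end

text \<open>The order interval on which the iteration runs. Borel measurability is required instead
  of continuity because it passes directly to pointwise limits.\<close>

definition profile :: "real \<Rightarrow> (real \<Rightarrow> real) \<Rightarrow> bool" where
  "profile M w \<longleftrightarrow> w \<in> borel_measurable borel \<and> (\<forall>s. 0 \<le> w s \<and> w s \<le> M)"

context relaxation
begin

text \<open>One component of the iteration: the history \<open>X\<close> is kept up to
  \<open>T\<close>, the target on \<open>[T, e]\<close> is computed from the other component
  \<open>v\<close>, and the value at \<open>e\<close> is continued as a constant to give a profile
  on the whole line.\<close>

definition relax_step where
  "relax_step h R f X v s =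
     (if s \<le> T then X s else relax (X T) (delay_average h R f e v) (min s e))"

context
  fixes h f X :: "real \<Rightarrow> real" and R :: "real \<Rightarrow> real \<Rightarrow> real" and M :: real
  assumes R: "delay_distribution h R" and h: "delay h" and f: "production_function f"
    and X: "profile M X" and small: "X T + B * f M * (e - T) \<le> M"
begin

lemma M_nonneg: "0 \<le> M"
  using X order_trans unfolding profile_def by blast

lemma delay_average_props:
  assumes "profile M v"
  shows "delay_average h R f e v \<in> borel_measurable lebesgue" "0 \<le> delay_average h R f e v t"
    "delay_average h R f e v t \<le> f M"
  using assms M_nonneg delay_average_measurable[OF R h f, of v M] delay_average_nonneg[OF R h f, of v M]
    delay_average_le[OF R h f, of v M] by (auto simp: profile_def)

text \<open>The condition \<open>small\<close> is tailored to \<open>relax_le\<close>: the target is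
  at most \<open>f M\<close>, so on \<open>[T, e]\<close> the new component grows by at most
  \<open>B * f M * (e - T)\<close>.\<close>

lemma profile_relax_step:
  assumes v: "profile M v"
  shows "profile M (relax_step h R f X v)"
  unfolding profile_def
proof (intro conjI allI)
  note D = delay_average_props[OF v]
  have X': "X \<in> borel_measurable borel" "0 \<le> X s" "X s \<le> M" for s
    using X by (auto simp: profile_def)
  show "0 \<le> relax_step h R f X v s" for s
    using X' relax_nonneg[OF D] by (simp add: relax_step_def)
  show "relax_step h R f X v s \<le> M" for s
  proof (cases "s \<le> T")
    case False
    then have "relax_step h R f X v s \<le> X T + B * f M * (min s e - T)"
      using relax_le[OF D, of "X T" "min s e"] X' T by (simp add: relax_step_def)
    also have "\<dots> \<le> X T + B * f M * (e - T)"
      using B_nonneg production_functionD(1)[OF f M_nonneg] by (intro add_left_mono mult_left_mono) auto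
    finally show ?thesis
      using small by simp
  qed (use X' in \<open>simp add: relax_step_def\<close>)
  have "continuous_on UNIV (\<lambda>s. relax (X T) (delay_average h R f e v) (max T (min s e)))"
    by (rule continuous_on_compose2[OF absolutely_continuous_imp_continuous[OF absolutely_continuous_relax[OF D]]])
      (use T in \<open>auto intro!: continuous_intros\<close>)
  then have "(\<lambda>s. relax (X T) (delay_average h R f e v) (max T (min s e))) \<in> borel_measurable borel"
    by (rule borel_measurable_continuous_onI)
  with X'(1) have "(\<lambda>s. if s \<le> T then X s
      else relax (X T) (delay_average h R f e v) (max T (min s e))) \<in> borel_measurable borel"
    by measurable
  also have "(\<lambda>s. if s \<le> T then X s
      else relax (X T) (delay_average h R f e v) (max T (min s e))) = relax_step h R f X v"
    using T by (auto simp: relax_step_def fun_eq_iff max_def)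
  finally show "relax_step h R f X v \<in> borel_measurable borel" .
qed

lemma relax_step_mono:
  assumes v: "profile M v" and w: "profile M w" and le: "\<And>s. v s \<le> w s"
  shows "relax_step h R f X v s \<le> relax_step h R f X w s"
proof -
  have "delay_average h R f e v t \<le> delay_average h R f e w t" for t
    using v w by (intro delay_average_mono[OF R h f, where M=M]) (auto simp: profile_def M_nonneg le)
  then show ?thesis
    unfolding relax_step_def using relax_mono[OF delay_average_props[OF v] delay_average_props[OF w]] by auto
qed

lemma relax_step_tendsto:
  assumes v: "\<And>n. profile M (v n)" and lim: "\<And>s. (\<lambda>n. v n s) \<longlonglongrightarrow> w s"
  shows "(\<lambda>n. relax_step h R f X (v n) s) \<longlonglongrightarrow> relax_step h R f X w s"
proof -
  have "(\<lambda>n. delay_average h R f e (v n) t) \<longlonglongrightarrow> delay_average h R f e w t" for t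
    using v by (intro delay_average_tendsto[OF R h f, where M=M]) (auto simp: profile_def M_nonneg lim)
  from relax_tendsto[OF delay_average_props[OF v] this] show ?thesis
    unfolding relax_step_def by simp
qed

end

end

text \<open>The iteration is monotone because \<open>f1\<close>, \<open>f2\<close> are increasing, so the iterates converge
  although the right-hand side need not be Lipschitz continuous.\<close>

lemma local_fixed_point:
  assumes f: "production_function f1" "production_function f2"
    and h: "delay h1" "delay h2" and R: "delay_distribution h1 R1" "delay_distribution h2 R2"
    and relax1: "relaxation r1 \<rho>1 r1' B1 T e" and relax2: "relaxation r2 \<rho>2 r2' B2 T e"
    and X: "profile M X" and Y: "profile M Y"
    and small: "X T + B1 * f1 M * (e - T) \<le> M" "Y T + B2 * f2 M * (e - T) \<le> M"
  obtains u v where "profile M u" "profile M v"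
    "u = relaxation.relax_step \<rho>1 r1' T e h1 R1 f1 X v"
    "v = relaxation.relax_step \<rho>2 r2' T e h2 R2 f2 Y u"
proof -
  interpret A: relaxation r1 \<rho>1 r1' B1 T e by fact
  interpret B: relaxation r2 \<rho>2 r2' B2 T e by fact
  define \<Phi> where "\<Phi> = A.relax_step h1 R1 f1 X"
  define \<Psi> where "\<Psi> = B.relax_step h2 R2 f2 Y"
  have M: "0 \<le> M"
    using A.M_nonneg[OF R(1) h(1) f(1) X small(1)] .
  have \<Phi>: "profile M v \<Longrightarrow> profile M (\<Phi> v)"
    "profile M v \<Longrightarrow> profile M w \<Longrightarrow> (\<And>s. v s \<le> w s) \<Longrightarrow> \<Phi> v s \<le> \<Phi> w s" for v w s
    unfolding \<Phi>_def
    using A.profile_relax_step[OF R(1) h(1) f(1) X small(1)] A.relax_step_mono[OF R(1) h(1) f(1) X small(1)]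
    by blast+
  have \<Psi>: "profile M v \<Longrightarrow> profile M (\<Psi> v)"
    "profile M v \<Longrightarrow> profile M w \<Longrightarrow> (\<And>s. v s \<le> w s) \<Longrightarrow> \<Psi> v s \<le> \<Psi> w s" for v w s
    unfolding \<Psi>_def
    using B.profile_relax_step[OF R(2) h(2) f(2) Y small(2)] B.relax_step_mono[OF R(2) h(2) f(2) Y small(2)]
    by blast+
  \<comment> \<open>The least profile with the prescribed history. The first iterate lies above it,
    and monotonicity of the step carries this order through all iterates.\<close>
  define start where "start Z s = (if s \<le> T then Z s else 0)" for Z :: "real \<Rightarrow> real" and s
  have start: "profile M (start Z)" if "profile M Z" for Z
  proof -
    have [measurable]: "Z \<in> borel_measurable borel"
      using that by (simp add: profile_def)
    have "start Z \<in> borel_measurable borel"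
      unfolding start_def[abs_def] by measurable
    with that M show ?thesis
      by (auto simp: profile_def start_def)
  qed
  define W where "W n = ((\<lambda>p. (\<Phi> (snd p), \<Psi> (fst p))) ^^ n) (start X, start Y)" for n
  have W_0: "W 0 = (start X, start Y)" and W_Suc: "W (Suc n) = (\<Phi> (snd (W n)), \<Psi> (fst (W n)))" for n
    by (auto simp: W_def)
  have prof: "profile M (fst (W n)) \<and> profile M (snd (W n))" for n
    by (induction n) (auto simp: W_0 W_Suc start X Y \<Phi>(1) \<Psi>(1))
  have incr: "fst (W n) s \<le> fst (W (Suc n)) s \<and> snd (W n) s \<le> snd (W (Suc n)) s" for n s
  proof (induction n arbitrary: s)
    case 0
    have "0 \<le> \<Phi> (start Y) s" "0 \<le> \<Psi> (start X) s"
      using \<Phi>(1)[OF start[OF Y]] \<Psi>(1)[OF start[OF X]] by (auto simp: profile_def)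
    then show ?case
      by (auto simp: W_0 W_Suc start_def \<Phi>_def \<Psi>_def A.relax_step_def B.relax_step_def)
  next
    case (Suc n)
    have "\<Phi> (snd (W n)) s \<le> \<Phi> (snd (W (Suc n))) s"
      using Suc prof by (intro \<Phi>(2)) auto
    moreover have "\<Psi> (fst (W n)) s \<le> \<Psi> (fst (W (Suc n))) s"
      using Suc prof by (intro \<Psi>(2)) auto
    ultimately show ?case
      by (simp add: W_Suc)
  qed
  have conv: "\<exists>l. (\<lambda>n. g n s) \<longlonglongrightarrow> l" if "\<And>n. profile M (g n)" "\<And>n. g n s \<le> g (Suc n) s" for g s
  proof -
    have "incseq (\<lambda>n. g n s)"
      using that(2) by (rule incseq_SucI)
    then show ?thesis
      using that(1) incseq_convergent[of "\<lambda>n. g n s" M] unfolding profile_def by blast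
  qed
  obtain u where u: "\<And>s. (\<lambda>n. fst (W n) s) \<longlonglongrightarrow> u s"
    using conv[of "\<lambda>n. fst (W n)"] prof incr by metis
  obtain v where v: "\<And>s. (\<lambda>n. snd (W n) s) \<longlonglongrightarrow> v s"
    using conv[of "\<lambda>n. snd (W n)"] prof incr by metis
  have lim_prof: "profile M w" if g: "\<And>n. profile M (g n)" and w: "\<And>s. (\<lambda>n. g n s) \<longlonglongrightarrow> w s" for g w
    unfolding profile_def
  proof (intro conjI allI)
    have "g n \<in> borel_measurable borel" for n
      using g by (simp add: profile_def)
    then show "w \<in> borel_measurable borel"
      by (rule borel_measurable_LIMSEQ_real[OF w])
    show "0 \<le> w s" "w s \<le> M" for s
      using LIMSEQ_le_const[OF w] LIMSEQ_le_const2[OF w] g by (auto simp: profile_def)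
  qed
  show thesis
  proof (rule that)
    show "profile M u" "profile M v"
      using lim_prof[OF _ u] lim_prof[OF _ v] prof by auto
    have "(\<lambda>n. \<Phi> (snd (W n)) s) \<longlonglongrightarrow> \<Phi> v s" for s
      unfolding \<Phi>_def using prof v by (intro A.relax_step_tendsto[OF R(1) h(1) f(1) X small(1)]) auto
    moreover have "(\<lambda>n. \<Phi> (snd (W n)) s) \<longlonglongrightarrow> u s" for s
      using LIMSEQ_Suc[OF u[of s]] by (simp add: W_Suc)
    ultimately show "u = A.relax_step h1 R1 f1 X v"
      unfolding \<Phi>_def[symmetric] by (intro ext) (metis LIMSEQ_unique)
    have "(\<lambda>n. \<Psi> (fst (W n)) s) \<longlonglongrightarrow> \<Psi> u s" for s
      unfolding \<Psi>_def using prof u by (intro B.relax_step_tendsto[OF R(2) h(2) f(2) Y small(2)]) auto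
    moreover have "(\<lambda>n. \<Psi> (fst (W n)) s) \<longlonglongrightarrow> v s" for s
      using LIMSEQ_Suc[OF v[of s]] by (simp add: W_Suc)
    ultimately show "v = B.relax_step h2 R2 f2 Y u"
      unfolding \<Psi>_def[symmetric] by (intro ext) (metis LIMSEQ_unique)
  qed
qed

section \<open>Gluing a continuation to a bounded solution\<close>

lemma solution_continuous:
  assumes sol: "solution_on f1 f2 h1 h2 R1 R2 r1 r2 \<phi> \<psi> c x y"
    and init: "initial_function \<phi>" "initial_function \<psi>" and b: "ereal b < c"
  shows "continuous_on {..b} x" "continuous_on {..b} y"
proof -
  have c: "0 < c"
    using sol by (simp add: solution_on_def)
  have neg: "continuous_on {..0} x" "continuous_on {..0} y"
  proof -
    have "continuous_on {..0} x \<longleftrightarrow> continuous_on {..0} \<phi>" "continuous_on {..0} y \<longleftrightarrow> continuous_on {..0} \<psi>"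
      using sol by (auto simp: solution_on_def intro!: continuous_on_cong)
    then show "continuous_on {..0} x" "continuous_on {..0} y"
      using init by (auto simp: initial_function_def)
  qed
  have pos: "continuous_on {0..max 0 b} x" "continuous_on {0..max 0 b} y"
    using sol b c absolutely_continuous_imp_continuous[of 0 "max 0 b"]
    by (auto simp: solution_on_def max_def zero_ereal_def)
  have "{..max 0 b} = {..0} \<union> {0..max 0 b}"
    by auto
  then have "continuous_on {..max 0 b} x" "continuous_on {..max 0 b} y"
    using continuous_on_closed_Un[OF _ _ neg(1) pos(1)] continuous_on_closed_Un[OF _ _ neg(2) pos(2)]
    by auto
  then show "continuous_on {..b} x" "continuous_on {..b} y"
    by (auto elim: continuous_on_subset)
qed

text \<open>With \<open>x\<close> in \<open>[0, M]\<close> and its target in \<open>[0, N]\<close>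
  the derivative is at most \<open>B * (N + M)\<close> in absolute value almost everywhere. Hence
  \<open>x\<close> is Lipschitz up to \<open>T\<close> and has a left limit there, which defines
  \<open>X\<close> from \<open>T\<close> on.\<close>

lemma bounded_component_extension:
  assumes rate: "rate_function r" and "0 < T"
    and ac: "\<And>b. 0 \<le> b \<Longrightarrow> b < T \<Longrightarrow> absolutely_continuous_fun_on 0 b x"
    and cont: "\<And>b. b < T \<Longrightarrow> continuous_on {..b} x"
    and bound: "\<And>t. t < T \<Longrightarrow> 0 \<le> x t \<and> x t \<le> M"
    and deriv: "AE t in lebesgue. 0 \<le> t \<and> t < T \<longrightarrow> (x has_real_derivative r t * (D t - x t)) (at t)"
    and D: "\<And>t. 0 \<le> t \<Longrightarrow> t < T \<Longrightarrow> 0 \<le> D t \<and> D t \<le> N"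
  obtains X C where "\<And>t. t < T \<Longrightarrow> X t = x t" "profile M X"
    "\<And>u v. 0 \<le> u \<Longrightarrow> u \<le> v \<Longrightarrow> v \<le> T \<Longrightarrow> \<bar>X v - X u\<bar> \<le> C * (v - u)"
proof -
  obtain r' B where r': "\<And>t. 0 \<le> r' t" "\<And>t. r' t \<le> B" "AE t in lebesgue. 0 \<le> t \<longrightarrow> r' t = r t"
    using rate_function_bounded_version[OF rate] by metis
  have "0 \<le> B" "0 \<le> M" "0 \<le> N"
    using r'(1,2)[of 0] bound[of 0] D[of 0] \<open>0 < T\<close> by auto
  define C where "C = B * (N + M)"
  have "0 \<le> C"
    using \<open>0 \<le> B\<close> \<open>0 \<le> M\<close> \<open>0 \<le> N\<close> by (simp add: C_def)
  have lip: "\<bar>x v - x u\<bar> \<le> C * (v - u)" if uv: "0 \<le> u" "u \<le> v" "v < T" for u v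
  proof (rule absolutely_continuous_bounded_derivative)
    show "absolutely_continuous_fun_on u v x"
      using ac[of v] uv by (auto intro: absolutely_continuous_fun_on_subset)
    show "AE t in lebesgue. u < t \<and> t < v \<longrightarrow> (\<exists>d. (x has_real_derivative d) (at t) \<and> \<bar>d\<bar> \<le> C)"
      using deriv r'(3)
    proof eventually_elim
      case (elim t)
      show ?case
      proof
        assume t: "u < t \<and> t < v"
        then have "(x has_real_derivative r t * (D t - x t)) (at t)" and "r t = r' t"
          using elim uv by auto
        moreover have "\<bar>r' t * (D t - x t)\<bar> \<le> C"
          unfolding C_def abs_mult using r'(1,2)[of t] D[of t] bound[of t] t uv \<open>0 \<le> B\<close>
          by (intro mult_mono) auto
        ultimately show "\<exists>d. (x has_real_derivative d) (at t) \<and> \<bar>d\<bar> \<le> C"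
          by auto
      qed
    qed
  qed (use uv in auto)
  obtain l where l: "\<And>u. 0 \<le> u \<Longrightarrow> u < T \<Longrightarrow> \<bar>l - x u\<bar> \<le> C * (T - u)"
    using lipschitz_left_limit[OF lip \<open>0 < T\<close> \<open>0 \<le> C\<close>] by blast
  have "(x \<longlongrightarrow> l) (at_left T)"
  proof (rule LIM_zero_cancel, rule Lim_null_comparison)
    show "eventually (\<lambda>u. norm (x u - l) \<le> C * (T - u)) (at_left T)"
      using eventually_at_left_real[OF \<open>0 < T\<close>] by eventually_elim (use l in \<open>auto simp: abs_minus_commute\<close>)
    show "((\<lambda>u. C * (T - u)) \<longlongrightarrow> 0) (at_left T)"
      by (auto intro!: tendsto_eq_intros)
  qed
  moreover have "eventually (\<lambda>u. 0 \<le> x u \<and> x u \<le> M) (at_left T)"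
    using eventually_at_left_real[OF \<open>0 < T\<close>] by eventually_elim (use bound in auto)
  ultimately have l_bound: "0 \<le> l" "l \<le> M"
    by (auto intro: tendsto_lowerbound tendsto_upperbound elim: eventually_mono)
  define X where "X t = (if t < T then x t else l)" for t
  have "continuous_on {..<T} x"
  proof (subst continuous_on_eq_continuous_at)
    show "\<forall>t\<in>{..<T}. isCont x t"
    proof
      fix t assume "t \<in> {..<T}"
      then have "continuous_on {..<(t + T) / 2} x"
        by (intro continuous_on_subset[OF cont[of "(t + T) / 2"]]) auto
      with \<open>t \<in> {..<T}\<close> show "isCont x t"
        by (auto simp: continuous_on_eq_continuous_at)
    qed
  qed auto
  then have "(\<lambda>t. indicator {..<T} t *\<^sub>R x t + indicator {T..} t * l) \<in> borel_measurable borel"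
    by (intro borel_measurable_add borel_measurable_continuous_on_indicator borel_measurable_times) auto
  also have "(\<lambda>t. indicator {..<T} t *\<^sub>R x t + indicator {T..} t * l) = X"
    by (auto simp: X_def fun_eq_iff split: split_indicator)
  finally have "X \<in> borel_measurable borel" .
  moreover have "0 \<le> X t \<and> X t \<le> M" for t
    using bound l_bound by (simp add: X_def)
  ultimately have "profile M X"
    by (simp add: profile_def)
  moreover have "\<bar>X v - X u\<bar> \<le> C * (v - u)" if "0 \<le> u" "u \<le> v" "v \<le> T" for u v
    using lip[of u v] l[of u] that \<open>0 \<le> C\<close> by (cases "v < T"; cases "u < T") (auto simp: X_def)
  ultimately show thesis
    using that[of X C] by (simp add: X_def)
qed

lemma lipschitz_concat_absolutely_continuous:
  fixes w :: "real \<Rightarrow> real"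
  assumes left: "\<And>u v. a \<le> u \<Longrightarrow> u \<le> v \<Longrightarrow> v \<le> T \<Longrightarrow> \<bar>w v - w u\<bar> \<le> C * (v - u)"
    and right: "\<And>u v. T \<le> u \<Longrightarrow> u \<le> v \<Longrightarrow> v \<le> e \<Longrightarrow> \<bar>w v - w u\<bar> \<le> C' * (v - u)"
  shows "absolutely_continuous_fun_on a e w"
proof (rule lipschitz_imp_absolutely_continuous)
  fix u v assume uv: "a \<le> u" "u \<le> v" "v \<le> e"
  have le: "C * d \<le> max C C' * d" "C' * d \<le> max C C' * d" if "0 \<le> d" for d
    using that by (auto intro: mult_right_mono)
  consider "v \<le> T" | "T \<le> u" | "u < T" "T < v"
    by linarith
  then show "\<bar>w v - w u\<bar> \<le> max C C' * (v - u)"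
  proof cases
    case 3
    have "\<bar>w v - w u\<bar> \<le> C' * (v - T) + C * (T - u)"
      using left[of u T] right[of T v] uv 3 by auto
    also have "\<dots> \<le> max C C' * (v - T) + max C C' * (T - u)"
      using le 3 by (intro add_mono) auto
    finally show ?thesis
      by (simp add: algebra_simps)
  qed (use left[of u v] right[of u v] uv le[of "v - u"] in auto)
qed

context relaxation
begin

context
  fixes h f X :: "real \<Rightarrow> real" and R :: "real \<Rightarrow> real \<Rightarrow> real" and M :: real
  assumes R: "delay_distribution h R" and h: "delay h" and f: "production_function f"
    and X: "profile M X" and small: "X T + B * f M * (e - T) \<le> M"
begin

lemma relax_step_eq:
  assumes "profile M v" "T \<le> s" "s \<le> e"
  shows "relax_step h R f X v s = relax (X T) (delay_average h R f e v) s"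
  using assms relax_start[OF delay_average_props[OF R h f X small assms(1)]]
  by (cases "s = T") (auto simp: relax_step_def)

lemma AE_relax_step_derivative:
  assumes v: "profile M v"
  shows "AE t in lebesgue. T < t \<and> t < e \<longrightarrow>
    (relax_step h R f X v has_real_derivative
       r t * (delay_integral h R (\<lambda>s. f (v s)) t - relax_step h R f X v t)) (at t)"
  using AE_relax_derivative[OF delay_average_props[OF R h f X small v], of "X T"]
proof eventually_elim
  case (elim t)
  show ?case
  proof
    assume t: "T < t \<and> t < e"
    have "delay_average h R f e v t = delay_integral h R (\<lambda>s. f (v s)) t"
      using v t T M_nonneg[OF R h f X small]
      by (intro delay_average_eq[OF R h f, where M=M]) (auto simp: profile_def)
    then have "(relax (X T) (delay_average h R f e v) has_real_derivative
       r t * (delay_integral h R (\<lambda>s. f (v s)) t - relax_step h R f X v t)) (at t)"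
      using elim t relax_step_eq[OF v, of t] by simp
    then show "(relax_step h R f X v has_real_derivative
       r t * (delay_integral h R (\<lambda>s. f (v s)) t - relax_step h R f X v t)) (at t)"
      by (rule has_field_derivative_transform_within_open[where S="{T<..<e}"])
        (use t relax_step_eq[OF v] in auto)
  qed
qed

lemma relax_step_lipschitz:
  assumes v: "profile M v"
  obtains C where "\<And>s u. T \<le> s \<Longrightarrow> s \<le> u \<Longrightarrow> u \<le> e \<Longrightarrow>
    \<bar>relax_step h R f X v u - relax_step h R f X v s\<bar> \<le> C * (u - s)"
proof -
  let ?w = "relax_step h R f X v" and ?D = "delay_average h R f e v"
  note D = delay_average_props[OF R h f X small v]
  have w: "0 \<le> ?w t" "?w t \<le> M" for t
    using profile_relax_step[OF R h f X small v] by (auto simp: profile_def)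
  have "\<bar>relax (X T) ?D u - relax (X T) ?D s\<bar> \<le> B * (f M + M) * (u - s)"
    if su: "T \<le> s" "s \<le> u" "u \<le> e" for s u
  proof (rule absolutely_continuous_bounded_derivative)
    show "absolutely_continuous_fun_on s u (relax (X T) ?D)"
      using su by (intro absolutely_continuous_fun_on_subset[OF absolutely_continuous_relax[OF D]]) auto
    show "AE t in lebesgue. s < t \<and> t < u \<longrightarrow>
        (\<exists>d. (relax (X T) ?D has_real_derivative d) (at t) \<and> \<bar>d\<bar> \<le> B * (f M + M))"
      using AE_relax_derivative[OF D, of "X T"] r'_eq
    proof eventually_elim
      case (elim t)
      show ?case
      proof
        assume t: "s < t \<and> t < u"
        then have "(relax (X T) ?D has_real_derivative r t * (?D t - relax (X T) ?D t)) (at t)" "r t = r' t"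
          using elim su T by auto
        moreover have "\<bar>r' t * (?D t - relax (X T) ?D t)\<bar> \<le> B * (f M + M)"
          unfolding abs_mult
          using r'_nonneg[of t] r'_le[of t] D(2,3)[of t] w[of t] relax_step_eq[OF v, of t] t su B_nonneg
          by (intro mult_mono) auto
        ultimately show "\<exists>d. (relax (X T) ?D has_real_derivative d) (at t) \<and> \<bar>d\<bar> \<le> B * (f M + M)"
          by auto
      qed
    qed
  qed (use su in auto)
  then show thesis
    using relax_step_eq[OF v] by (intro that[of "B * (f M + M)"]) auto
qed

end

end

lemma delay_integral_bounds:
  assumes R: "delay_distribution h R" and h: "delay h" and f: "production_function f"
    and "0 \<le> t" and v: "continuous_on {..t} v" "\<And>s. s \<le> t \<Longrightarrow> 0 \<le> v s \<and> v s \<le> M"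
  shows "0 \<le> delay_integral h R (\<lambda>s. f (v s)) t \<and> delay_integral h R (\<lambda>s. f (v s)) t \<le> f M"
proof -
  have "h t \<le> t"
    using h \<open>0 \<le> t\<close> by (simp add: delay_def)
  have cont: "continuous_on {h t..t} (\<lambda>s. f (v s))"
    by (rule continuous_on_compose2[OF production_functionD(2)[OF f]])
      (use v in \<open>auto intro: continuous_on_subset\<close>)
  show ?thesis
    using delay_integral_sign[OF R \<open>0 \<le> t\<close> \<open>h t \<le> t\<close> cont, of 1 0]
      delay_integral_sign[OF R \<open>0 \<le> t\<close> \<open>h t \<le> t\<close> cont, of "-1" "f M"] v(2)
      production_functionD(1,4)[OF f] by auto
qed

lemma local_extension:
  assumes f: "production_function f1" "production_function f2"
    and h: "delay h1" "delay h2" and R: "delay_distribution h1 R1" "delay_distribution h2 R2"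
    and rate: "rate_function r1" "rate_function r2"
    and init: "initial_function \<phi>" "initial_function \<psi>"
    and sol: "solution_on f1 f2 h1 h2 R1 R2 r1 r2 \<phi> \<psi> (ereal T) x y"
    and bound: "\<And>t. t < T \<Longrightarrow> 0 \<le> x t \<and> x t \<le> M" "\<And>t. t < T \<Longrightarrow> 0 \<le> y t \<and> y t \<le> M"
  shows "\<exists>c' x' y'. ereal T < c' \<and> solution_on f1 f2 h1 h2 R1 R2 r1 r2 \<phi> \<psi> c' x' y' \<and>
    (\<forall>t. ereal t < ereal T \<longrightarrow> x' t = x t \<and> y' t = y t)"
proof -
  define D1 where "D1 = delay_integral h1 R1 (\<lambda>s. f1 (y s))"
  define D2 where "D2 = delay_integral h2 R2 (\<lambda>s. f2 (x s))"
  have T: "0 < T"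
    using sol by (simp add: solution_on_def zero_ereal_def)
  note cont = solution_continuous[OF sol init]
  have ac: "absolutely_continuous_fun_on 0 b x" "absolutely_continuous_fun_on 0 b y" if "0 \<le> b" "b < T" for b
    using sol that by (auto simp: solution_on_def)
  have deriv: "AE t in lebesgue. 0 \<le> t \<and> t < T \<longrightarrow>
      (x has_real_derivative r1 t * (D1 t - x t)) (at t) \<and> (y has_real_derivative r2 t * (D2 t - y t)) (at t)"
    using sol by (simp add: solution_on_def D1_def D2_def)
  have D1: "0 \<le> D1 t \<and> D1 t \<le> f1 M" if "0 \<le> t" "t < T" for t
    unfolding D1_def using that bound cont(2)[of t] by (intro delay_integral_bounds[OF R(1) h(1) f(1)]) auto
  have D2: "0 \<le> D2 t \<and> D2 t \<le> f2 M" if "0 \<le> t" "t < T" for t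
    unfolding D2_def using that bound cont(1)[of t] by (intro delay_integral_bounds[OF R(2) h(2) f(2)]) auto
  obtain X C1 where X: "\<And>t. t < T \<Longrightarrow> X t = x t" "profile M X"
    "\<And>u v. 0 \<le> u \<Longrightarrow> u \<le> v \<Longrightarrow> v \<le> T \<Longrightarrow> \<bar>X v - X u\<bar> \<le> C1 * (v - u)"
  proof (rule bounded_component_extension[OF rate(1) T ac(1) cont(1) bound(1) _ D1])
    show "AE t in lebesgue. 0 \<le> t \<and> t < T \<longrightarrow> (x has_real_derivative r1 t * (D1 t - x t)) (at t)"
      using deriv by eventually_elim auto
  qed auto
  obtain Y C2 where Y: "\<And>t. t < T \<Longrightarrow> Y t = y t" "profile M Y"
    "\<And>u v. 0 \<le> u \<Longrightarrow> u \<le> v \<Longrightarrow> v \<le> T \<Longrightarrow> \<bar>Y v - Y u\<bar> \<le> C2 * (v - u)"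
  proof (rule bounded_component_extension[OF rate(2) T ac(2) cont(2) bound(2) _ D2])
    show "AE t in lebesgue. 0 \<le> t \<and> t < T \<longrightarrow> (y has_real_derivative r2 t * (D2 t - y t)) (at t)"
      using deriv by eventually_elim auto
  qed auto
  obtain \<rho>1 where \<rho>1: "rate_primitive r1 \<rho>1"
    using rate_primitive_exists[OF rate(1)] by blast
  obtain \<rho>2 where \<rho>2: "rate_primitive r2 \<rho>2"
    using rate_primitive_exists[OF rate(2)] by blast
  obtain r1' B1 where r1': "r1' \<in> borel_measurable lebesgue" "\<And>t. 0 \<le> r1' t" "\<And>t. r1' t \<le> B1"
    "AE t in lebesgue. 0 \<le> t \<longrightarrow> r1' t = r1 t"
    using rate_function_bounded_version[OF rate(1)] by metis
  obtain r2' B2 where r2': "r2' \<in> borel_measurable lebesgue" "\<And>t. 0 \<le> r2' t" "\<And>t. r2' t \<le> B2"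
    "AE t in lebesgue. 0 \<le> t \<longrightarrow> r2' t = r2 t"
    using rate_function_bounded_version[OF rate(2)] by metis
  have "0 \<le> M"
    using bound(1)[OF T] by simp
  \<comment> \<open>The bound \<open>M + 1\<close> leaves room 1 for growth. At that level the
    components grow at speed at most \<open>k1\<close> and \<open>k2\<close>, and the length
    \<open>1 / (k1 + k2 + 1)\<close> chosen below keeps both increments within 1.\<close>
  define k1 where "k1 = B1 * f1 (M + 1)"
  define k2 where "k2 = B2 * f2 (M + 1)"
  have k: "0 \<le> k1" "0 \<le> k2"
    using r1'(2,3)[of 0] r2'(2,3)[of 0] \<open>0 \<le> M\<close> production_functionD(1)[OF f(1)] production_functionD(1)[OF f(2)]
    by (auto simp: k1_def k2_def)
  define e where "e = T + 1 / (k1 + k2 + 1)"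
  have "T < e" and small: "k1 * (e - T) \<le> 1" "k2 * (e - T) \<le> 1"
    using k by (auto simp: e_def divide_le_eq)
  interpret A: relaxation r1 \<rho>1 r1' B1 T e
    using \<rho>1 r1' T \<open>T < e\<close> by unfold_locales auto
  interpret B: relaxation r2 \<rho>2 r2' B2 T e
    using \<rho>2 r2' T \<open>T < e\<close> by unfold_locales auto
  have prof: "profile (M + 1) X" "profile (M + 1) Y"
    using X(2) Y(2) by (auto simp: profile_def intro: order_trans)
  have smallX: "X T + B1 * f1 (M + 1) * (e - T) \<le> M + 1"
    using X(2) small(1) by (auto simp: profile_def k1_def intro: add_mono)
  have smallY: "Y T + B2 * f2 (M + 1) * (e - T) \<le> M + 1"
    using Y(2) small(2) by (auto simp: profile_def k2_def intro: add_mono)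
  obtain u v where uv: "profile (M + 1) u" "profile (M + 1) v"
    "u = A.relax_step h1 R1 f1 X v" "v = B.relax_step h2 R2 f2 Y u"
    using local_fixed_point[OF f h R A.relaxation_axioms B.relaxation_axioms prof smallX smallY] by blast
  have u_X: "u t = X t" and v_Y: "v t = Y t" if "t \<le> T" for t
    using that by (simp_all add: uv(3)[unfolded A.relax_step_def fun_eq_iff] uv(4)[unfolded B.relax_step_def fun_eq_iff])
  have u_x: "u t = x t" and v_y: "v t = y t" if "t < T" for t
    using that u_X[of t] v_Y[of t] X(1) Y(1) by auto
  obtain C1' where "\<And>s t. T \<le> s \<Longrightarrow> s \<le> t \<Longrightarrow> t \<le> e \<Longrightarrow> \<bar>u t - u s\<bar> \<le> C1' * (t - s)"
    using A.relax_step_lipschitz[OF R(1) h(1) f(1) prof(1) smallX uv(2)] unfolding uv(3)[symmetric] by blast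
  then have "absolutely_continuous_fun_on 0 e u"
    using X(3) u_X by (intro lipschitz_concat_absolutely_continuous[where T=T and C=C1 and C'=C1']) auto
  moreover obtain C2' where "\<And>s t. T \<le> s \<Longrightarrow> s \<le> t \<Longrightarrow> t \<le> e \<Longrightarrow> \<bar>v t - v s\<bar> \<le> C2' * (t - s)"
    using B.relax_step_lipschitz[OF R(2) h(2) f(2) prof(2) smallY uv(1)] unfolding uv(4)[symmetric] by blast
  then have "absolutely_continuous_fun_on 0 e v"
    using Y(3) v_Y by (intro lipschitz_concat_absolutely_continuous[where T=T and C=C2 and C'=C2']) auto
  \<comment> \<open>The junction point \<open>T\<close> is discarded as a null set; a two-sided
    derivative need not exist there.\<close>
  moreover have "AE t in lebesgue. 0 \<le> t \<and> t < e \<longrightarrow>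
      (u has_real_derivative r1 t * (delay_integral h1 R1 (\<lambda>s. f1 (v s)) t - u t)) (at t) \<and>
      (v has_real_derivative r2 t * (delay_integral h2 R2 (\<lambda>s. f2 (u s)) t - v t)) (at t)"
    using deriv A.AE_relax_step_derivative[OF R(1) h(1) f(1) prof(1) smallX uv(2), folded uv(3)]
      B.AE_relax_step_derivative[OF R(2) h(2) f(2) prof(2) smallY uv(1), folded uv(4)]
      AE_completion[OF AE_lborel_singleton[of T]]
  proof eventually_elim
    case (elim t)
    show ?case
    proof
      assume t: "0 \<le> t \<and> t < e"
      show "(u has_real_derivative r1 t * (delay_integral h1 R1 (\<lambda>s. f1 (v s)) t - u t)) (at t) \<and>
          (v has_real_derivative r2 t * (delay_integral h2 R2 (\<lambda>s. f2 (u s)) t - v t)) (at t)"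
      proof (cases "t < T")
        case True
        have "D1 t = delay_integral h1 R1 (\<lambda>s. f1 (v s)) t" "D2 t = delay_integral h2 R2 (\<lambda>s. f2 (u s)) t"
          unfolding D1_def D2_def using True u_x v_y by (auto intro!: delay_integral_cong)
        then have "(x has_real_derivative r1 t * (delay_integral h1 R1 (\<lambda>s. f1 (v s)) t - u t)) (at t)"
          "(y has_real_derivative r2 t * (delay_integral h2 R2 (\<lambda>s. f2 (u s)) t - v t)) (at t)"
          using elim t True u_x v_y by auto
        then show ?thesis
          using True u_x v_y
          by (auto elim!: has_field_derivative_transform_within_open[where S="{..<T}"])
      qed (use elim t in auto)
    qed
  qed
  moreover have "\<forall>t\<le>0. u t = \<phi> t \<and> v t = \<psi> t"
    using sol u_x v_y T by (simp add: solution_on_def)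
  ultimately have "solution_on f1 f2 h1 h2 R1 R2 r1 r2 \<phi> \<psi> (ereal e) u v"
    using T \<open>T < e\<close> unfolding solution_on_def
    by (auto simp: zero_ereal_def intro: absolutely_continuous_fun_on_subset)
  with \<open>T < e\<close> u_x v_y show ?thesis
    by (intro exI[of _ "ereal e"] exI[of _ u] exI[of _ v]) auto
qed

section \<open>Invariant boxes\<close>

lemma solution_on_swap:
  "solution_on f1 f2 h1 h2 R1 R2 r1 r2 \<phi> \<psi> c x y \<longleftrightarrow> solution_on f2 f1 h2 h1 R2 R1 r2 r1 \<psi> \<phi> c y x"
  unfolding solution_on_def by (simp add: conj_commute)

lemma maximal_solution_swap:
  assumes "maximal_solution f1 f2 h1 h2 R1 R2 r1 r2 \<phi> \<psi> c x y"
  shows "maximal_solution f2 f1 h2 h1 R2 R1 r2 r1 \<psi> \<phi> c y x"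
  using assms unfolding maximal_solution_def solution_on_swap[of f2 f1 h2 h1 R2 R1 r2 r1 \<psi> \<phi>]
  by blast

lemma production_sign:
  assumes f: "production_function f" and \<sigma>: "\<sigma> = 1 \<or> \<sigma> = - 1"
    and "0 \<le> u" "0 \<le> q" "0 \<le> \<sigma> * (u - q)" "0 \<le> \<sigma> * (f q - p)"
  shows "0 \<le> \<sigma> * (f u - p)"
  using assms production_functionD(4)[OF f, of q u] production_functionD(4)[OF f, of u q] by auto

lemma delay_integral_production_sign:
  assumes R: "delay_distribution h R" and h: "delay h" and f: "production_function f"
    and \<sigma>: "\<sigma> = 1 \<or> \<sigma> = - 1" and t: "0 \<le> t" and v: "continuous_on {..t} v" "\<And>s. s \<le> t \<Longrightarrow> 0 \<le> v s"
    and q: "0 \<le> q" "\<And>s. h t \<le> s \<Longrightarrow> s \<le> t \<Longrightarrow> 0 \<le> \<sigma> * (v s - q)" and p: "0 \<le> \<sigma> * (f q - p)"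
  shows "0 \<le> \<sigma> * (delay_integral h R (\<lambda>s. f (v s)) t - p)"
proof (rule delay_integral_sign[OF R t])
  show "h t \<le> t"
    using h t by (simp add: delay_def)
  have "continuous_on {h t..t} v"
    using v(1) by (rule continuous_on_subset) simp
  moreover have "v ` {h t..t} \<subseteq> {0..}"
    using v(2) by auto
  ultimately show "continuous_on {h t..t} (\<lambda>s. f (v s))"
    by (rule continuous_on_compose2[OF production_functionD(2)[OF f]])
  show "0 \<le> \<sigma> * (f (v s) - p)" if "s \<in> {h t..t}" for s
  proof (rule production_sign[OF f \<sigma> _ q(1) _ p])
    show "0 \<le> v s" "0 \<le> \<sigma> * (v s - q)"
      using that v(2) q(2) by simp_all
  qed
qed

locale delay_solution =
  fixes f1 f2 h1 h2 :: "real \<Rightarrow> real" and R1 R2 :: "real \<Rightarrow> real \<Rightarrow> real"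
    and r1 r2 \<phi> \<psi> :: "real \<Rightarrow> real" and c :: ereal and x y \<rho>1 \<rho>2 :: "real \<Rightarrow> real"
  assumes f1: "production_function f1" and f2: "production_function f2"
    and h1: "delay h1" and h2: "delay h2"
    and R1: "delay_distribution h1 R1" and R2: "delay_distribution h2 R2"
    and r1: "rate_function r1" and r2: "rate_function r2"
    and init: "initial_function \<phi>" "initial_function \<psi>"
    and sol: "solution_on f1 f2 h1 h2 R1 R2 r1 r2 \<phi> \<psi> c x y"
    and \<rho>1: "rate_primitive r1 \<rho>1" and \<rho>2: "rate_primitive r2 \<rho>2"
begin

text \<open>Through this symmetry every statement about \<open>x\<close> also serves for
  \<open>y\<close>.\<close>

lemma swap: "delay_solution f2 f1 h2 h1 R2 R1 r2 r1 \<psi> \<phi> c y x \<rho>2 \<rho>1"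
  using f1 f2 h1 h2 R1 R2 r1 r2 init sol \<rho>1 \<rho>2 by unfold_locales (auto simp: solution_on_swap[of f2])

definition D1 where "D1 = delay_integral h1 R1 (\<lambda>s. f1 (y s))"
definition D2 where "D2 = delay_integral h2 R2 (\<lambda>s. f2 (x s))"

lemma swap_D: "delay_solution.D1 f2 h2 R2 x = D2" "delay_solution.D2 f1 h1 R1 y = D1"
  unfolding D1_def D2_def delay_solution.D1_def[OF swap] delay_solution.D2_def[OF swap] by simp_all

lemma c_pos: "0 < c"
  using sol by (simp add: solution_on_def)

lemma initial: "t \<le> 0 \<Longrightarrow> x t = \<phi> t" "t \<le> 0 \<Longrightarrow> y t = \<psi> t"
  using sol by (auto simp: solution_on_def)

lemma cont: "ereal b < c \<Longrightarrow> continuous_on {..b} x" "ereal b < c \<Longrightarrow> continuous_on {..b} y"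
  using solution_continuous[OF sol init] by auto

lemma less_c: "s \<le> t \<Longrightarrow> ereal t < c \<Longrightarrow> ereal s < c"
  using le_less_trans[of "ereal s" "ereal t" c] by simp

lemma comparison:
  assumes ab: "0 \<le> a" "a \<le> b" "ereal b < c" and D: "\<And>t. a < t \<Longrightarrow> t < b \<Longrightarrow> 0 \<le> \<sigma> * (D1 t - L)"
  shows "\<sigma> * (x a - L) * exp (\<rho>1 a) \<le> \<sigma> * (x b - L) * exp (\<rho>1 b)"
proof (rule relaxation_comparison[OF \<rho>1 _ ab(1,2)])
  show "0 \<le> r1 t" if "0 \<le> t" for t
    using r1 that by (simp add: rate_function_def)
  show "absolutely_continuous_fun_on a b x"
    using sol ab absolutely_continuous_fun_on_subset[of 0 b x a b] by (auto simp: solution_on_def)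
  have "AE t in lebesgue. 0 \<le> t \<and> ereal t < c \<longrightarrow> (x has_real_derivative r1 t * (D1 t - x t)) (at t)"
    using sol unfolding solution_on_def D1_def by (elim conjE, elim eventually_mono) auto
  then show "AE t in lebesgue. a < t \<and> t < b \<longrightarrow>
      (x has_real_derivative r1 t * (D1 t - x t)) (at t) \<and> 0 \<le> \<sigma> * (D1 t - L)"
  proof eventually_elim
    case (elim t)
    then show ?case
      using ab D[of t] less_c[of t b] by auto
  qed
qed

lemma comparison_nonneg:
  assumes "0 \<le> a" "a \<le> b" "ereal b < c" "\<And>t. a < t \<Longrightarrow> t < b \<Longrightarrow> 0 \<le> \<sigma> * (D1 t - L)"
  shows "0 \<le> \<sigma> * (x a - L) \<Longrightarrow> 0 \<le> \<sigma> * (x b - L)" "0 < \<sigma> * (x a - L) \<Longrightarrow> 0 < \<sigma> * (x b - L)"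
proof -
  note * = comparison[OF assms]
  show "0 \<le> \<sigma> * (x b - L)" if "0 \<le> \<sigma> * (x a - L)"
    using order_trans[OF mult_nonneg_nonneg[OF that exp_ge_zero] *] by (simp add: zero_le_mult_iff)
  show "0 < \<sigma> * (x b - L)" if "0 < \<sigma> * (x a - L)"
    using less_le_trans[OF mult_pos_pos[OF that exp_gt_zero] *] by (simp add: zero_less_mult_iff)
qed

text \<open>Up to the first time at which \<open>y\<close> fails to be strictly beyond
  \<open>q\<close>, the target of \<open>x\<close> is on the correct side, hence so is
  \<open>x\<close>, hence so is the target of \<open>y\<close>; the comparison then keeps
  \<open>y\<close> strictly beyond \<open>q\<close> at that very time. Strictness is needed in one
  component only, to make the set of failures closed and its least element contradictory.\<close>

lemma first_exit:
  assumes a: "0 \<le> a" "ereal a < c"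
    and H1: "\<And>t. a \<le> t \<Longrightarrow> ereal t < c \<Longrightarrow> (\<And>s. a \<le> s \<Longrightarrow> s \<le> t \<Longrightarrow> 0 \<le> \<sigma> * (y s - q)) \<Longrightarrow> 0 \<le> \<sigma> * (D1 t - p)"
    and H2: "\<And>t. a \<le> t \<Longrightarrow> ereal t < c \<Longrightarrow> (\<And>s. a \<le> s \<Longrightarrow> s \<le> t \<Longrightarrow> 0 \<le> \<sigma> * (x s - p)) \<Longrightarrow> 0 \<le> \<sigma> * (D2 t - q)"
    and start: "0 \<le> \<sigma> * (x a - p)" "0 < \<sigma> * (y a - q)"
    and t: "a \<le> t" "ereal t < c"
  shows "0 < \<sigma> * (y t - q)" "0 \<le> \<sigma> * (x t - p)" "0 < \<sigma> * (x a - p) \<Longrightarrow> 0 < \<sigma> * (x t - p)"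
proof -
  interpret S: delay_solution f2 f1 h2 h1 R2 R1 r2 r1 \<psi> \<phi> c y x \<rho>2 \<rho>1
    by (rule swap)
  have y_pos: "0 < \<sigma> * (y b - q)" if b: "a \<le> b" "ereal b < c" for b
  proof (rule ccontr)
    assume neg: "\<not> 0 < \<sigma> * (y b - q)"
    define Z where "Z = {s \<in> {a..b}. \<sigma> * (y s - q) \<le> 0}"
    have "continuous_on {a..b} (\<lambda>s. \<sigma> * (y s - q))"
      by (intro continuous_intros continuous_on_subset[OF cont(2)[OF b(2)]]) auto
    then have "closed Z"
      unfolding Z_def by (intro continuous_closed_preimage_constant continuous_on_closed_Collect_le continuous_on_const) auto
    moreover have "b \<in> Z" "bdd_below Z"
      using neg b by (auto simp: Z_def)
    ultimately have "Inf Z \<in> Z"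
      using closed_contains_Inf[of Z] by blast
    then have T: "a \<le> Inf Z" "Inf Z \<le> b" "\<sigma> * (y (Inf Z) - q) \<le> 0"
      by (auto simp: Z_def)
    have before: "0 < \<sigma> * (y s - q)" if "a \<le> s" "s < Inf Z" for s
      using that T cInf_lower[OF _ \<open>bdd_below Z\<close>, of s] by (fastforce simp: Z_def)
    have "0 \<le> \<sigma> * (D1 s - p)" if "a \<le> s" "s < Inf Z" for s
      using that before b T less_c[of s b] by (intro H1) (auto intro: less_imp_le)
    then have "0 \<le> \<sigma> * (x s - p)" if "a \<le> s" "s < Inf Z" for s
      using that b T less_c[of s b] start(1) a by (intro comparison_nonneg(1)[of a s]) auto
    then have "0 \<le> \<sigma> * (D2 s - q)" if "a \<le> s" "s < Inf Z" for s
      using that b T less_c[of s b] by (intro H2) auto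
    then have "0 < \<sigma> * (y (Inf Z) - q)"
      using a T b less_c[of "Inf Z" b] start(2)
      by (intro S.comparison_nonneg(2)[of a "Inf Z"]) (auto simp: swap_D)
    with T show False by simp
  qed
  have "0 \<le> \<sigma> * (D1 s - p)" if "a \<le> s" "s < t" for s
    using that y_pos less_c[OF _ t(2)] by (intro H1) (auto intro!: less_imp_le)
  then show "0 < \<sigma> * (y t - q)" "0 \<le> \<sigma> * (x t - p)" "0 < \<sigma> * (x a - p) \<Longrightarrow> 0 < \<sigma> * (x t - p)"
    using y_pos t a start comparison_nonneg[of a t \<sigma> p] by auto
qed

text \<open>The quadrant with corner \<open>p = q = 0\<close> is invariant, since
  \<open>f1 0\<close> and \<open>f2 0\<close> are nonnegative and so is the initial history.\<close>

lemma positive: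
  assumes "0 \<le> t" "ereal t < c"
  shows "0 < x t" "0 < y t"
proof -
  have x0: "0 < x 0" "0 < y 0" and past: "s \<le> 0 \<Longrightarrow> 0 \<le> x s" "s \<le> 0 \<Longrightarrow> 0 \<le> y s" for s
    using init initial by (cases "s = 0"; auto simp: initial_function_def)+
  have "0 \<le> 1 * (D1 t - 0)" if "0 \<le> t" "ereal t < c" "\<And>s. 0 \<le> s \<Longrightarrow> s \<le> t \<Longrightarrow> 0 \<le> 1 * (y s - 0)" for t
    unfolding D1_def
  proof (rule delay_integral_production_sign[OF R1 h1 f1 _ that(1) cont(2)[OF that(2)], where q=0])
    show "0 \<le> y s" if "s \<le> t" for s
      using that past[of s] \<open>\<And>s. 0 \<le> s \<Longrightarrow> s \<le> t \<Longrightarrow> 0 \<le> 1 * (y s - 0)\<close>[of s] by (cases "0 \<le> s") auto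
    then show "0 \<le> 1 * (y s - 0)" if "s \<le> t" for s
      using that by simp
  qed (use production_functionD(1)[OF f1, of 0] in auto)
  moreover have "0 \<le> 1 * (D2 t - 0)" if "0 \<le> t" "ereal t < c" "\<And>s. 0 \<le> s \<Longrightarrow> s \<le> t \<Longrightarrow> 0 \<le> 1 * (x s - 0)" for t
    unfolding D2_def
  proof (rule delay_integral_production_sign[OF R2 h2 f2 _ that(1) cont(1)[OF that(2)], where q=0])
    show "0 \<le> x s" if "s \<le> t" for s
      using that past[of s] \<open>\<And>s. 0 \<le> s \<Longrightarrow> s \<le> t \<Longrightarrow> 0 \<le> 1 * (x s - 0)\<close>[of s] by (cases "0 \<le> s") auto
    then show "0 \<le> 1 * (x s - 0)" if "s \<le> t" for s
      using that by simp
  qed (use production_functionD(1)[OF f2, of 0] in auto)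
  ultimately show "0 < x t" "0 < y t"
    using first_exit[of 0 1 0 0 t] assms x0 c_pos by (auto simp: zero_ereal_def)
qed

lemma nonneg: "ereal t < c \<Longrightarrow> 0 \<le> x t" "ereal t < c \<Longrightarrow> 0 \<le> y t"
proof -
  assume t: "ereal t < c"
  show "0 \<le> x t" "0 \<le> y t"
    using positive[of t] t init initial[of t] by (cases "0 \<le> t"; auto simp: initial_function_def)+
qed

lemma D1_sign:
  assumes "\<sigma> = 1 \<or> \<sigma> = - 1" "0 \<le> t" "ereal t < c" "0 \<le> q"
    and "\<And>s. h1 t \<le> s \<Longrightarrow> s \<le> t \<Longrightarrow> 0 \<le> \<sigma> * (y s - q)" "0 \<le> \<sigma> * (f1 q - p)"
  shows "0 \<le> \<sigma> * (D1 t - p)"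
  unfolding D1_def
  by (rule delay_integral_production_sign[OF R1 h1 f1 assms(1,2) cont(2)[OF assms(3)] nonneg(2) assms(4-6)])
    (use less_c assms in auto)

text \<open>The bounds close up: \<open>y\<close> beyond \<open>q\<close> puts the target of
  \<open>x\<close> beyond \<open>f1 q\<close>, which is beyond \<open>p\<close>, and symmetrically.
  Of the times up to \<open>a\<close>, \<open>past\<close> constrains only those not preceding a
  delayed argument at a later time, so the lemma also applies at late starting times.\<close>

lemma box:
  assumes \<sigma>: "\<sigma> = 1 \<or> \<sigma> = - 1" and pq: "0 \<le> p" "0 \<le> q" "0 \<le> \<sigma> * (f1 q - p)" "0 \<le> \<sigma> * (f2 p - q)"
    and a: "0 \<le> a" "ereal a < c"
    and past: "\<And>s t. a \<le> t \<Longrightarrow> ereal t < c \<Longrightarrow> s \<le> a \<Longrightarrow> h1 t \<le> s \<or> h2 t \<le> s \<Longrightarrow>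
      0 \<le> \<sigma> * (x s - p) \<and> 0 \<le> \<sigma> * (y s - q)"
    and start: "0 \<le> \<sigma> * (x a - p)" "0 < \<sigma> * (y a - q)"
    and t: "a \<le> t" "ereal t < c"
  shows "0 < \<sigma> * (y t - q)" "0 \<le> \<sigma> * (x t - p)" "0 < \<sigma> * (x a - p) \<Longrightarrow> 0 < \<sigma> * (x t - p)"
proof -
  interpret S: delay_solution f2 f1 h2 h1 R2 R1 r2 r1 \<psi> \<phi> c y x \<rho>2 \<rho>1
    by (rule swap)
  have "0 \<le> \<sigma> * (D1 t - p)" if t: "a \<le> t" "ereal t < c" "\<And>s. a \<le> s \<Longrightarrow> s \<le> t \<Longrightarrow> 0 \<le> \<sigma> * (y s - q)" for t
  proof (rule D1_sign[OF \<sigma> _ t(2) pq(2)])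
    show "0 \<le> \<sigma> * (y s - q)" if "h1 t \<le> s" "s \<le> t" for s
      using that t past[of t s] by (cases "a \<le> s") auto
  qed (use a t pq in auto)
  moreover have "0 \<le> \<sigma> * (D2 t - q)" if t: "a \<le> t" "ereal t < c" "\<And>s. a \<le> s \<Longrightarrow> s \<le> t \<Longrightarrow> 0 \<le> \<sigma> * (x s - p)" for t
    unfolding swap_D[symmetric]
  proof (rule S.D1_sign[OF \<sigma> _ t(2) pq(1)])
    show "0 \<le> \<sigma> * (x s - p)" if "h2 t \<le> s" "s \<le> t" for s
      using that t past[of t s] by (cases "a \<le> s") auto
  qed (use a t pq in auto)
  ultimately show "0 < \<sigma> * (y t - q)" "0 \<le> \<sigma> * (x t - p)" "0 < \<sigma> * (x a - p) \<Longrightarrow> 0 < \<sigma> * (x t - p)"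
    using first_exit[OF a _ _ start t] by blast+
qed

end

section \<open>Asymptotic bounds\<close>

text \<open>Suppose the values satisfying \<open>P\<close> had a supremum \<open>s < k\<close>. Then
  \<open>G s\<close> exceeds \<open>s\<close>, and by continuity a value \<open>u\<close> just below
  \<open>s\<close> with \<open>P u\<close> has \<open>G u\<close> above the midpoint of
  \<open>s\<close> and \<open>G s\<close>, so \<open>P\<close> holds beyond \<open>s\<close>. As
  \<open>P s\<close> itself is unknown, the step starts from \<open>u\<close>.\<close>

lemma downward_iteration:
  fixes G :: "real \<Rightarrow> real"
  assumes a: "P a" and down: "\<And>u v. P u \<Longrightarrow> v \<le> u \<Longrightarrow> P v"
    and G: "continuous_on {a..<k} G" "\<And>u. a \<le> u \<Longrightarrow> u < k \<Longrightarrow> u < G u"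
    and step: "\<And>u v. P u \<Longrightarrow> a \<le> u \<Longrightarrow> u < k \<Longrightarrow> v < G u \<Longrightarrow> P v"
    and v: "v < k"
  shows "P v"
proof (rule ccontr)
  assume "\<not> P v"
  define S where "S = {u. P u \<and> a \<le> u}"
  have less_v: "u < v" if "P u" for u
    using down[OF that, of v] \<open>\<not> P v\<close> by (meson not_le)
  have bdd: "bdd_above S"
    by (rule bdd_aboveI[of _ v]) (use less_v in \<open>auto simp: S_def intro: less_imp_le\<close>)
  have "a \<in> S"
    using a by (simp add: S_def)
  define s where "s = Sup S"
  have "a \<le> s"
    unfolding s_def using \<open>a \<in> S\<close> bdd by (rule cSup_upper)
  moreover have "s \<le> v"
    unfolding s_def using \<open>a \<in> S\<close> less_v by (intro cSup_least) (auto simp: S_def intro: less_imp_le)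
  ultimately have s: "a \<le> s" "s \<le> v"
    by auto
  with v have "s < G s"
    by (intro G(2)) auto
  obtain d where d: "d > 0" "\<And>u. u \<in> {a..<k} \<Longrightarrow> \<bar>u - s\<bar> < d \<Longrightarrow> \<bar>G u - G s\<bar> < (G s - s) / 2"
    using G(1)[unfolded continuous_on_iff, rule_format, of s "(G s - s) / 2"] s v \<open>s < G s\<close>
    by (auto simp: dist_real_def)
  obtain u where u: "u \<in> S" "s - d < u"
    using less_cSup_iff[OF _ bdd, of "s - d"] \<open>a \<in> S\<close> d(1) unfolding s_def by auto
  have "u \<le> s"
    unfolding s_def using u(1) bdd by (rule cSup_upper)
  have "P ((s + G s) / 2)"
  proof (rule step)
    show "P u" "a \<le> u"
      using u(1) by (auto simp: S_def)
    show "u < k"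
      using \<open>u \<le> s\<close> s v by simp
    then have "\<bar>G u - G s\<bar> < (G s - s) / 2"
      using \<open>a \<le> u\<close> \<open>u \<le> s\<close> u(2) by (intro d(2)) auto
    then show "(s + G s) / 2 < G u"
      using abs_ge_minus_self[of "G u - G s"] by (simp add: field_simps)
  qed
  then have "(s + G s) / 2 \<le> s"
    unfolding s_def[symmetric] using s \<open>s < G s\<close>
    by (subst (2) s_def) (intro cSup_upper bdd, auto simp: S_def)
  with \<open>s < G s\<close> show False by simp
qed

text \<open>Eventual bounds are available only strictly short of a limit value \<open>k\<close>. By
  continuity a slightly weaker \<open>p\<close> still produces the required strict
  inequality.\<close>

lemma continuous_on_bounded_point:
  fixes f :: "real \<Rightarrow> real"
  assumes f: "continuous_on {0..} f" and \<sigma>: "\<sigma> = 1 \<or> \<sigma> = - 1" and "0 \<le> k" "\<sigma> = 1 \<longrightarrow> 0 < k"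
    and less: "\<sigma> * q < \<sigma> * f k"
  obtains p where "0 \<le> p" "\<sigma> * p < \<sigma> * k" "\<sigma> * q < \<sigma> * f p"
proof -
  have "0 < \<bar>f k - q\<bar>"
    using less \<sigma> by auto
  then obtain d where d: "d > 0" "\<And>u. 0 \<le> u \<Longrightarrow> \<bar>u - k\<bar> < d \<Longrightarrow> \<bar>f u - f k\<bar> < \<bar>f k - q\<bar>"
    using f[unfolded continuous_on_iff, rule_format, of k "\<bar>f k - q\<bar>"] \<open>0 \<le> k\<close> by (auto simp: dist_real_def)
  \<comment> \<open>For lower bounds \<open>p\<close> moves down and \<open>k / 2\<close> keeps it
    nonnegative; for upper bounds it moves up.\<close>
  define p where "p = (if \<sigma> = 1 then max (k / 2) (k - d / 2) else k + d / 2)"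
  have "0 \<le> p" "\<sigma> * p < \<sigma> * k" "\<bar>p - k\<bar> < d"
    using assms(2-4) d(1) by (auto simp: p_def)
  moreover from this have "\<sigma> * q < \<sigma> * f p"
    using d(2)[of p] less \<sigma> by auto
  ultimately show thesis
    using that by blast
qed

lemma min_attained:
  fixes v :: "real \<Rightarrow> real"
  assumes "continuous_on {..b} v" "a \<le> b" "\<And>s. a \<le> s \<Longrightarrow> s \<le> b \<Longrightarrow> 0 < \<sigma> * (v s - k)"
  obtains m where "m \<in> {a..b}" "\<And>s. a \<le> s \<Longrightarrow> s \<le> b \<Longrightarrow> \<sigma> * (v m - k) \<le> \<sigma> * (v s - k)"
proof -
  have "continuous_on {a..b} (\<lambda>s. \<sigma> * (v s - k))"
    by (intro continuous_intros continuous_on_subset[OF assms(1)]) auto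
  then show thesis
    using continuous_attains_inf[of "{a..b}" "\<lambda>s. \<sigma> * (v s - k)"] that assms(2) by auto
qed

context delay_solution
begin

context
  assumes c_inf: "c = \<infinity>"
begin

text \<open>The initial deviation is damped by \<open>exp (- \<rho>1 t)\<close>, which tends to 0
  precisely because the primitive of the rate diverges.\<close>

lemma relaxes_to:
  assumes D: "eventually (\<lambda>t. 0 \<le> \<sigma> * (D1 t - L)) at_top" and "0 < \<eta>"
  shows "eventually (\<lambda>t. - \<eta> \<le> \<sigma> * (x t - L)) at_top"
proof -
  obtain T0 where T0: "\<And>t. T0 \<le> t \<Longrightarrow> 0 \<le> \<sigma> * (D1 t - L)"
    using D by (auto simp: eventually_at_top_linorder)
  define T where "T = max 0 T0"
  define A where "A = \<sigma> * (x T - L) * exp (\<rho>1 T)"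
  have "filterlim \<rho>1 at_top at_top"
    using \<rho>1 by (simp add: rate_primitive_def)
  then have "((\<lambda>t. exp (- \<rho>1 t)) \<longlongrightarrow> 0) at_top"
    by (intro filterlim_compose[OF exp_at_bot] filterlim_compose[OF filterlim_uminus_at_bot_at_top])
  then have "((\<lambda>t. A * exp (- \<rho>1 t)) \<longlongrightarrow> 0) at_top"
    by (rule tendsto_mult_right_zero)
  then have "eventually (\<lambda>t. - \<eta> < A * exp (- \<rho>1 t)) at_top"
    using \<open>0 < \<eta>\<close> by (intro order_tendstoD) auto
  then show ?thesis
    using eventually_ge_at_top[of T]
  proof eventually_elim
    case (elim t)
    have "A \<le> \<sigma> * (x t - L) * exp (\<rho>1 t)"
      unfolding A_def using elim T0 c_inf by (intro comparison) (auto simp: T_def)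
    then have "A * exp (- \<rho>1 t) \<le> \<sigma> * (x t - L) * exp (\<rho>1 t) * exp (- \<rho>1 t)"
      by (rule mult_right_mono) simp
    also have "\<dots> = \<sigma> * (x t - L)"
      by (simp add: exp_minus)
    finally show ?case
      using elim by simp
  qed
qed

lemma step_fst:
  assumes \<sigma>: "\<sigma> = 1 \<or> \<sigma> = - 1" and q: "0 \<le> q" "eventually (\<lambda>t. 0 \<le> \<sigma> * (y t - q)) at_top"
    and p: "\<sigma> * p < \<sigma> * f1 q"
  shows "eventually (\<lambda>t. 0 \<le> \<sigma> * (x t - p)) at_top"
proof -
  obtain T where T: "\<And>t. T \<le> t \<Longrightarrow> 0 \<le> \<sigma> * (y t - q)"
    using q(2) by (auto simp: eventually_at_top_linorder)
  have "eventually (\<lambda>t. T \<le> h1 t) at_top"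
    using h1 by (auto simp: delay_def filterlim_at_top)
  then have "eventually (\<lambda>t. 0 \<le> \<sigma> * (D1 t - f1 q)) at_top"
    using eventually_ge_at_top[of 0]
    by eventually_elim (use T c_inf in \<open>auto intro!: D1_sign[OF \<sigma> _ _ q(1)]\<close>)
  \<comment> \<open>The gap between \<open>p\<close> and \<open>f1 q\<close> is spent as the
    tolerance of the relaxation.\<close>
  from relaxes_to[OF this, of "\<sigma> * f1 q - \<sigma> * p"] p show ?thesis
    by (simp add: algebra_simps)
qed

end

lemma step_snd:
  assumes "c = \<infinity>" "\<sigma> = 1 \<or> \<sigma> = - 1" "0 \<le> p" "eventually (\<lambda>t. 0 \<le> \<sigma> * (x t - p)) at_top" "\<sigma> * q < \<sigma> * f2 p"
  shows "eventually (\<lambda>t. 0 \<le> \<sigma> * (y t - q)) at_top"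
  using delay_solution.step_fst[OF swap assms] .

lemma snd_limit:
  assumes "c = \<infinity>" and \<sigma>: "\<sigma> = 1 \<or> \<sigma> = - 1" and k: "0 \<le> k" "\<sigma> = 1 \<longrightarrow> 0 < k"
    and x: "\<And>p. \<sigma> * p < \<sigma> * k \<Longrightarrow> eventually (\<lambda>t. 0 \<le> \<sigma> * (x t - p)) at_top"
    and q: "\<sigma> * q < \<sigma> * f2 k"
  shows "eventually (\<lambda>t. 0 \<le> \<sigma> * (y t - q)) at_top"
proof -
  obtain p where "0 \<le> p" "\<sigma> * p < \<sigma> * k" "\<sigma> * q < \<sigma> * f2 p"
    using continuous_on_bounded_point[OF production_functionD(2)[OF f2] \<sigma> k q] by blast
  with x show ?thesis
    by (intro step_snd[OF assms(1) \<sigma>]) auto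
qed

text \<open>In the coordinate \<open>\<sigma> * p\<close> lower and upper bounds both improve
  upwards, so a single supremum argument covers the two directions. One round of improvement leads
  from \<open>x\<close> to \<open>y\<close> and back to \<open>x\<close>.\<close>

lemma fst_limit:
  assumes c: "c = \<infinity>" and \<sigma>: "\<sigma> = 1 \<or> \<sigma> = - 1"
    and p0: "eventually (\<lambda>t. 0 \<le> \<sigma> * (x t - p0)) at_top"
    and G: "\<And>p. \<sigma> * p0 \<le> \<sigma> * p \<Longrightarrow> \<sigma> * p < \<sigma> * k \<Longrightarrow> 0 < p \<and> \<sigma> * p < \<sigma> * f1 (f2 p)"
    and p: "\<sigma> * p < \<sigma> * k"
  shows "eventually (\<lambda>t. 0 \<le> \<sigma> * (x t - p)) at_top"
proof -
  have \<sigma>2: "\<sigma> * (\<sigma> * u) = u" for u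
    using \<sigma> by auto
  define P where "P u \<longleftrightarrow> eventually (\<lambda>t. 0 \<le> \<sigma> * x t - u) at_top" for u
  have P_iff: "eventually (\<lambda>t. 0 \<le> \<sigma> * (x t - u)) at_top \<longleftrightarrow> P (\<sigma> * u)" for u
    by (simp add: P_def right_diff_distrib)
  have "P (\<sigma> * p)"
  proof (rule downward_iteration[where P=P and a="\<sigma> * p0" and k="\<sigma> * k" and G="\<lambda>u. \<sigma> * f1 (f2 (\<sigma> * u))"])
    show "P (\<sigma> * p0)"
      using p0 by (simp add: P_iff)
    show "P v" if "P u" "v \<le> u" for u v
      using that unfolding P_def by (auto elim!: eventually_mono)
    have pos: "0 < \<sigma> * u" "u < \<sigma> * f1 (f2 (\<sigma> * u))" if "\<sigma> * p0 \<le> u" "u < \<sigma> * k" for u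
      using G[of "\<sigma> * u"] that by (auto simp: \<sigma>2)
    then show "u < \<sigma> * f1 (f2 (\<sigma> * u))" if "\<sigma> * p0 \<le> u" "u < \<sigma> * k" for u
      using that by blast
    have "continuous_on {\<sigma> * p0..<\<sigma> * k} (\<lambda>u. f2 (\<sigma> * u))"
    proof (rule continuous_on_compose2[OF production_functionD(2)[OF f2]])
      show "continuous_on {\<sigma> * p0..<\<sigma> * k} (\<lambda>u. \<sigma> * u)"
        by (intro continuous_intros)
      show "(\<lambda>u. \<sigma> * u) ` {\<sigma> * p0..<\<sigma> * k} \<subseteq> {0..}"
        using pos(1) by (auto intro: less_imp_le)
    qed
    moreover have "(\<lambda>u. f2 (\<sigma> * u)) ` {\<sigma> * p0..<\<sigma> * k} \<subseteq> {0..}"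
      using pos(1) production_functionD(1)[OF f2, OF less_imp_le] by auto
    ultimately have "continuous_on {\<sigma> * p0..<\<sigma> * k} (\<lambda>u. f1 (f2 (\<sigma> * u)))"
      by (rule continuous_on_compose2[OF production_functionD(2)[OF f1]])
    then show "continuous_on {\<sigma> * p0..<\<sigma> * k} (\<lambda>u. \<sigma> * f1 (f2 (\<sigma> * u)))"
      by (intro continuous_intros)
    show "P v" if u: "P u" "\<sigma> * p0 \<le> u" "u < \<sigma> * k" "v < \<sigma> * f1 (f2 (\<sigma> * u))" for u v
    proof -
      have "0 < f2 (\<sigma> * u)"
        using pos[OF u(2,3)] production_functionD(5)[OF f2] by blast
      moreover have "\<sigma> * (\<sigma> * v) < \<sigma> * f1 (f2 (\<sigma> * u))"
        using u(4) by (simp add: \<sigma>2)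
      \<comment> \<open>The bound \<open>f2 (\<sigma> * u)\<close> for \<open>y\<close> is not
        reached exactly; \<open>q\<close> is slightly weaker, yet \<open>f1 q\<close> still passes
        \<open>\<sigma> * v\<close>.\<close>
      ultimately obtain q where q: "0 \<le> q" "\<sigma> * q < \<sigma> * f2 (\<sigma> * u)" "\<sigma> * (\<sigma> * v) < \<sigma> * f1 q"
        using continuous_on_bounded_point[OF production_functionD(2)[OF f1] \<sigma>] by (metis less_imp_le)
      have "eventually (\<lambda>t. 0 \<le> \<sigma> * (x t - \<sigma> * u)) at_top"
        using u(1) by (simp add: P_iff \<sigma>2)
      then have "eventually (\<lambda>t. 0 \<le> \<sigma> * (y t - q)) at_top"
        using pos(1)[OF u(2,3)] q(2) by (intro step_snd[OF c \<sigma>, of "\<sigma> * u"]) auto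
      from step_fst[OF c \<sigma> q(1) this q(3)] show ?thesis
        by (simp add: P_iff \<sigma>2)
    qed
  qed (use p in auto)
  then show ?thesis
    by (simp add: P_iff)
qed

text \<open>Both components stay away from the equilibrium on a compact interval that contains all the
  arguments the equation uses later; this gives a strictly better invariant box.\<close>

lemma inner_box:
  assumes c: "c = \<infinity>" and \<sigma>: "\<sigma> = 1 \<or> \<sigma> = - 1" and Q: "0 \<le> Q" "0 \<le> \<sigma> * (f1 Q - K)"
    and t0: "0 \<le> t0" and strict: "\<And>t. t0 \<le> t \<Longrightarrow> 0 < \<sigma> * (x t - K) \<and> 0 < \<sigma> * (y t - Q)"
    and d: "0 < d" and G: "\<And>p. 0 < \<sigma> * (p - K) \<Longrightarrow> \<sigma> * (p - K) < d \<Longrightarrow> 0 < p \<and> \<sigma> * p \<le> \<sigma> * f1 (f2 p)"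
  obtains p where "0 < \<sigma> * (p - K)" "\<sigma> * (p - K) < d" "eventually (\<lambda>t. 0 \<le> \<sigma> * (x t - p)) at_top"
proof -
  interpret S: delay_solution f2 f1 h2 h1 R2 R1 r2 r1 \<psi> \<phi> c y x \<rho>2 \<rho>1
    by (rule swap)
  have "eventually (\<lambda>t. t0 \<le> h1 t \<and> t0 \<le> h2 t) at_top"
    using h1 h2 by (auto simp: delay_def filterlim_at_top eventually_conj_iff)
  then obtain T0 where T0: "\<And>t. T0 \<le> t \<Longrightarrow> t0 \<le> h1 t \<and> t0 \<le> h2 t"
    by (auto simp: eventually_at_top_linorder)
  \<comment> \<open>From \<open>T\<close> on, all delayed arguments are at least \<open>t0\<close>,
    so \<open>[t0, T]\<close> is the only part of the past that matters.\<close>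
  define T where "T = max T0 t0"
  have T: "t0 \<le> T" "ereal T < c"
    using c by (simp add: T_def, simp)
  obtain m where m: "m \<in> {t0..T}" "\<And>s. t0 \<le> s \<Longrightarrow> s \<le> T \<Longrightarrow> \<sigma> * (x m - K) \<le> \<sigma> * (x s - K)"
    using min_attained[OF cont(1)[OF T(2)] T(1), of \<sigma> K] strict by blast
  obtain n where n: "n \<in> {t0..T}" "\<And>s. t0 \<le> s \<Longrightarrow> s \<le> T \<Longrightarrow> \<sigma> * (y n - Q) \<le> \<sigma> * (y s - Q)"
    using min_attained[OF cont(2)[OF T(2)] T(1), of \<sigma> Q] strict by blast
  have y_n: "0 \<le> y n"
    using nonneg c by simp
  have "0 < \<sigma> * (f1 (y n) - K)"
    using strict[of n] n(1) \<sigma> Q y_n production_functionD(3)[OF f1, of Q "y n"] production_functionD(3)[OF f1, of "y n" Q]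
    by auto
  moreover have "0 < \<sigma> * (x m - K)"
    using strict m by auto
  \<comment> \<open>The shift below \<open>d\<close> makes \<open>G\<close> applicable at
    \<open>p\<close>, the third bound puts \<open>f1 (y n)\<close> beyond \<open>p\<close>, and the
    last one puts \<open>x\<close> strictly beyond \<open>p\<close> on
    \<open>[t0, T]\<close>.\<close>
  ultimately obtain \<delta> where \<delta>: "0 < \<delta>" "\<delta> < d" "\<delta> < \<sigma> * (f1 (y n) - K)" "\<delta> < \<sigma> * (x m - K)"
    using d field_lbound_gt_zero[of d "min (\<sigma> * (f1 (y n) - K)) (\<sigma> * (x m - K))"] by auto
  define p where "p = K + \<sigma> * \<delta>"
  have p_K: "\<sigma> * (p - K) = \<delta>"
    using \<sigma> by (auto simp: p_def)
  have p: "0 < p" "\<sigma> * p \<le> \<sigma> * f1 (f2 p)"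
    using G[of p] \<delta> by (auto simp: p_K)
  \<comment> \<open>The weaker of the bounds \<open>f2 p\<close> and \<open>y n\<close>:
    \<open>y\<close> satisfies it on \<open>[t0, T]\<close>, \<open>f2 p\<close> is on its correct
    side, and \<open>f1 q\<close> is beyond \<open>p\<close> in either case.\<close>
  define q where "q = (if \<sigma> * f2 p \<le> \<sigma> * y n then f2 p else y n)"
  have q: "0 \<le> q" "0 \<le> \<sigma> * (f2 p - q)" "0 \<le> \<sigma> * (f1 q - p)" "\<sigma> * q \<le> \<sigma> * y n"
    using y_n production_functionD(1)[OF f2, of p] p \<delta>(3) p_K by (auto simp: q_def algebra_simps)
  have x_p: "0 < \<sigma> * (x s - p)" if "t0 \<le> s" "s \<le> T" for s
    using m(2)[OF that] \<delta>(4) p_K by (simp add: algebra_simps)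
  have y_q: "0 \<le> \<sigma> * (y s - q)" if "t0 \<le> s" "s \<le> T" for s
    using n(2)[OF that] q(4) by (simp add: algebra_simps)
  have "0 < \<sigma> * (x t - p)" if "T \<le> t" for t
  \<comment> \<open>The components are exchanged because the box requires a strict start in its
    second component; here \<open>x\<close> is strict at \<open>T\<close>, while \<open>y\<close>
    may equal \<open>q\<close>.\<close>
  proof (rule S.box(1)[OF \<sigma> q(1) less_imp_le[OF p(1)] q(2,3), of T])
    show "0 \<le> \<sigma> * (y s - q) \<and> 0 \<le> \<sigma> * (x s - p)" if "T \<le> t" "s \<le> T" "h2 t \<le> s \<or> h1 t \<le> s" for s t
      using that T0[of t] x_p[of s] y_q[of s] by (auto simp: T_def)
  qed (use that c t0 T x_p[of T] y_q[of T] in auto)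
  then have "eventually (\<lambda>t. 0 \<le> \<sigma> * (x t - p)) at_top"
    by (intro eventually_at_top_linorderI[of T]) (auto intro: less_imp_le)
  then show thesis
    using that[of p] \<delta> by (simp add: p_K)
qed

end

section \<open>Solutions on either side of the equilibrium\<close>

text \<open>If \<open>f v\<close> were at least \<open>u\<close>, the intermediate value theorem
  would give a preimage of \<open>u\<close> at or below \<open>v\<close>; this preimage is then the
  value of the inverse. With the two lemmas on the reverse inequality and on equality, the
  hypotheses become comparisons of \<open>f1 (f2 u)\<close> with \<open>u\<close>.\<close>

lemma less_extended_inverse:
  assumes f: "production_function f" and v: "0 \<le> v" "ereal v < extended_inverse f u"
  shows "f v < u"
proof (rule ccontr)
  assume "\<not> f v < u"
  have "f 0 \<le> u"
    using v by (auto simp: extended_inverse_def zero_ereal_def split: if_splits)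
  moreover have "continuous_on {0..v} f"
    using production_functionD(2)[OF f] by (rule continuous_on_subset) simp
  ultimately obtain w where w: "0 \<le> w" "w \<le> v" "f w = u"
    using IVT'[of f 0 u v] \<open>\<not> f v < u\<close> v(1) by auto
  have "inj_on f {0..}"
    using f by (auto simp: production_function_def intro: strict_mono_on_imp_inj_on)
  then have "the_inv_into {0..} f u = w"
    using w the_inv_into_f_f[of f "{0..}" w] by simp
  moreover have "u \<in> f ` {0..}"
    using w by force
  ultimately have "extended_inverse f u = ereal w"
    using \<open>f 0 \<le> u\<close> by (simp add: extended_inverse_def)
  with v(2) w(2) show False by simp
qed

lemma extended_inverse_cases:
  assumes f: "production_function f" and "0 \<le> v" "extended_inverse f u \<le> ereal v"
  obtains "u < f 0" "extended_inverse f u = 0" | w where "0 \<le> w" "f w = u" "extended_inverse f u = ereal w"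
proof (cases "u < f 0")
  case False
  then have "u \<in> f ` {0..}"
    using assms(3) by (auto simp: extended_inverse_def split: if_splits)
  then obtain w where "0 \<le> w" "f w = u"
    by auto
  moreover have "inj_on f {0..}"
    using f by (auto simp: production_function_def intro: strict_mono_on_imp_inj_on)
  ultimately show thesis
    using False that(2)[of w] by (auto simp: extended_inverse_def the_inv_into_f_f)
qed (use that(1) in \<open>simp add: extended_inverse_def\<close>)

lemma extended_inverse_less:
  assumes f: "production_function f" and v: "0 \<le> v" "extended_inverse f u < ereal v"
  shows "u < f v"
  using extended_inverse_cases[OF f v(1) less_imp_le[OF v(2)]]
proof cases
  case 1
  then show ?thesis
    using production_functionD(4)[OF f, of 0 v] v(1) by simp
next
  case (2 w)
  then show ?thesis
    using v(2) production_functionD(3)[OF f, of w v] by simp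
qed

text \<open>Positivity of \<open>v\<close> excludes the conventional value 0 assigned below the
  range.\<close>

lemma extended_inverse_eq:
  assumes f: "production_function f" and v: "0 < v" "ereal v = extended_inverse f u"
  shows "f v = u"
proof -
  have "extended_inverse f u \<le> ereal v"
    using v(2) by simp
  with f less_imp_le[OF v(1)] show ?thesis
    by (cases rule: extended_inverse_cases) (use v in \<open>auto simp: zero_ereal_def\<close>)
qed

section \<open>Global existence, blow-up and a priori bounds\<close>

context delay_solution
begin

lemma initial_bounded: obtains B where "\<And>t. t \<le> 0 \<Longrightarrow> x t \<le> B"
proof -
  obtain B where "\<And>t. t \<le> 0 \<Longrightarrow> \<bar>\<phi> t\<bar> \<le> B"
    using init(1) by (auto simp: initial_function_def bounded_iff)
  then show thesis
    using that[of B] initial(1) by (auto simp: abs_le_iff)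
qed

lemma bounded_imp_global:
  assumes max: "maximal_solution f1 f2 h1 h2 R1 R2 r1 r2 \<phi> \<psi> c x y"
    and bound: "\<And>t. ereal t < c \<Longrightarrow> x t \<le> M \<and> y t \<le> M"
  shows "c = \<infinity>"
proof (cases c)
  case (real T)
  have "\<exists>c' x' y'. ereal T < c' \<and> solution_on f1 f2 h1 h2 R1 R2 r1 r2 \<phi> \<psi> c' x' y' \<and>
      (\<forall>t. ereal t < ereal T \<longrightarrow> x' t = x t \<and> y' t = y t)"
    using sol bound nonneg unfolding real
    by (intro local_extension[OF f1 f2 h1 h2 R1 R2 r1 r2 init]) auto
  with max show ?thesis
    unfolding maximal_solution_def real by blast
qed (use c_pos in auto)

text \<open>A bound on \<open>y\<close> bounds the target of \<open>x\<close>, so neither component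
  can become unbounded alone.\<close>

lemma bounded_fst:
  assumes "\<And>t. ereal t < c \<Longrightarrow> y t \<le> M"
  obtains M' where "\<And>t. ereal t < c \<Longrightarrow> x t \<le> M'"
proof -
  obtain B where B: "\<And>t. t \<le> 0 \<Longrightarrow> x t \<le> B"
    using initial_bounded by blast
  have "0 \<le> M"
    using assms[of 0] nonneg(2)[of 0] c_pos by (simp add: zero_ereal_def)
  define L where "L = max B (f1 M)"
  have "x t \<le> L" if "0 \<le> t" "ereal t < c" for t
  proof -
    have "0 \<le> - 1 * (x t - L)"
    proof (rule comparison_nonneg(1)[of 0])
      show "0 \<le> - 1 * (D1 s - L)" if "0 < s" "s < t" for s
        using that \<open>ereal t < c\<close> less_c[of _ t] assms \<open>0 \<le> M\<close> by (intro D1_sign[where q=M]) (auto simp: L_def)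
      show "0 \<le> - 1 * (x 0 - L)"
        using B[of 0] by (simp add: L_def)
    qed (use that in auto)
    then show ?thesis by simp
  qed
  moreover have "x t \<le> L" if "t \<le> 0" for t
    using B[OF that] by (simp add: L_def)
  ultimately show thesis
    by (intro that[of L]) (meson linear)
qed

text \<open>If \<open>x\<close> were bounded, so would be \<open>y\<close>, and the solution could
  be continued. As the target is nonnegative, \<open>x\<close> times \<open>exp\<close> of
  \<open>\<rho>1\<close> is nondecreasing, which turns unboundedness into divergence to
  infinity.\<close>

lemma blow_up_fst:
  assumes max: "maximal_solution f1 f2 h1 h2 R1 R2 r1 r2 \<phi> \<psi> c x y" and c: "c = ereal T"
  shows "filterlim x at_top (at_left T)"
proof -
  have T: "0 < T"
    using c c_pos by (simp add: zero_ereal_def)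
  have unbounded: "\<exists>t. 0 \<le> t \<and> t < T \<and> Z < x t" for Z
  proof (rule ccontr)
    assume *: "\<nexists>t. 0 \<le> t \<and> t < T \<and> Z < x t"
    obtain B where B: "\<And>t. t \<le> 0 \<Longrightarrow> x t \<le> B"
      using initial_bounded by blast
    have "x t \<le> Z" if "0 \<le> t" "t < T" for t
      using * that not_less by blast
    then have x: "x t \<le> max Z B" if "ereal t < c" for t
      using that B[of t] c by (cases "t \<le> 0") (auto simp: le_max_iff_disj)
    then obtain M where "\<And>t. ereal t < c \<Longrightarrow> y t \<le> M"
      using delay_solution.bounded_fst[OF swap] by blast
    with x have "c = \<infinity>"
      by (intro bounded_imp_global[OF max, of "max (max Z B) M"]) (auto simp: le_max_iff_disj)
    with c show False by simp
  qed
  show ?thesis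
    unfolding filterlim_at_top_gt[of _ _ 0]
  proof (intro allI impI)
    fix Z :: real assume "0 < Z"
    \<comment> \<open>The extra factor is the largest decay that \<open>x\<close> can suffer before
      \<open>T\<close>.\<close>
    obtain t0 where t0: "0 \<le> t0" "t0 < T" "Z * exp (\<rho>1 T - \<rho>1 0) < x t0"
      using unbounded by blast
    have "Z \<le> x t" if t: "t0 < t" "t < T" for t
    proof -
      have "1 * (x t0 - 0) * exp (\<rho>1 t0) \<le> 1 * (x t - 0) * exp (\<rho>1 t)"
      proof (rule comparison)
        show "0 \<le> 1 * (D1 s - 0)" if "t0 < s" "s < t" for s
          using that t t0 c nonneg(2) production_functionD(1)[OF f1, of 0] by (intro D1_sign[where q=0]) auto
      qed (use t0 t c in auto)
      moreover have "Z * exp (\<rho>1 T - \<rho>1 0) * exp (\<rho>1 t0) \<le> x t0 * exp (\<rho>1 t0)"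
        using t0 by (intro mult_right_mono) auto
      moreover have "Z * exp (\<rho>1 t) \<le> Z * exp (\<rho>1 T - \<rho>1 0) * exp (\<rho>1 t0)"
        using rate_primitive_mono[OF \<rho>1, of t T] rate_primitive_mono[OF \<rho>1, of 0 t0] t t0 \<open>0 < Z\<close>
        by (simp add: mult.assoc flip: exp_add)
      ultimately have "Z * exp (\<rho>1 t) \<le> x t * exp (\<rho>1 t)"
        unfolding mult_1 diff_0_right by linarith
      then show ?thesis by simp
    qed
    then show "eventually (\<lambda>t. Z \<le> x t) (at_left T)"
      using t0(2) by (auto simp: eventually_at_left_field)
  qed
qed

lemma bounded_above:
  assumes "0 < K" and G: "\<And>u. K < u \<Longrightarrow> f1 (f2 u) < u"
  obtains M where "\<And>t. ereal t < c \<Longrightarrow> x t \<le> M \<and> y t \<le> M"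
proof -
  obtain A where A: "\<And>t. t \<le> 0 \<Longrightarrow> x t \<le> A"
    using initial_bounded by blast
  obtain B where B: "\<And>t. t \<le> 0 \<Longrightarrow> y t \<le> B"
    using delay_solution.initial_bounded[OF swap] by blast
  \<comment> \<open>\<open>M\<close> and \<open>N\<close> close a box over the whole history.
    \<open>M \<ge> f1 N0\<close> settles \<open>f1 N \<le> M\<close> when \<open>N = N0\<close>;
    when \<open>N = f2 M\<close> it follows from \<open>M > K\<close> and \<open>G\<close>. Adding 1
    makes the start strict.\<close>
  define N0 where "N0 = max 0 B + 1"
  define M where "M = max (max (f1 N0) (A + 1)) (K + 1)"
  define N where "N = max N0 (f2 M)"
  have M: "0 \<le> M" "0 \<le> N" "f1 N \<le> M" "f2 M \<le> N"
    using \<open>0 < K\<close> G[of M] by (auto simp: M_def N_def N0_def max_def)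
  have x0: "x s < M" and y0: "y s < N" if "s \<le> 0" for s
    using A[OF that] B[OF that] by (auto simp: M_def N_def N0_def less_max_iff_disj)
  have "x t \<le> M \<and> y t \<le> N" if t: "0 \<le> t" "ereal t < c" for t
  proof -
    have "0 \<le> - 1 * (x t - M)" "0 < - 1 * (y t - N)"
      using M c_pos x0 y0
      by (intro box(1,2)[where a=0 and p=M and q=N, OF _ _ _ _ _ _ _ _ _ _ t]; auto simp: zero_ereal_def less_imp_le)+
    then show ?thesis by simp
  qed
  then show thesis
    using that[of "max M N"] x0 y0 by (meson le_max_iff_disj less_imp_le linear)
qed

section \<open>Strict separation from the equilibrium\<close>

context
  fixes K Q :: real
  assumes KQ: "0 < K" "0 < Q" "f1 Q = K" "f2 K = Q"
begin

text \<open>The corner of the box is the equilibrium itself, which the initial data may touch.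
  Strictness of \<open>y\<close> at time 0 starts the first exit argument; strictness of
  \<open>x\<close> is handled by exchanging the components.\<close>

lemma above_aux:
  assumes init: "\<And>t. t \<le> 0 \<Longrightarrow> K \<le> x t \<and> Q \<le> y t" and start: "Q < y 0" and t: "ereal t < c"
  shows "K \<le> x t" "Q \<le> y t" "0 \<le> t \<Longrightarrow> Q < y t"
proof -
  have "K \<le> x t \<and> Q < y t" if "0 \<le> t"
  proof -
    have "0 < 1 * (y t - Q)" "0 \<le> 1 * (x t - K)"
      using KQ c_pos init start
      by (intro box(1,2)[where a=0 and p=K and q=Q, OF _ _ _ _ _ _ _ _ _ _ that t]; auto simp: zero_ereal_def)+
    then show ?thesis by simp
  qed
  then show "K \<le> x t" "Q \<le> y t" "0 \<le> t \<Longrightarrow> Q < y t"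
    using init[of t] by (cases "0 \<le> t"; simp)+
qed

lemma below:
  assumes init: "\<And>t. t \<le> 0 \<Longrightarrow> x t < K \<and> y t < Q" and t: "ereal t < c"
  shows "x t < K" "y t < Q"
proof -
  have "x t < K \<and> y t < Q" if "0 \<le> t"
  proof -
    have "0 < - 1 * (y t - Q)" "0 < - 1 * (x t - K)"
      using KQ c_pos init
      by (intro box(1,3)[where a=0 and p=K and q=Q, OF _ _ _ _ _ _ _ _ _ _ that t]; auto simp: zero_ereal_def less_imp_le)+
    then show ?thesis by simp
  qed
  then show "x t < K" "y t < Q"
    using init[of t] by (cases "0 \<le> t"; simp)+
qed

text \<open>\<open>x\<close> may rest at \<open>K\<close> while \<open>r1\<close> vanishes or while
  the delays reach initial times with \<open>y\<close> equal to \<open>Q\<close>. After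
  \<open>T1\<close> the delayed arguments are nonnegative, so up to \<open>T2\<close> the target of
  \<open>x\<close> is at least \<open>f1 (y n) > K\<close>; \<open>T2\<close> is chosen so that
  \<open>\<rho>1\<close> has increased, and by then \<open>x\<close> has left
  \<open>K\<close>.\<close>

lemma strictly_above_aux:
  assumes c: "c = \<infinity>" and init: "\<And>t. t \<le> 0 \<Longrightarrow> K \<le> x t \<and> Q \<le> y t" and start: "Q < y 0"
  obtains t0 where "0 \<le> t0" "\<And>t. t0 \<le> t \<Longrightarrow> K < x t \<and> Q < y t"
proof -
  have c': "ereal t < c" for t
    using c by simp
  have above: "K \<le> x t" "Q \<le> y t" "0 \<le> t \<Longrightarrow> Q < y t" for t
    using above_aux[OF init start c'] by auto
  have "eventually (\<lambda>t. 0 \<le> h1 t) at_top"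
    using h1 by (auto simp: delay_def filterlim_at_top)
  then obtain T0 where T0: "\<And>t. T0 \<le> t \<Longrightarrow> 0 \<le> h1 t"
    by (auto simp: eventually_at_top_linorder)
  define T1 where "T1 = max 0 T0"
  have "eventually (\<lambda>t. \<rho>1 T1 < \<rho>1 t) at_top"
    using \<rho>1 by (auto simp: rate_primitive_def filterlim_at_top_dense)
  then obtain T2 where T2: "T1 < T2" "\<rho>1 T1 < \<rho>1 T2"
    using eventually_conj[OF eventually_gt_at_top[of T1]] eventually_happens'[of at_top] by (metis (mono_tags, lifting) trivial_limit_at_top_linorder)
  have "0 \<le> T1" "0 \<le> T2"
    using T2 by (auto simp: T1_def)
  obtain n where n: "n \<in> {0..T2}" "\<And>s. 0 \<le> s \<Longrightarrow> s \<le> T2 \<Longrightarrow> 1 * (y n - Q) \<le> 1 * (y s - Q)"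
    using min_attained[OF cont(2)[OF c'] \<open>0 \<le> T2\<close>, of 1 Q] above(3) by auto
  have "Q < y n"
    using above(3)[of n] n(1) by simp
  then have L: "K < f1 (y n)"
    using production_functionD(3)[OF f1, of Q "y n"] KQ by simp
  have "1 * (x T1 - f1 (y n)) * exp (\<rho>1 T1) \<le> 1 * (x T2 - f1 (y n)) * exp (\<rho>1 T2)"
  proof (rule comparison[OF \<open>0 \<le> T1\<close> less_imp_le[OF T2(1)] c'])
    show "0 \<le> 1 * (D1 t - f1 (y n))" if "T1 < t" "t < T2" for t
      using that T0[of t] n \<open>Q < y n\<close> KQ(2) c' by (intro D1_sign[where q="y n"]) (auto simp: T1_def)
  qed
  \<comment> \<open>The factor \<open>K - f1 (y n)\<close> is negative, so the increase of
    \<open>\<rho>1\<close> is the source of the strict inequality.\<close>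
  moreover have "(K - f1 (y n)) * exp (\<rho>1 T2) < (K - f1 (y n)) * exp (\<rho>1 T1)"
    using L T2(2) by (intro mult_strict_left_mono_neg) auto
  moreover have "(K - f1 (y n)) * exp (\<rho>1 T1) \<le> (x T1 - f1 (y n)) * exp (\<rho>1 T1)"
    using above(1) by (intro mult_right_mono) auto
  ultimately have "(K - f1 (y n)) * exp (\<rho>1 T2) < (x T2 - f1 (y n)) * exp (\<rho>1 T2)"
    unfolding mult_1 by linarith
  then have x_T2: "K < x T2"
    by simp
  have "K < x t \<and> Q < y t" if "T2 \<le> t" for t
  proof -
    have "0 < 1 * (x t - K)"
      using KQ x_T2 above \<open>0 \<le> T2\<close>
      by (intro box(3)[where a=T2 and p=K and q=Q, OF _ _ _ _ _ _ c' _ _ _ that c']) auto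
    then show ?thesis
      using above(3)[of t] \<open>0 \<le> T2\<close> that by simp
  qed
  with \<open>0 \<le> T2\<close> show thesis
    by (rule that)
qed

end

end

section \<open>Limits above and below the equilibrium\<close>

context delay_solution
begin

context
  fixes K Q :: real
  assumes KQ: "0 < K" "0 < Q" "f1 Q = K" "f2 K = Q"
begin

context
  assumes init: "\<And>t. t \<le> 0 \<Longrightarrow> K \<le> x t \<and> Q \<le> y t" and start: "K < x 0 \<or> Q < y 0"
begin

lemma above:
  assumes t: "ereal t < c"
  shows "K \<le> x t" "Q \<le> y t"
proof -
  have "K \<le> x t \<and> Q \<le> y t"
  proof (cases "Q < y 0")
    case True
    with init t show ?thesis
      using above_aux[OF KQ] by blast
  next
    case False
    with start have "K < x 0"
      by blast
    with init t show ?thesis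
      using delay_solution.above_aux[OF swap KQ(2,1,4,3)] by blast
  qed
  then show "K \<le> x t" "Q \<le> y t"
    by auto
qed

lemma strictly_above:
  assumes "c = \<infinity>"
  shows "\<exists>t0\<ge>0. \<forall>t\<ge>t0. K < x t \<and> Q < y t"
proof (cases "Q < y 0")
  case True
  show ?thesis
    by (rule strictly_above_aux[OF KQ assms init True]) auto
next
  case False
  with start have "K < x 0"
    by blast
  show ?thesis
    by (rule delay_solution.strictly_above_aux[OF swap KQ(2,1,4,3) assms _ \<open>K < x 0\<close>])
      (use init in auto)
qed

text \<open>Lower bounds are the invariant quadrant at the equilibrium. Upper bounds come from
  iterating down from a global bound \<open>M\<close>; this approaches \<open>K\<close> from the far
  side and so cannot stall before it.\<close>

lemma above_converges:
  assumes max: "maximal_solution f1 f2 h1 h2 R1 R2 r1 r2 \<phi> \<psi> c x y"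
    and G: "\<And>u. K < u \<Longrightarrow> f1 (f2 u) < u"
  shows "c = \<infinity> \<and> (x \<longlongrightarrow> K) at_top \<and> (y \<longlongrightarrow> Q) at_top"
proof -
  obtain M where M: "\<And>t. ereal t < c \<Longrightarrow> x t \<le> M \<and> y t \<le> M"
    using bounded_above[OF KQ(1) G] by blast
  have c: "c = \<infinity>"
    by (rule bounded_imp_global[OF max M])
  have x: "eventually (\<lambda>t. 0 \<le> - 1 * (x t - p)) at_top" if "- 1 * p < - 1 * K" for p
  proof (rule fst_limit[OF c _ _ _ that])
    show "eventually (\<lambda>t. 0 \<le> - 1 * (x t - M)) at_top"
      using M c by simp
    show "0 < p \<and> - 1 * p < - 1 * f1 (f2 p)" if "- 1 * p < - 1 * K" for p
      using that G[of p] KQ(1) by simp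
  qed simp
  have y: "eventually (\<lambda>t. 0 \<le> - 1 * (y t - q)) at_top" if "- 1 * q < - 1 * Q" for q
    using that KQ by (intro snd_limit[OF c _ _ _ x, where k=K]) auto
  have "(x \<longlongrightarrow> K) at_top"
  proof (rule order_tendstoI)
    fix a assume "K < a"
    then show "eventually (\<lambda>t. x t < a) at_top"
      using x[of "(a + K) / 2"] by (auto elim!: eventually_mono)
  qed (use above c in \<open>auto intro!: always_eventually intro: less_le_trans\<close>)
  moreover have "(y \<longlongrightarrow> Q) at_top"
  proof (rule order_tendstoI)
    fix a assume "Q < a"
    then show "eventually (\<lambda>t. y t < a) at_top"
      using y[of "(a + Q) / 2"] by (auto elim!: eventually_mono)
  qed (use above c in \<open>auto intro!: always_eventually intro: less_le_trans\<close>)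
  ultimately show ?thesis
    using c by simp
qed

lemma above_diverges:
  assumes c: "c = \<infinity>" and G: "\<And>u. K < u \<Longrightarrow> u < f1 (f2 u)"
  shows "filterlim x at_top at_top \<and> filterlim y at_top at_top"
proof -
  obtain t0 where t0: "0 \<le> t0" "\<And>t. t0 \<le> t \<Longrightarrow> K < x t \<and> Q < y t"
    using strictly_above[OF c] by blast
  obtain p0 where p0: "K < p0" "eventually (\<lambda>t. 0 \<le> 1 * (x t - p0)) at_top"
  proof (rule inner_box[OF c, of 1 Q K t0 1])
    show "0 < p \<and> 1 * p \<le> 1 * f1 (f2 p)" if "0 < 1 * (p - K)" for p
      using that G[of p] KQ(1) by simp
  qed (use KQ t0 in auto)
  have x: "eventually (\<lambda>t. 0 \<le> 1 * (x t - p)) at_top" for p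
    by (rule fst_limit[OF c _ p0(2), where k="p + 1"]) (use G KQ(1) p0(1) in auto)
  then have "filterlim x at_top at_top"
    by (simp add: filterlim_at_top)
  moreover have "eventually (\<lambda>t. Z \<le> y t) at_top" for Z
  proof -
    \<comment> \<open>Divergence of \<open>y\<close> needs \<open>f2\<close> to be unbounded. This
      is forced by \<open>G\<close>: if \<open>u\<close> exceeds \<open>f1 Z'\<close>, then so does
      \<open>f1 (f2 u)\<close>, and hence \<open>f2 u\<close> exceeds \<open>Z'\<close>.\<close>
    define Z' where "Z' = max Z 0"
    define u where "u = max (f1 Z') K + 1"
    have u: "f1 Z' < u" "K < u"
      by (auto simp: u_def)
    have "f1 Z' < f1 (f2 u)"
      using G[OF u(2)] u(1) by linarith
    then have "Z < f2 u"
      using production_functionD(4)[OF f1, of "f2 u" Z'] production_functionD(1)[OF f2, of u] KQ(1)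
      u(2) by (fastforce simp: Z'_def not_le[symmetric])
    then have "eventually (\<lambda>t. 0 \<le> 1 * (y t - Z)) at_top"
      using KQ(1) u(2) by (intro step_snd[OF c _ _ x, where p=u]) auto
    then show ?thesis by simp
  qed
  ultimately show ?thesis
    by (simp add: filterlim_at_top)
qed

end

context
  assumes init: "\<And>t. t \<le> 0 \<Longrightarrow> x t < K \<and> y t < Q"
    and max: "maximal_solution f1 f2 h1 h2 R1 R2 r1 r2 \<phi> \<psi> c x y"
begin

lemma below_global: "c = \<infinity>"
proof (rule bounded_imp_global[OF max])
  show "x t \<le> max K Q \<and> y t \<le> max K Q" if "ereal t < c" for t
    using below[OF KQ init that] by (auto simp: le_max_iff_disj)
qed

lemma below_strict: "x t < K" "y t < Q"
  using below[OF KQ init] below_global by auto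

lemma below_vanishes:
  assumes G: "\<And>u. 0 < u \<Longrightarrow> u < K \<Longrightarrow> f1 (f2 u) < u"
  shows "(x \<longlongrightarrow> 0) at_top \<and> (y \<longlongrightarrow> 0) at_top"
proof -
  note c = below_global
  \<comment> \<open>Needed to pass from \<open>x\<close> to \<open>y\<close> in the limit. Otherwise
    \<open>f1 (f2 u)\<close> would stay above the positive number \<open>f1 (f2 0)\<close> and could
    not lie below \<open>u\<close> for small \<open>u\<close>.\<close>
  have f2_0: "f2 0 = 0"
  proof (rule ccontr)
    assume "f2 0 \<noteq> 0"
    then have "0 < f2 0"
      using production_functionD(1)[OF f2, of 0] by simp
    then have pos: "0 < f1 (f2 0)"
      by (rule production_functionD(5)[OF f1])
    define u where "u = min (f1 (f2 0)) K / 2"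
    have u: "0 < u" "u < K" "u < f1 (f2 0)"
      using pos KQ(1) by (auto simp: u_def min_def)
    have "f1 (f2 0) \<le> f1 (f2 u)"
      using u production_functionD(1,4)[OF f2] by (intro production_functionD(4)[OF f1]) auto
    with G[OF u(1,2)] u(3) show False by simp
  qed
  obtain p0 where p0: "p0 < K" "eventually (\<lambda>t. 0 \<le> - 1 * (x t - p0)) at_top"
  proof (rule inner_box[OF c, of "- 1" Q K 0 K])
    show "0 < p \<and> - 1 * p \<le> - 1 * f1 (f2 p)" if "0 < - 1 * (p - K)" "- 1 * (p - K) < K" for p
      using that G[of p] by simp
  qed (use KQ below_strict in auto)
  have x: "eventually (\<lambda>t. 0 \<le> - 1 * (x t - p)) at_top" if "- 1 * p < - 1 * 0" for p
    by (rule fst_limit[OF c _ p0(2) _ that]) (use G p0(1) in auto)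
  have y: "eventually (\<lambda>t. 0 \<le> - 1 * (y t - q)) at_top" if "- 1 * q < - 1 * 0" for q
    using that f2_0 by (intro snd_limit[OF c _ _ _ x, where k=0]) auto
  have "(x \<longlongrightarrow> 0) at_top"
  proof (rule order_tendstoI)
    fix a :: real assume "0 < a"
    then show "eventually (\<lambda>t. x t < a) at_top"
      using x[of "a / 2"] by (auto elim!: eventually_mono)
  qed (use nonneg(1) c in \<open>auto intro!: always_eventually intro: less_le_trans\<close>)
  moreover have "(y \<longlongrightarrow> 0) at_top"
  proof (rule order_tendstoI)
    fix a :: real assume "0 < a"
    then show "eventually (\<lambda>t. y t < a) at_top"
      using y[of "a / 2"] by (auto elim!: eventually_mono)
  qed (use nonneg(2) c in \<open>auto intro!: always_eventually intro: less_le_trans\<close>)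
  ultimately show ?thesis ..
qed

lemma below_converges:
  assumes G: "\<And>u. 0 < u \<Longrightarrow> u < K \<Longrightarrow> u < f1 (f2 u)"
  shows "(x \<longlongrightarrow> K) at_top \<and> (y \<longlongrightarrow> Q) at_top"
proof -
  note c = below_global
  \<comment> \<open>The inner box is taken at the origin in place of the equilibrium, with
    positivity of the solution as the strict bound. The margin \<open>K\<close> keeps
    \<open>p\<close> in the range where \<open>G\<close> applies.\<close>
  obtain p0 where p0: "0 < p0" "eventually (\<lambda>t. 0 \<le> 1 * (x t - p0)) at_top"
  proof (rule inner_box[OF c, of 1 0 0 0 K])
    show "0 < p \<and> 1 * p \<le> 1 * f1 (f2 p)" if "0 < 1 * (p - 0)" "1 * (p - 0) < K" for p
      using that G[of p] by simp
    show "0 < 1 * (x t - 0) \<and> 0 < 1 * (y t - 0)" if "0 \<le> t" for t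
      using positive[OF that] c by simp
  qed (use KQ production_functionD(1)[OF f1, of 0] in auto)
  have x: "eventually (\<lambda>t. 0 \<le> 1 * (x t - p)) at_top" if "1 * p < 1 * K" for p
    by (rule fst_limit[OF c _ p0(2) _ that]) (use G p0(1) in auto)
  have y: "eventually (\<lambda>t. 0 \<le> 1 * (y t - q)) at_top" if "1 * q < 1 * Q" for q
    using that KQ by (intro snd_limit[OF c _ _ _ x, where k=K]) auto
  have "(x \<longlongrightarrow> K) at_top"
  proof (rule order_tendstoI)
    fix a assume "a < K"
    then show "eventually (\<lambda>t. a < x t) at_top"
      using x[of "(a + K) / 2"] by (auto elim!: eventually_mono)
  qed (use below_strict(1) in \<open>auto intro!: always_eventually intro: less_trans\<close>)
  moreover have "(y \<longlongrightarrow> Q) at_top"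
  proof (rule order_tendstoI)
    fix a assume "a < Q"
    then show "eventually (\<lambda>t. a < y t) at_top"
      using y[of "(a + Q) / 2"] by (auto elim!: eventually_mono)
  qed (use below_strict(2) in \<open>auto intro!: always_eventually intro: less_trans\<close>)
  ultimately show ?thesis ..
qed

end

end

end

theorem theorem3p10:
  fixes f1 f2 h1 h2 r1 r2 \<phi> \<psi> :: "real \<Rightarrow> real"
    and R1 R2 :: "real \<Rightarrow> real \<Rightarrow> real"
    and K :: real
  assumes "production_function f1" and "production_function f2"
    and "K > 0"
    and "delay h1" and "delay h2"
    and "delay_distribution h1 R1" and "delay_distribution h2 R2"
    and "rate_function r1" and "rate_function r2"
    and "initial_function \<phi>" and "initial_function \<psi>"
  shows
    "((\<forall>u>0. u \<noteq> K \<longrightarrow> ereal (f2 u) < extended_inverse f1 u) \<and>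
      ereal (f2 K) = extended_inverse f1 K \<longrightarrow>
      (\<forall>c x y. maximal_solution f1 f2 h1 h2 R1 R2 r1 r2 \<phi> \<psi> c x y \<longrightarrow>
        ((\<forall>t\<le>0. \<phi> t \<ge> K \<and> \<psi> t \<ge> f2 K) \<and> (\<phi> 0, \<psi> 0) \<noteq> (K, f2 K) \<longrightarrow>
           c = \<infinity> \<and> (x \<longlongrightarrow> K) at_top \<and> (y \<longlongrightarrow> f2 K) at_top) \<and>
        ((\<forall>t\<le>0. \<phi> t < K \<and> \<psi> t < f2 K) \<longrightarrow>
           c = \<infinity> \<and> (x \<longlongrightarrow> 0) at_top \<and> (y \<longlongrightarrow> 0) at_top)))
     \<and>
     ((\<forall>u>0. u \<noteq> K \<longrightarrow> ereal (f2 u) > extended_inverse f1 u) \<and>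
      ereal (f2 K) = extended_inverse f1 K \<longrightarrow>
      (\<forall>c x y. maximal_solution f1 f2 h1 h2 R1 R2 r1 r2 \<phi> \<psi> c x y \<longrightarrow>
        ((\<forall>t\<le>0. \<phi> t \<ge> K \<and> \<psi> t \<ge> f2 K) \<and> (\<phi> 0, \<psi> 0) \<noteq> (K, f2 K) \<longrightarrow>
           (c = \<infinity> \<longrightarrow> filterlim x at_top at_top \<and> filterlim y at_top at_top) \<and>
           (\<forall>T. c = ereal T \<longrightarrow>
              filterlim x at_top (at_left T) \<and> filterlim y at_top (at_left T))) \<and>
        ((\<forall>t\<le>0. \<phi> t < K \<and> \<psi> t < f2 K) \<longrightarrow>
           c = \<infinity> \<and> (x \<longlongrightarrow> K) at_top \<and> (y \<longlongrightarrow> f2 K) at_top)))"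
    (is "(?A \<and> ?B \<longrightarrow> ?concl1) \<and> (?C \<and> ?B \<longrightarrow> ?concl2)")
proof -
  obtain \<rho>1 where \<rho>1: "rate_primitive r1 \<rho>1"
    using rate_primitive_exists[OF assms(8)] by blast
  obtain \<rho>2 where \<rho>2: "rate_primitive r2 \<rho>2"
    using rate_primitive_exists[OF assms(9)] by blast
  have Q: "0 < f2 K" and f2_nonneg: "0 < u \<Longrightarrow> 0 \<le> f2 u" for u
    using production_functionD(1,5)[OF assms(2)] \<open>K > 0\<close> by auto
  have sol: "delay_solution f1 f2 h1 h2 R1 R2 r1 r2 \<phi> \<psi> c x y \<rho>1 \<rho>2"
    if "maximal_solution f1 f2 h1 h2 R1 R2 r1 r2 \<phi> \<psi> c x y" for c x y
    using that assms \<rho>1 \<rho>2 by unfold_locales (auto simp: maximal_solution_def)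
  have start: "x t = \<phi> t" "y t = \<psi> t"
    if "maximal_solution f1 f2 h1 h2 R1 R2 r1 r2 \<phi> \<psi> c x y" "t \<le> 0" for c x y t
    using that by (auto simp: maximal_solution_def solution_on_def)
  have "?concl1" if A: ?A and B: ?B
  proof -
    have K: "f1 (f2 K) = K"
      using extended_inverse_eq[OF assms(1) Q B] .
    have G: "f1 (f2 u) < u" if "0 < u" "u \<noteq> K" for u
      using A that f2_nonneg by (intro less_extended_inverse[OF assms(1)]) auto
    note KQ = \<open>K > 0\<close> Q K refl
    have "c = \<infinity> \<and> (x \<longlongrightarrow> K) at_top \<and> (y \<longlongrightarrow> f2 K) at_top"
      if max: "maximal_solution f1 f2 h1 h2 R1 R2 r1 r2 \<phi> \<psi> c x y"
        and above: "(\<forall>t\<le>0. \<phi> t \<ge> K \<and> \<psi> t \<ge> f2 K) \<and> (\<phi> 0, \<psi> 0) \<noteq> (K, f2 K)" for c x y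
    proof (rule delay_solution.above_converges[OF sol[OF max] KQ _ _ max])
      show "K \<le> x t \<and> f2 K \<le> y t" if "t \<le> 0" for t
        using above that start[OF max] by simp
      show "K < x 0 \<or> f2 K < y 0"
        using above start[OF max, of 0] by (auto simp: less_le)
    qed (use G \<open>K > 0\<close> in auto)
    moreover have "c = \<infinity> \<and> (x \<longlongrightarrow> 0) at_top \<and> (y \<longlongrightarrow> 0) at_top"
      if max: "maximal_solution f1 f2 h1 h2 R1 R2 r1 r2 \<phi> \<psi> c x y"
        and below: "\<forall>t\<le>0. \<phi> t < K \<and> \<psi> t < f2 K" for c x y
    proof -
      have init: "x t < K \<and> y t < f2 K" if "t \<le> 0" for t
        using below that start[OF max] by simp
      have "c = \<infinity>"
        by (rule delay_solution.below_global[OF sol[OF max] KQ _ max]) (rule init)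
      moreover have "(x \<longlongrightarrow> 0) at_top \<and> (y \<longlongrightarrow> 0) at_top"
        by (rule delay_solution.below_vanishes[OF sol[OF max] KQ _ max]) (use init G in auto)
      ultimately show ?thesis ..
    qed
    ultimately show ?thesis
      by blast
  qed
  moreover have "?concl2" if C: ?C and B: ?B
  proof -
    have K: "f1 (f2 K) = K"
      using extended_inverse_eq[OF assms(1) Q B] .
    have G: "u < f1 (f2 u)" if "0 < u" "u \<noteq> K" for u
      using C that f2_nonneg by (intro extended_inverse_less[OF assms(1)]) auto
    note KQ = \<open>K > 0\<close> Q K refl
    have "filterlim x at_top at_top \<and> filterlim y at_top at_top"
      if max: "maximal_solution f1 f2 h1 h2 R1 R2 r1 r2 \<phi> \<psi> c x y" and "c = \<infinity>"
        and above: "(\<forall>t\<le>0. \<phi> t \<ge> K \<and> \<psi> t \<ge> f2 K) \<and> (\<phi> 0, \<psi> 0) \<noteq> (K, f2 K)" for c x y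
    proof (rule delay_solution.above_diverges[OF sol[OF max] KQ _ _ \<open>c = \<infinity>\<close>])
      show "K \<le> x t \<and> f2 K \<le> y t" if "t \<le> 0" for t
        using above that start[OF max] by simp
      show "K < x 0 \<or> f2 K < y 0"
        using above start[OF max, of 0] by (auto simp: less_le)
    qed (use G \<open>K > 0\<close> in auto)
    \<comment> \<open>At a finite end point, maximality forces both components to infinity; for
      \<open>y\<close> the statement about \<open>x\<close> is read in the system with exchanged
      components.\<close>
    moreover have "filterlim x at_top (at_left T) \<and> filterlim y at_top (at_left T)"
      if max: "maximal_solution f1 f2 h1 h2 R1 R2 r1 r2 \<phi> \<psi> c x y" and "c = ereal T" for c x y T
      using delay_solution.blow_up_fst[OF sol[OF max] max that(2)]
        delay_solution.blow_up_fst[OF delay_solution.swap[OF sol[OF max]] maximal_solution_swap[OF max] that(2)]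
      by simp
    moreover have "c = \<infinity> \<and> (x \<longlongrightarrow> K) at_top \<and> (y \<longlongrightarrow> f2 K) at_top"
      if max: "maximal_solution f1 f2 h1 h2 R1 R2 r1 r2 \<phi> \<psi> c x y"
        and below: "\<forall>t\<le>0. \<phi> t < K \<and> \<psi> t < f2 K" for c x y
    proof -
      have init: "x t < K \<and> y t < f2 K" if "t \<le> 0" for t
        using below that start[OF max] by simp
      have "c = \<infinity>"
        by (rule delay_solution.below_global[OF sol[OF max] KQ _ max]) (rule init)
      moreover have "(x \<longlongrightarrow> K) at_top \<and> (y \<longlongrightarrow> f2 K) at_top"
        by (rule delay_solution.below_converges[OF sol[OF max] KQ _ max]) (use init G in auto)
      ultimately show ?thesis ..
    qed
    ultimately show ?thesis
      by blast
  qed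
  ultimately show ?thesis
    by blast
qed

end
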